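(* Let $\mathcal W=\{W_m\}_{m\in\mathbb N}$ be an $\mathrm{FB}$-module. (a) If $\mathcal W$ is representation stable ($\mathrm{RS}$), then $\mathcal W$ has a polynomial character ($\mathrm{PC}$), and $\operatorname{rank}_{\mathrm{PC}}(\mathcal W)\le \operatorname{rank}_{\mathrm{RS}}(\mathcal W)$. (b) If $\mathcal W$ is $\mathrm{PC}$ with polynomial character $P_{\mathcal W}$, then $\mathcal W$ is $\mathrm{RS}$ and $$\operatorname{rank}_{\mathrm{RS}}(\mathcal W)\le \max\{\operatorname{rank}_{\mathrm{PC}}(\mathcal W),\ 2\deg_{w}(P_{\mathcal W})\}.$$
   Context: $\mathbb N=\{0,1,2,\dots\}$. $\mathfrak S_m$ is the symmetric group on $\{1,\dots,m\}$. An $\mathfrak S_m$-module is a finite dimensional $\mathbb Q$-linear representation of $\mathfrak S_m$. An $\mathrm{FB}$-module is a family $\mathcal W=\{W_m\}_{m\in\mathbb N}$ where each $W_m$ is an $\mathfrak S_m$-module. For a partition $\nu$ of $m$, $V_\nu$ denotes the simple $\mathfrak S_m$-module associated with $\nu$ (so $V_{(m)}$ is the trivial module). For a partition $\lambda=(\lambda_1\ge\dots\ge\lambda_\ell)$ (possibly empty, in which case $|\lambda|=\lambda_1=0$) and $m\ge|\lambda|+\lambda_1$, put $\lambda[m]:=(m-|\lambda|,\lambda_1,\dots,\lambda_\ell)$, a partition of $m$. Representation stability: $\mathcal W$ is $\mathrm{RS}_{m\ge N}$ if there are natural numbers $n_\lambda$, indexed by the partitions $\lambda$ with $|\lambda|+\lambda_1\le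 N$ and independent of $m$, such that $W_m\cong\bigoplus_{\lambda}V_{\lambda[m]}^{\,n_\lambda}$ for all $m\ge N$. $\mathcal W$ is $\mathrm{RS}$ if it is $\mathrm{RS}_{m\ge N}$ for some $N\in\mathbb N$; the smallest such $N$ is $\operatorname{rank}_{\mathrm{RS}}(\mathcal W)$. Character polynomiality: let $\mathbb Q[\overline X]=\mathbb Q[X_1,X_2,\dots]$ and, for each $m$, let $\rho_m$ be the algebra homomorphism from $\mathbb Q[\overline X]$ to the algebra of $\mathbb Q$-valued class functions on $\mathfrak S_m$ sending $X_i$ to the function $g\mapsto X_i(g):=$ number of $i$-cycles in the decomposition of $g\in\mathfrak S_m$ into disjoint cycles (fixed points count as $1$-cycles). $\mathcal W$ is $\mathrm{PC}_{m\ge N}$ if there is $P_{\mathcal W}\in\mathbb Q[\overline X]$ such that the character of $W_m$ equals $\rho_m(P_{\mathcal W})$ for all $m\ge N$. $\mathcal W$ is $\mathrm{PC}$ if it is $\mathrm{PC}_{m\ge N}$ for some $N\in\mathbb N$; the smallest such $N$ is $\operatorname{rank}_{\mathrm{PC}}(\mathcal W)$; the polynomial $P_{\mathcal W}$ is then unique and is called the polynomial character of $\mathcal W$. $\deg_w$ is the weighted degree on $\mathbb Q[\overline X]$ with $\deg_w(X_i)=i$ (with $\deg_w(0)=-\infty$). *)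

theory Defs
  imports
    Complex_Main
    "HOL-Library.FuncSet"
    "HOL-Library.Function_Algebras"
    "HOL-Library.Poly_Mapping"
    "HOL-Library.Extended_Real"
    "HOL-Combinatorics.Permutations"
    "HOL-Combinatorics.Orbits"
begin

section \<open>Rational representations of the symmetric groups\<close>

text \<open>
  The underlying space of a representation is a subspace \<open>space V\<close> of a rational vector space
  whose elements are all the elements of the type \<open>'v\<close>. In this way a single type can hold the
  members of a family whose dimension varies. The symmetric group on \<open>{1..m}\<close> consists of the
  functions \<open>g\<close> with \<open>g permutes {1..m}\<close>; only their action on \<open>space V\<close> matters.
\<close>

record 'v sym_rep =
  scale :: "rat \<Rightarrow> 'v \<Rightarrow> 'v"
  space :: "'v set"
  act :: "(nat \<Rightarrow> nat) \<Rightarrow> 'v \<Rightarrow> 'v"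

definition sym_module :: "nat \<Rightarrow> 'v::ab_group_add sym_rep \<Rightarrow> bool" where
  "sym_module m V \<longleftrightarrow>
     vector_space (scale V) \<and>
     module.subspace (scale V) (space V) \<and>
     (\<exists>B. finite B \<and> module.span (scale V) B = space V) \<and>
     (\<forall>g. g permutes {1..m} \<longrightarrow>
        (\<forall>v\<in>space V. act V g v \<in> space V) \<and>
        (\<forall>v\<in>space V. \<forall>w\<in>space V. act V g (v + w) = act V g v + act V g w) \<and>
        (\<forall>c. \<forall>v\<in>space V. act V g (scale V c v) = scale V c (act V g v))) \<and>
     (\<forall>v\<in>space V. act V id v = v) \<and>
     (\<forall>g h. g permutes {1..m} \<longrightarrow> h permutes {1..m} \<longrightarrow>
        (\<forall>v\<in>space V. act V (g \<circ> h) v = act V g (act V h v)))"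

definition rep_iso :: "nat \<Rightarrow> 'v::ab_group_add sym_rep \<Rightarrow> 'w::ab_group_add sym_rep \<Rightarrow> bool" where
  "rep_iso m V W \<longleftrightarrow>
     (\<exists>f. bij_betw f (space V) (space W) \<and>
        (\<forall>v\<in>space V. \<forall>w\<in>space V. f (v + w) = f v + f w) \<and>
        (\<forall>c. \<forall>v\<in>space V. f (scale V c v) = scale W c (f v)) \<and>
        (\<forall>g. g permutes {1..m} \<longrightarrow> (\<forall>v\<in>space V. f (act V g v) = act W g (f v))))"

definition direct_sum :: "'i set \<Rightarrow> ('i \<Rightarrow> 'v::ab_group_add sym_rep) \<Rightarrow> ('i \<Rightarrow> 'v) sym_rep" where
  "direct_sum I F =
     \<lparr>scale = (\<lambda>c f i. scale (F i) c (f i)),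
      space = {f. (\<forall>i\<in>I. f i \<in> space (F i)) \<and> (\<forall>i. i \<notin> I \<longrightarrow> f i = 0) \<and> finite {i. f i \<noteq> 0}},
      act = (\<lambda>g f i. if i \<in> I then act (F i) g (f i) else 0)\<rparr>"

text \<open>
  The trace of \<open>f\<close> on the finite dimensional subspace \<open>V\<close>, computed in an arbitrary basis.
\<close>

definition trace_on :: "(rat \<Rightarrow> 'v::ab_group_add \<Rightarrow> 'v) \<Rightarrow> 'v set \<Rightarrow> ('v \<Rightarrow> 'v) \<Rightarrow> rat" where
  "trace_on s V f =
     (let B = (SOME B. \<not> module.dependent s B \<and> module.span s B = V)
      in \<Sum>b\<in>B. module.representation s B (f b) b)"

definition rep_character :: "'v::ab_group_add sym_rep \<Rightarrow> (nat \<Rightarrow> nat) \<Rightarrow> rat" where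
  "rep_character V g = trace_on (scale V) (space V) (act V g)"

definition FB_module :: "(nat \<Rightarrow> 'v::ab_group_add sym_rep) \<Rightarrow> bool" where
  "FB_module W \<longleftrightarrow> (\<forall>m. sym_module m (W m))"


section \<open>Partitions and Specht modules\<close>

definition is_partition :: "nat list \<Rightarrow> bool" where
  "is_partition l \<longleftrightarrow> sorted_wrt (\<ge>) l \<and> 0 \<notin> set l"

definition first_part :: "nat list \<Rightarrow> nat" where
  "first_part l = (case l of [] \<Rightarrow> 0 | k # _ \<Rightarrow> k)"

text \<open>
  The partition \<open>\<lambda>[m]\<close>, for \<open>m \<ge> |\<lambda>| + \<lambda>\<^sub>1\<close>. The filter only matters for \<open>m = 0\<close>
  and \<open>\<lambda> = \<emptyset>\<close>, where \<open>\<lambda>[0]\<close> is the empty partition.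
\<close>

definition padded :: "nat list \<Rightarrow> nat \<Rightarrow> nat list" where
  "padded l m = filter (\<lambda>k. 0 < k) ((m - sum_list l) # l)"

text \<open>
  The simple module \<open>V\<^sub>\<nu>\<close> is the Specht module, the span of the polytabloids in the permutation
  module of the tabloids of shape \<open>\<nu>\<close>. A tableau is given by the map \<open>t\<close> sending an entry
  \<open>k \<in> {1..m}\<close> to its cell (row, column), so that the tableau \<open>\<sigma>t\<close> is \<open>t \<circ> \<sigma>\<^sup>-\<^sup>1\<close>.
  A tabloid is given by the map sending each entry to its row, and a vector of the permutation
  module is a function from tabloids to coefficients.
\<close>

definition cells :: "nat list \<Rightarrow> (nat \<times> nat) set" where
  "cells \<nu> = {(i, j). i < length \<nu> \<and> j < \<nu> ! i}"

definition is_tableau :: "nat list \<Rightarrow> (nat \<Rightarrow> nat \<times> nat) \<Rightarrow> bool" where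
  "is_tableau \<nu> t \<longleftrightarrow> bij_betw t {1..sum_list \<nu>} (cells \<nu>)"

definition tabloid :: "nat list \<Rightarrow> (nat \<Rightarrow> nat \<times> nat) \<Rightarrow> nat \<Rightarrow> nat" where
  "tabloid \<nu> t = restrict (\<lambda>k. fst (t k)) {1..sum_list \<nu>}"

definition column_stabilizer :: "nat list \<Rightarrow> (nat \<Rightarrow> nat \<times> nat) \<Rightarrow> (nat \<Rightarrow> nat) set" where
  "column_stabilizer \<nu> t =
     {\<sigma>. \<sigma> permutes {1..sum_list \<nu>} \<and> (\<forall>k\<in>{1..sum_list \<nu>}. snd (t (\<sigma> k)) = snd (t k))}"

definition polytabloid :: "nat list \<Rightarrow> (nat \<Rightarrow> nat \<times> nat) \<Rightarrow> (nat \<Rightarrow> nat) \<Rightarrow> rat" where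
  "polytabloid \<nu> t =
     (\<lambda>r. \<Sum>\<sigma>\<in>column_stabilizer \<nu> t.
        of_int (sign \<sigma>) * (if r = tabloid \<nu> (t \<circ> inv \<sigma>) then 1 else 0))"

text \<open>
  A permutation \<open>g\<close> sends the tabloid \<open>r\<close> to \<open>r \<circ> g\<^sup>-\<^sup>1\<close>, hence the coefficient of \<open>r\<close> in the
  image of a vector \<open>v\<close> is \<open>v (r \<circ> g)\<close>.
\<close>

definition specht :: "nat list \<Rightarrow> ((nat \<Rightarrow> nat) \<Rightarrow> rat) sym_rep" where
  "specht \<nu> =
     \<lparr>scale = (\<lambda>c v r. c * v r),
      space = module.span (\<lambda>c v r. c * v r) (polytabloid \<nu> ` {t. is_tableau \<nu> t}),
      act = (\<lambda>g v r. v (r \<circ> g))\<rparr>"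


section \<open>Representation stability\<close>

definition stable_partitions :: "nat \<Rightarrow> nat list set" where
  "stable_partitions N = {l. is_partition l \<and> sum_list l + first_part l \<le> N}"

definition RS_from :: "nat \<Rightarrow> (nat \<Rightarrow> 'v::ab_group_add sym_rep) \<Rightarrow> bool" where
  "RS_from N W \<longleftrightarrow>
     (\<exists>n :: nat list \<Rightarrow> nat. \<forall>m\<ge>N.
        rep_iso m (W m)
          (direct_sum {(l, j). l \<in> stable_partitions N \<and> j < n l} (\<lambda>(l, j). specht (padded l m))))"

definition RS :: "(nat \<Rightarrow> 'v::ab_group_add sym_rep) \<Rightarrow> bool" where
  "RS W \<longleftrightarrow> (\<exists>N. RS_from N W)"

definition rank_RS :: "(nat \<Rightarrow> 'v::ab_group_add sym_rep) \<Rightarrow> nat" where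
  "rank_RS W = (LEAST N. RS_from N W)"


section \<open>Polynomial characters\<close>

text \<open>
  The polynomial ring in the variables \<open>X\<^sub>1, X\<^sub>2, \<dots>\<close>. A monomial is its finitely supported
  family of exponents, where the exponent at index \<open>i\<close> belongs to the variable \<open>X\<^sub>i\<^sub>+\<^sub>1\<close>: the
  shift by one makes every element of the type a polynomial in these variables.
\<close>

type_synonym monomial = "nat \<Rightarrow>\<^sub>0 nat"
type_synonym cycle_poly = "monomial \<Rightarrow>\<^sub>0 rat"

definition cycle_count :: "nat \<Rightarrow> nat \<Rightarrow> (nat \<Rightarrow> nat) \<Rightarrow> nat" where
  "cycle_count m i g = card {C \<in> orbit g ` {1..m}. card C = i}"

text \<open>
  The algebra homomorphism \<open>\<rho>\<^sub>m\<close>: its value at \<open>P\<close> is the function on the symmetric group on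
  \<open>{1..m}\<close> obtained by substituting for each \<open>X\<^sub>i\<close> the number of \<open>i\<close>-cycles.
\<close>

definition rho :: "nat \<Rightarrow> cycle_poly \<Rightarrow> (nat \<Rightarrow> nat) \<Rightarrow> rat" where
  "rho m P g =
     (\<Sum>a\<in>Poly_Mapping.keys P. Poly_Mapping.lookup P a *
        (\<Prod>i\<in>Poly_Mapping.keys a. of_nat (cycle_count m (i + 1) g) ^ Poly_Mapping.lookup a i))"

definition weight :: "monomial \<Rightarrow> nat" where
  "weight a = (\<Sum>i\<in>Poly_Mapping.keys a. (i + 1) * Poly_Mapping.lookup a i)"

definition deg_w :: "cycle_poly \<Rightarrow> ereal" where
  "deg_w P = (if P = 0 then -\<infinity> else ereal (real (Max (weight ` Poly_Mapping.keys P))))"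

definition polynomial_from :: "nat \<Rightarrow> (nat \<Rightarrow> 'v::ab_group_add sym_rep) \<Rightarrow> cycle_poly \<Rightarrow> bool" where
  "polynomial_from N W P \<longleftrightarrow>
     (\<forall>m\<ge>N. \<forall>g. g permutes {1..m} \<longrightarrow> rep_character (W m) g = rho m P g)"

definition PC_from :: "nat \<Rightarrow> (nat \<Rightarrow> 'v::ab_group_add sym_rep) \<Rightarrow> bool" where
  "PC_from N W \<longleftrightarrow> (\<exists>P. polynomial_from N W P)"

definition PC :: "(nat \<Rightarrow> 'v::ab_group_add sym_rep) \<Rightarrow> bool" where
  "PC W \<longleftrightarrow> (\<exists>N. PC_from N W)"

definition rank_PC :: "(nat \<Rightarrow> 'v::ab_group_add sym_rep) \<Rightarrow> nat" where
  "rank_PC W = (LEAST N. PC_from N W)"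

definition polynomial_character :: "(nat \<Rightarrow> 'v::ab_group_add sym_rep) \<Rightarrow> cycle_poly" where
  "polynomial_character W = (THE P. \<exists>N. polynomial_from N W P)"

end

theory Submission
  imports Defs
begin

text \<open>
  Everything rests on one formula for the character of the Specht module of a partition \<open>\<nu>\<close>. Let
  \<open>\<chi>\<^sub>\<alpha>\<close> be the character of the permutation module on the colourings of \<open>{1..m}\<close> in which the
  colour \<open>i\<close> occurs \<open>\<alpha> i\<close> times. The claim is that the Specht character is the alternating sum
  of the \<open>\<chi>\<^sub>\<alpha>\<close> with \<open>\<alpha> i = \<nu> i + \<pi> i - i\<close>, over the permutations \<open>\<pi>\<close> of the indices: the
  determinantal formula of Jacobi and Trudi (\<open>specht_character_jacobi_trudi\<close>).

  It gives both parts. For \<open>\<nu> = \<lambda>[m]\<close> only the multiplicity of the colour \<open>0\<close> depends on \<open>m\<close>, and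
  a colouring is determined by its other colours. Colourings fixed by \<open>g\<close> are colourings of the
  cycles of \<open>g\<close>, and counting them with the other multiplicities prescribed is a polynomial in the
  numbers of cycles whose weighted degree is at most the number of points with those colours. Hence
  for all \<open>m \<ge> |\<lambda>| + \<lambda>\<^sub>1\<close> the character of \<open>V\<^sub>\<lambda>\<^sub>[\<^sub>m\<^sub>]\<close> is given by one polynomial of weighted degree
  at most \<open>|\<lambda>|\<close> (\<open>specht_character_polynomial\<close>), and (a) follows by adding up. Conversely these
  polynomials with \<open>|\<lambda>| \<le> d\<close> are linearly independent, because the Specht characters are
  orthonormal for \<open>m \<ge> 2 d\<close>, and there are as many of them as monomials of weight at most \<open>d\<close>. So
  they span the polynomials of weighted degree at most \<open>d\<close> (\<open>char_poly_spans\<close>). If such a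
  polynomial is the character of \<open>W\<^sub>m\<close>, its coefficients in this basis are the multiplicities of the
  Specht modules in \<open>W\<^sub>m\<close>, and they do not depend on \<open>m\<close>. This is (b).

  The determinantal formula is obtained by comparing norms. Write \<open>\<chi>\<close> for the Specht character and
  \<open>\<psi>\<close> for the alternating sum. Since both have norm one and their inner product is one, the
  norm of \<open>\<chi> - \<psi>\<close> is zero.
  \<^item> The norm of \<open>\<chi>\<close> is one by Schur orthogonality, as the only endomorphisms of a Specht module are
    the scalars (\<open>specht_absolutely_simple\<close>).
  \<^item> The inner product of \<open>\<chi>\<close> with \<open>\<chi>\<^sub>\<alpha>\<close> is the dimension of the space of invariants of a Young subgroup.
    This space is zero if a partial sum of \<open>\<alpha>\<close> exceeds that of \<open>\<nu>\<close>, which happens in all terms of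
    \<open>\<psi>\<close> other than the one of the identity, and it has dimension one for \<open>\<alpha> = \<nu>\<close>.
  \<^item> The inner products of the \<open>\<chi>\<^sub>\<alpha>\<close> count matrices of natural numbers with prescribed row and
    column sums, and a sign reversing involution evaluates the alternating sum of these counts
    (\<open>pieri_cancellation\<close>, \<open>jacobi_trudi_norm\<close>).

  The passage from characters to modules splits off Specht modules one at a time until the character,
  and with it the dimension of the remainder, is zero (\<open>decomposition_from_character\<close>).
\<close>

section \<open>Traces on finite dimensional subspaces\<close>

locale fin_dim_subspace = vector_space s
  for s :: "rat \<Rightarrow> 'a::ab_group_add \<Rightarrow> 'a" +
  fixes V :: "'a set"
  assumes generated: "\<exists>B. finite B \<and> span B = V"
begin

definition basis :: "'a set \<Rightarrow> bool" where
  "basis B \<longleftrightarrow> independent B \<and> span B = V"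

lemma subspace: "subspace V"
  using generated subspace_span by blast

lemma finite_basis: "basis B \<Longrightarrow> finite B"
  using generated independent_span_bound[of _ B] span_superset[of B] unfolding basis_def by auto

lemma ex_basis: "\<exists>B. basis B"
proof -
  obtain B where "B \<subseteq> V" "independent B" "V \<subseteq> span B"
    by (rule basis_exists[of V])
  then have "span B = V"
    by (simp add: span_subspace subspace)
  with \<open>independent B\<close> show ?thesis
    unfolding basis_def by blast
qed

lemma basis_subset: "basis B \<Longrightarrow> b \<in> B \<Longrightarrow> b \<in> V"
  unfolding basis_def using span_base by blast

lemma expand: "basis B \<Longrightarrow> v \<in> V \<Longrightarrow> (\<Sum>b\<in>B. s (representation B v b) b) = v"
  using sum_representation_eq[of B v B] finite_basis unfolding basis_def by auto

lemma coord_add: "basis B \<Longrightarrow> v \<in> V \<Longrightarrow> w \<in> V \<Longrightarrow>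
    representation B (v + w) b = representation B v b + representation B w b"
  using representation_add[of B w v] unfolding basis_def by (simp add: add.commute)

lemma coord_scale: "basis B \<Longrightarrow> v \<in> V \<Longrightarrow>
    representation B (s c v) b = c * representation B v b"
  using representation_scale[of B v c] unfolding basis_def by simp

lemma coord_sum: "basis B \<Longrightarrow> (\<And>i. i \<in> I \<Longrightarrow> v i \<in> V) \<Longrightarrow>
    representation B (\<Sum>i\<in>I. v i) b = (\<Sum>i\<in>I. representation B (v i) b)"
  using representation_sum[of B I v] unfolding basis_def by simp

lemma coord_lincomb: "basis B \<Longrightarrow> (\<And>i. i \<in> I \<Longrightarrow> v i \<in> V) \<Longrightarrow>
    representation B (\<Sum>i\<in>I. s (c i) (v i)) b = (\<Sum>i\<in>I. c i * representation B (v i) b)"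
  by (subst coord_sum) (auto simp: coord_scale intro: subspace_scale[OF subspace])

lemma coord_basis: "basis B \<Longrightarrow> b \<in> B \<Longrightarrow> representation B b c = (if c = b then 1 else 0)"
  using representation_basis[of B b] unfolding basis_def by simp

end

definition linmap ::
    "(rat \<Rightarrow> 'a::ab_group_add \<Rightarrow> 'a) \<Rightarrow> 'a set \<Rightarrow> (rat \<Rightarrow> 'b::ab_group_add \<Rightarrow> 'b) \<Rightarrow> 'b set \<Rightarrow> ('a \<Rightarrow> 'b) set" where
  "linmap s V t W = {f. (\<forall>v\<in>V. f v \<in> W) \<and> (\<forall>v\<in>V. \<forall>w\<in>V. f (v + w) = f v + f w) \<and>
     (\<forall>c. \<forall>v\<in>V. f (s c v) = t c (f v))}"

lemma linmapI:
  assumes "\<And>v. v \<in> V \<Longrightarrow> f v \<in> W"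
    and "\<And>v w. v \<in> V \<Longrightarrow> w \<in> V \<Longrightarrow> f (v + w) = f v + f w"
    and "\<And>c v. v \<in> V \<Longrightarrow> f (s c v) = t c (f v)"
  shows "f \<in> linmap s V t W"
  using assms unfolding linmap_def by auto

lemma linmap_in: "f \<in> linmap s V t W \<Longrightarrow> v \<in> V \<Longrightarrow> f v \<in> W"
  and linmap_add: "f \<in> linmap s V t W \<Longrightarrow> v \<in> V \<Longrightarrow> w \<in> V \<Longrightarrow> f (v + w) = f v + f w"
  and linmap_scale: "f \<in> linmap s V t W \<Longrightarrow> v \<in> V \<Longrightarrow> f (s c v) = t c (f v)"
  unfolding linmap_def by auto

lemma linmap_comp: "f \<in> linmap s V t W \<Longrightarrow> g \<in> linmap t W u X \<Longrightarrow> (\<lambda>x. g (f x)) \<in> linmap s V u X"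
  unfolding linmap_def by auto

lemma linmap_0:
  assumes "fin_dim_subspace s V" "f \<in> linmap s V t W"
  shows "f 0 = 0"
proof -
  interpret fin_dim_subspace s V by fact
  have "0 \<in> V" by (rule subspace_0[OF subspace])
  then have "f (0 + 0) = f 0 + f 0" using linmap_add[OF assms(2)] by blast
  then show ?thesis by simp
qed

lemma linmap_sum:
  assumes "fin_dim_subspace s V" "f \<in> linmap s V t W" "\<And>i. i \<in> I \<Longrightarrow> v i \<in> V"
  shows "f (\<Sum>i\<in>I. v i) = (\<Sum>i\<in>I. f (v i))"
proof -
  interpret fin_dim_subspace s V by fact
  show ?thesis
    using assms(3)
  proof (induction I rule: infinite_finite_induct)
    case (insert i I)
    then show ?case
      using linmap_add[OF assms(2), of "v i" "sum v I"] subspace_sum[OF subspace, of I v] by auto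
  qed (simp_all add: linmap_0[OF assms(1,2)])
qed

lemma linmap_diff:
  assumes "fin_dim_subspace s V" "f \<in> linmap s V t W" "v \<in> V" "w \<in> V"
  shows "f (v - w) = f v - f w"
proof -
  interpret fin_dim_subspace s V by fact
  have "f ((v - w) + w) = f (v - w) + f w"
    using assms subspace_diff[OF subspace] by (intro linmap_add) auto
  then show ?thesis by simp
qed

lemma linmap_lincomb:
  assumes "fin_dim_subspace s V" "f \<in> linmap s V t W" "\<And>i. i \<in> I \<Longrightarrow> v i \<in> V"
  shows "f (\<Sum>i\<in>I. s (c i) (v i)) = (\<Sum>i\<in>I. t (c i) (f (v i)))"
proof -
  interpret fin_dim_subspace s V by fact
  show ?thesis
    using assms subspace_scale[OF subspace]
    by (subst linmap_sum[OF assms(1,2)]) (auto intro!: sum.cong simp: linmap_scale[OF assms(2)])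
qed

lemma linmap_minus:
  assumes "fin_dim_subspace t W" "f \<in> linmap s V t W" "g \<in> linmap s V t W"
  shows "(\<lambda>x. f x - g x) \<in> linmap s V t W"
proof -
  interpret fin_dim_subspace t W by fact
  show ?thesis using assms(2,3) subspace_diff[OF subspace]
    by (intro linmapI) (auto simp: linmap_add[OF assms(2)] linmap_add[OF assms(3)]
        linmap_scale[OF assms(2)] linmap_scale[OF assms(3)] scale_right_diff_distrib linmap_in)
qed

lemma linmap_sums:
  assumes "fin_dim_subspace t W" "\<And>i. i \<in> I \<Longrightarrow> f i \<in> linmap s V t W"
  shows "(\<lambda>x. \<Sum>i\<in>I. f i x) \<in> linmap s V t W"
proof -
  interpret fin_dim_subspace t W by fact
  show ?thesis
    using assms(2) unfolding linmap_def
    by (auto intro!: subspace_sum[OF subspace] sum.cong simp: sum.distrib[symmetric] scale_sum_right)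
qed

lemma linmap_scaled:
  assumes "fin_dim_subspace t W" "f \<in> linmap s V t W"
  shows "(\<lambda>x. t c (f x)) \<in> linmap s V t W"
proof -
  interpret fin_dim_subspace t W by fact
  show ?thesis
    using assms(2) unfolding linmap_def
    by (auto intro!: subspace_scale[OF subspace] simp: scale_right_distrib mult.commute)
qed

lemma linmap_id: "(\<lambda>x. x) \<in> linmap s V s V"
  by (intro linmapI) auto

text \<open>
  In coordinates both sides are the same double sum of products of matrix entries of \<open>f\<close> and \<open>g\<close>.
  With \<open>g\<close> the identity and \<open>f\<close> an endomorphism this says that the trace does not depend on the basis,
  with \<open>f\<close> and \<open>g\<close> arbitrary it is the cyclicity of the trace.
\<close>

lemma trace_swap_bases:
  assumes "fin_dim_subspace s V" "fin_dim_subspace t W"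
    and B: "fin_dim_subspace.basis s V B" and C: "fin_dim_subspace.basis t W C"
    and f: "f \<in> linmap s V t W" and g: "g \<in> linmap t W s V"
  shows "(\<Sum>b\<in>B. module.representation s B (g (f b)) b) = (\<Sum>c\<in>C. module.representation t C (f (g c)) c)"
proof -
  interpret V: fin_dim_subspace s V by fact
  interpret W: fin_dim_subspace t W by fact
  have 1: "V.representation B (g (f b)) b = (\<Sum>c\<in>C. W.representation C (f b) c * V.representation B (g c) b)"
    if "b \<in> B" for b
  proof -
    have "f b = (\<Sum>c\<in>C. t (W.representation C (f b) c) c)"
      using W.expand[OF C] linmap_in[OF f] V.basis_subset[OF B that] by metis
    then have "g (f b) = g (\<Sum>c\<in>C. t (W.representation C (f b) c) c)" by simp
    also have "\<dots> = (\<Sum>c\<in>C. s (W.representation C (f b) c) (g c))"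
      using W.basis_subset[OF C] by (intro linmap_lincomb[OF assms(2) g]) auto
    finally show ?thesis
      using W.basis_subset[OF C] linmap_in[OF g] by (simp add: V.coord_lincomb[OF B])
  qed
  have 2: "W.representation C (f (g c)) c = (\<Sum>b\<in>B. V.representation B (g c) b * W.representation C (f b) c)"
    if "c \<in> C" for c
  proof -
    have "g c = (\<Sum>b\<in>B. s (V.representation B (g c) b) b)"
      using V.expand[OF B] linmap_in[OF g] W.basis_subset[OF C that] by metis
    then have "f (g c) = f (\<Sum>b\<in>B. s (V.representation B (g c) b) b)" by simp
    also have "\<dots> = (\<Sum>b\<in>B. t (V.representation B (g c) b) (f b))"
      using V.basis_subset[OF B] by (intro linmap_lincomb[OF assms(1) f]) auto
    finally show ?thesis
      using V.basis_subset[OF B] linmap_in[OF f] by (simp add: W.coord_lincomb[OF C])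
  qed
  have "(\<Sum>b\<in>B. V.representation B (g (f b)) b)
      = (\<Sum>b\<in>B. \<Sum>c\<in>C. W.representation C (f b) c * V.representation B (g c) b)"
    by (intro sum.cong refl 1)
  also have "\<dots> = (\<Sum>c\<in>C. \<Sum>b\<in>B. V.representation B (g c) b * W.representation C (f b) c)"
    by (subst sum.swap) (simp only: mult.commute)
  also have "\<dots> = (\<Sum>c\<in>C. W.representation C (f (g c)) c)"
    by (intro sum.cong refl 2[symmetric])
  finally show ?thesis .
qed

lemma trace_on_eq:
  assumes "fin_dim_subspace s V" "fin_dim_subspace.basis s V B" "f \<in> linmap s V s V"
  shows "trace_on s V f = (\<Sum>b\<in>B. module.representation s B (f b) b)"
proof -
  interpret V: fin_dim_subspace s V by fact
  define B' where "B' = (SOME B. V.independent B \<and> V.span B = V)"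
  have "V.basis B'"
    unfolding B'_def V.basis_def using V.ex_basis[unfolded V.basis_def] by (rule someI_ex)
  from trace_swap_bases[OF assms(1,1) this assms(2,3) linmap_id]
  have "(\<Sum>b\<in>B'. V.representation B' (f b) b) = (\<Sum>b\<in>B. V.representation B (f b) b)" .
  moreover have "trace_on s V f = (\<Sum>b\<in>B'. V.representation B' (f b) b)"
    unfolding trace_on_def Let_def B'_def by (rule refl)
  ultimately show ?thesis by simp
qed

lemma trace_cyclic:
  assumes "fin_dim_subspace s V" "fin_dim_subspace t W"
    and f: "f \<in> linmap s V t W" and g: "g \<in> linmap t W s V"
  shows "trace_on s V (\<lambda>x. g (f x)) = trace_on t W (\<lambda>x. f (g x))"
proof -
  interpret V: fin_dim_subspace s V by fact
  interpret W: fin_dim_subspace t W by fact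
  obtain B where B: "V.basis B" using V.ex_basis by blast
  obtain C where C: "W.basis C" using W.ex_basis by blast
  show ?thesis
    unfolding trace_on_eq[OF assms(1) B linmap_comp[OF f g]] trace_on_eq[OF assms(2) C linmap_comp[OF g f]]
    by (rule trace_swap_bases[OF assms(1,2) B C f g])
qed

lemma trace_cong:
  assumes "fin_dim_subspace s V" "f \<in> linmap s V s V" "\<And>v. v \<in> V \<Longrightarrow> f v = g v"
  shows "trace_on s V f = trace_on s V g"
proof -
  interpret V: fin_dim_subspace s V by fact
  have g: "g \<in> linmap s V s V"
    using assms(2) V.subspace_add[OF V.subspace] V.subspace_scale[OF V.subspace]
    unfolding linmap_def by (auto simp: assms(3)[symmetric])
  obtain B where B: "V.basis B" using V.ex_basis by blast
  show ?thesis
    using V.basis_subset[OF B]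
    by (auto simp: trace_on_eq[OF assms(1) B assms(2)] trace_on_eq[OF assms(1) B g] assms(3) intro!: sum.cong)
qed

lemma trace_sum:
  assumes "fin_dim_subspace s V" "\<And>i. i \<in> I \<Longrightarrow> f i \<in> linmap s V s V"
  shows "trace_on s V (\<lambda>x. \<Sum>i\<in>I. f i x) = (\<Sum>i\<in>I. trace_on s V (f i))"
proof -
  interpret V: fin_dim_subspace s V by fact
  obtain B where B: "V.basis B" using V.ex_basis by blast
  have "trace_on s V (\<lambda>x. \<Sum>i\<in>I. f i x) = (\<Sum>b\<in>B. V.representation B (\<Sum>i\<in>I. f i b) b)"
    by (rule trace_on_eq[OF assms(1) B linmap_sums[OF assms]])
  also have "\<dots> = (\<Sum>b\<in>B. \<Sum>i\<in>I. V.representation B (f i b) b)"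
    using V.basis_subset[OF B] linmap_in[OF assms(2)] by (intro sum.cong V.coord_sum[OF B]) auto
  also have "\<dots> = (\<Sum>i\<in>I. trace_on s V (f i))"
    by (subst sum.swap) (auto intro!: sum.cong simp: trace_on_eq[OF assms(1) B assms(2)])
  finally show ?thesis .
qed

lemma trace_add:
  assumes V: "fin_dim_subspace s V" and f: "f \<in> linmap s V s V" and g: "g \<in> linmap s V s V"
  shows "trace_on s V (\<lambda>x. f x + g x) = trace_on s V f + trace_on s V g"
  using trace_sum[OF V, of "{0,1::nat}" "\<lambda>i. if i = 0 then f else g"] f g by simp

lemma trace_scale:
  assumes "fin_dim_subspace s V" "f \<in> linmap s V s V"
  shows "trace_on s V (\<lambda>x. s c (f x)) = c * trace_on s V f"
proof -
  interpret V: fin_dim_subspace s V by fact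
  obtain B where B: "V.basis B" using V.ex_basis by blast
  show ?thesis
    using V.basis_subset[OF B] linmap_in[OF assms(2)]
    by (simp add: trace_on_eq[OF assms(1) B assms(2)] trace_on_eq[OF assms(1) B linmap_scaled[OF assms]]
        sum_distrib_left V.coord_scale[OF B])
qed

lemma trace_rank_one:
  assumes "fin_dim_subspace s V" and l: "l \<in> linmap s V (*) UNIV" and v: "v \<in> V"
  shows "trace_on s V (\<lambda>x. s (l x) v) = l v"
proof -
  interpret V: fin_dim_subspace s V by fact
  obtain B where B: "V.basis B" using V.ex_basis by blast
  have lin: "(\<lambda>x. s (l x) v) \<in> linmap s V s V"
    using V.subspace_scale[OF V.subspace v]
    by (intro linmapI) (auto simp: linmap_add[OF l] linmap_scale[OF l] V.scale_left_distrib)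
  have "trace_on s V (\<lambda>x. s (l x) v) = (\<Sum>b\<in>B. V.representation B v b * l b)"
    using v by (simp add: trace_on_eq[OF assms(1) B lin] V.coord_scale[OF B] mult.commute)
  also have "\<dots> = l (\<Sum>b\<in>B. s (V.representation B v b) b)"
    using V.basis_subset[OF B] by (intro linmap_lincomb[OF assms(1) l, symmetric]) auto
  finally show ?thesis by (simp add: V.expand[OF B v])
qed

lemma trace_id_basis:
  assumes "fin_dim_subspace s V" "fin_dim_subspace.basis s V B"
  shows "trace_on s V (\<lambda>x. x) = of_nat (card B)"
proof -
  interpret V: fin_dim_subspace s V by fact
  show ?thesis by (simp add: trace_on_eq[OF assms linmap_id] V.coord_basis[OF assms(2)])
qed

text \<open>
  Characteristic zero enters here: a module whose character vanishes at the identity is zero.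
\<close>

lemma trace_id_eq_0_iff:
  assumes "fin_dim_subspace s V"
  shows "trace_on s V (\<lambda>x. x) = 0 \<longleftrightarrow> V = {0}"
proof -
  interpret V: fin_dim_subspace s V by fact
  obtain B where B: "V.basis B" using V.ex_basis by blast
  have "B = {} \<longleftrightarrow> V = {0}"
  proof
    assume "V = {0}"
    then have "B \<subseteq> {0}" "0 \<notin> B"
      using V.basis_subset[OF B] B V.dependent_zero[of B] unfolding V.basis_def by auto
    then show "B = {}" by auto
  qed (use B in \<open>auto simp: V.basis_def\<close>)
  then show ?thesis
    using V.finite_basis[OF B] by (simp add: trace_id_basis[OF assms B])
qed

lemma fin_dim_subspace_image:
  assumes "fin_dim_subspace s V" "fin_dim_subspace t W" "f \<in> linmap s V t W"
  shows "fin_dim_subspace t (f ` V)"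
proof -
  interpret V: fin_dim_subspace s V by fact
  interpret W: fin_dim_subspace t W by fact
  obtain B where B: "V.basis B" using V.ex_basis by blast
  have sub: "W.subspace (f ` V)"
  proof (rule W.subspaceI)
    show "0 \<in> f ` V"
      using linmap_0[OF assms(1,3)] V.subspace_0[OF V.subspace] by force
    show "x + y \<in> f ` V" if "x \<in> f ` V" "y \<in> f ` V" for x y
      using that V.subspace_add[OF V.subspace] linmap_add[OF assms(3)] by (auto simp: image_iff) metis
    show "t c x \<in> f ` V" if "x \<in> f ` V" for c x
      using that V.subspace_scale[OF V.subspace] linmap_scale[OF assms(3)] by (auto simp: image_iff) metis
  qed
  have "W.span (f ` B) = f ` V"
  proof (rule W.span_subspace)
    show "f ` B \<subseteq> f ` V" using V.basis_subset[OF B] by auto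
    show "f ` V \<subseteq> W.span (f ` B)"
    proof safe
      fix v assume v: "v \<in> V"
      have "f v = f (\<Sum>b\<in>B. s (V.representation B v b) b)" by (simp add: V.expand[OF B v])
      also have "\<dots> = (\<Sum>b\<in>B. t (V.representation B v b) (f b))"
        using V.basis_subset[OF B] by (intro linmap_lincomb[OF assms(1,3)]) auto
      also have "\<dots> \<in> W.span (f ` B)"
        by (intro W.span_sum W.span_scale W.span_base) auto
      finally show "f v \<in> W.span (f ` B)" .
    qed
  qed (rule sub)
  then show ?thesis
    using V.finite_basis[OF B] by unfold_locales blast
qed

(* Keeps the lower bound of {1..m} in this form during simplification. *)
declare One_nat_def [simp del]

section \<open>Equivariant maps and characters\<close>

abbreviation linmaps :: "'v::ab_group_add sym_rep \<Rightarrow> 'w::ab_group_add sym_rep \<Rightarrow> ('v \<Rightarrow> 'w) set" where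
  "linmaps V W \<equiv> linmap (scale V) (space V) (scale W) (space W)"

abbreviation rep_trace :: "'v::ab_group_add sym_rep \<Rightarrow> ('v \<Rightarrow> 'v) \<Rightarrow> rat" where
  "rep_trace V \<equiv> trace_on (scale V) (space V)"

lemma sym_module_fin_dim: "sym_module m V \<Longrightarrow> fin_dim_subspace (scale V) (space V)"
  unfolding sym_module_def fin_dim_subspace_def fin_dim_subspace_axioms_def by blast

lemma act_linmap:
  "sym_module m V \<Longrightarrow> g permutes {1..m} \<Longrightarrow> act V g \<in> linmaps V V"
  unfolding sym_module_def by (intro linmapI) auto

lemma act_in: "sym_module m V \<Longrightarrow> g permutes {1..m} \<Longrightarrow> v \<in> space V \<Longrightarrow> act V g v \<in> space V"
  and act_id: "sym_module m V \<Longrightarrow> v \<in> space V \<Longrightarrow> act V id v = v"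
  and act_comp: "sym_module m V \<Longrightarrow> g permutes {1..m} \<Longrightarrow> h permutes {1..m} \<Longrightarrow> v \<in> space V \<Longrightarrow>
    act V g (act V h v) = act V (g \<circ> h) v"
  unfolding sym_module_def by auto

lemma act_inv:
  assumes "sym_module m V" "g permutes {1..m}" "v \<in> space V"
  shows "act V g (act V (inv g) v) = v" "act V (inv g) (act V g v) = v"
  using assms permutes_inv[OF assms(2)]
  by (simp_all add: act_comp act_id permutes_inv_o[OF assms(2)])

definition equivariant ::
    "nat \<Rightarrow> 'v::ab_group_add sym_rep \<Rightarrow> 'w::ab_group_add sym_rep \<Rightarrow> ('v \<Rightarrow> 'w) \<Rightarrow> bool" where
  "equivariant m V W f \<longleftrightarrow> f \<in> linmaps V W \<and>
     (\<forall>g. g permutes {1..m} \<longrightarrow> (\<forall>v\<in>space V. f (act V g v) = act W g (f v)))"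

lemma equivariant_linmap: "equivariant m V W f \<Longrightarrow> f \<in> linmaps V W"
  and equivariant_act: "equivariant m V W f \<Longrightarrow> g permutes {1..m} \<Longrightarrow> v \<in> space V \<Longrightarrow>
    f (act V g v) = act W g (f v)"
  unfolding equivariant_def by auto

text \<open>
  The average is not divided by the order of the group. This factor is accounted for where traces
  are compared.
\<close>

definition average ::
    "nat \<Rightarrow> 'v::ab_group_add sym_rep \<Rightarrow> 'w::ab_group_add sym_rep \<Rightarrow> ('v \<Rightarrow> 'w) \<Rightarrow> 'v \<Rightarrow> 'w" where
  "average m V W f x = (\<Sum>g | g permutes {1..m}. act W g (f (act V (inv g) x)))"

lemma average_term_linmap:
  assumes "sym_module m V" "sym_module m W" "f \<in> linmaps V W"
    "g permutes {1..m}"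
  shows "(\<lambda>x. act W g (f (act V (inv g) x))) \<in> linmaps V W"
  using linmap_comp[OF linmap_comp[OF act_linmap[OF assms(1) permutes_inv[OF assms(4)]] assms(3)]
      act_linmap[OF assms(2,4)]] .

lemma average_equivariant:
  assumes V: "sym_module m V" and W: "sym_module m W"
    and f: "f \<in> linmaps V W"
  shows "equivariant m V W (average m V W f)"
  unfolding equivariant_def
proof (intro conjI allI impI ballI)
  show "average m V W f \<in> linmaps V W"
    unfolding average_def
    by (rule linmap_sums[OF sym_module_fin_dim[OF W]]) (auto intro: average_term_linmap assms)
  fix h v assume h: "h permutes {1..m}" and v: "v \<in> space V"
  have *: "act W h (act W g (f (act V (inv g) v))) = act W (h \<circ> g) (f (act V (inv (h \<circ> g)) (act V h v)))"
    if "g permutes {1..m}" for g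
  proof -
    have "inv (h \<circ> g) \<circ> h = inv g"
      using h that by (simp add: permutes_inv_o(2) o_inv_distrib permutes_bij comp_assoc)
    then have "act V (inv (h \<circ> g)) (act V h v) = act V (inv g) v"
      using h that v V by (subst act_comp) (auto intro: permutes_inv permutes_compose)
    moreover have "f (act V (inv g) v) \<in> space W"
      using linmap_in[OF f] act_in[OF V] permutes_inv[OF that] v by blast
    ultimately show ?thesis
      using act_comp[OF W h that] by simp
  qed
  have "act W h (average m V W f v) = (\<Sum>g | g permutes {1..m}. act W h (act W g (f (act V (inv g) v))))"
    unfolding average_def
    using linmap_in[OF average_term_linmap[OF V W f] v]
    by (intro linmap_sum[OF sym_module_fin_dim[OF W] act_linmap[OF W h]]) auto
  also have "\<dots> = (\<Sum>g | g permutes {1..m}. act W (h \<circ> g) (f (act V (inv (h \<circ> g)) (act V h v))))"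
    by (intro sum.cong refl *) auto
  also have "\<dots> = average m V W f (act V h v)"
    unfolding average_def by (rule setum_permutations_compose_left[OF h, symmetric])
  finally show "average m V W f (act V h v) = act W h (average m V W f v)" by simp
qed

lemma trace_conjugate:
  assumes V: "sym_module m V" and f: "f \<in> linmaps V V"
    and g: "g permutes {1..m}"
  shows "rep_trace V (\<lambda>x. act V g (f (act V (inv g) x))) = rep_trace V f"
proof -
  note fd = sym_module_fin_dim[OF V]
  note g1 = act_linmap[OF V g] and g2 = act_linmap[OF V permutes_inv[OF g]]
  have "rep_trace V (\<lambda>x. act V g (f (act V (inv g) x)))
      = rep_trace V (\<lambda>x. f (act V (inv g) (act V g x)))"
    by (rule trace_cyclic[OF fd fd linmap_comp[OF g2 f] g1])
  also have "\<dots> = rep_trace V f"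
    by (rule trace_cong[OF fd, symmetric, OF f]) (simp add: act_inv[OF V g])
  finally show ?thesis .
qed

lemma trace_average:
  assumes V: "sym_module m V" and f: "f \<in> linmaps V V"
  shows "rep_trace V (average m V V f) = fact m * rep_trace V f"
proof -
  have "rep_trace V (average m V V f)
      = (\<Sum>g | g permutes {1..m}. rep_trace V (\<lambda>x. act V g (f (act V (inv g) x))))"
    unfolding average_def
    by (rule trace_sum[OF sym_module_fin_dim[OF V]]) (auto intro: average_term_linmap[OF V V f])
  also have "\<dots> = (\<Sum>g | g permutes {1..m}. rep_trace V f)"
    by (intro sum.cong refl trace_conjugate[OF V f]) auto
  finally show ?thesis by (simp add: card_permutations)
qed

lemma rep_character_conjugate:
  assumes V: "sym_module m V" and g: "g permutes {1..m}" and h: "h permutes {1..m}"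
  shows "rep_character V (h \<circ> g \<circ> inv h) = rep_character V g"
proof -
  have "rep_trace V (\<lambda>x. act V h (act V g (act V (inv h) x)))
      = rep_trace V (act V (h \<circ> g \<circ> inv h))"
    using permutes_inv[OF h] permutes_compose[OF g h] act_in[OF V permutes_inv[OF h]]
    by (intro trace_cong[OF sym_module_fin_dim[OF V] average_term_linmap[OF V V act_linmap[OF V g] h]])
       (simp add: act_comp[OF V] g h permutes_compose permutes_inv comp_assoc)
  then show ?thesis
    unfolding rep_character_def using trace_conjugate[OF V act_linmap[OF V g] h] by simp
qed

text \<open>
  Inside a cycle with chosen starting point \<open>r\<close>, the map \<open>g\<^sup>k r \<mapsto> g\<^sup>-\<^sup>k r\<close> conjugates \<open>g\<close> into its
  inverse.
\<close>

lemma conjugate_to_inverse: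
  assumes g: "g permutes {1..m::nat}"
  obtains h where "h permutes {1..m}" "h \<circ> g \<circ> inv h = inv g"
proof -
  have perm: "permutation g" using g by (auto simp: permutation_permutes)
  have bij: "bij g" using permutes_bij[OF g] .
  have inv_pow: "(inv g ^^ k) ((g ^^ k) x) = x" for k x
  proof (induction k arbitrary: x)
    case (Suc k)
    have "(inv g ^^ Suc k) ((g ^^ Suc k) x) = (inv g ^^ k) (inv g (g ((g ^^ k) x)))"
      by (simp add: funpow_swap1)
    then show ?case using Suc bij by (simp add: bij_is_inj inv_f_f)
  qed simp
  \<comment> \<open>starting points: the choice depends on the cycle only\<close>
  define r where "r x = (SOME y. y \<in> orbit g x)" for x
  have r_in: "r x \<in> orbit g x" for x
    unfolding r_def using permutation_self_in_orbit[OF perm] by (rule someI)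
  have x_in: "x \<in> orbit g (r x)" for x
    using r_in orbit_swap[OF permutation_self_in_orbit[OF perm]] by blast
  have "\<exists>k. x = (g ^^ k) (r x)" for x
    using x_in[of x] unfolding orbit_altdef by blast
  then obtain k where k: "\<And>x. x = (g ^^ k x) (r x)" by metis
  define h where "h x = (inv g ^^ k x) (r x)" for x
  have cancel: "(inv g ^^ i) z = (inv g ^^ j) z" if "(g ^^ i) z = (g ^^ j) z" for i j z
  proof -
    have *: "(inv g ^^ i) z = (inv g ^^ j) z" if "(g ^^ i) z = (g ^^ j) z" "i \<le> j" for i j
    proof -
      obtain d where d: "j = i + d" using \<open>i \<le> j\<close> le_Suc_ex by blast
      have "(inv g ^^ i) ((g ^^ i) z) = (inv g ^^ i) ((g ^^ i) ((g ^^ d) z))"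
        using that by (simp add: d funpow_add)
      then have "(g ^^ d) z = z" by (simp add: inv_pow)
      then have "(inv g ^^ d) z = z" using inv_pow[of d z] by simp
      then show ?thesis by (simp add: d funpow_add)
    qed
    show ?thesis using *[of i j] *[of j i] that nat_le_linear[of i j] by metis
  qed
  have h_pow: "h x = (inv g ^^ i) (r x)" if "x = (g ^^ i) (r x)" for x i
    unfolding h_def by (rule cancel[OF trans[OF k[symmetric] that]])
  have r_step: "r (g x) = r x" for x
    unfolding r_def using permutation_orbit_step[OF perm, of x] by simp
  have hg: "h (g x) = inv g (h x)" for x
    using h_pow[of "g x" "Suc (k x)"] k[symmetric, of x] by (simp add: r_step h_def)
  have r_inv: "r (inv g x) = r x" for x
    using r_step[of "inv g x"] g by (simp add: permutes_inverses)
  have r_inv_pow: "r ((inv g ^^ i) x) = r x" for i x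
    by (induction i) (simp_all add: r_inv)
  have r_r: "r (r x) = r x" for x
    using r_inv_pow[of "k x" x] inv_pow[of "k x" "r x"] k[symmetric, of x] by simp
  have pow_pow: "h ((inv g ^^ i) x) = (g ^^ i) (h x)" for i x
  proof (induction i)
    case (Suc i)
    have "h ((inv g ^^ Suc i) x) = g (inv g (h (inv g ((inv g ^^ i) x))))"
      using g by (simp add: permutes_inverses)
    also have "inv g (h (inv g ((inv g ^^ i) x))) = h ((inv g ^^ i) x)"
      using g by (simp add: hg[symmetric] permutes_inverses)
    finally show ?case using Suc by simp
  qed simp
  have "h (r x) = r x" for x
    using h_pow[of "r x" 0] by (simp add: r_r)
  then have hh: "h (h x) = x" for x
    unfolding h_def[of x] pow_pow using k[symmetric, of x] by simp
  have "h permutes {1..m}"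
    unfolding permutes_def
  proof (intro conjI allI impI)
    fix x :: nat assume x: "x \<notin> {1..m}"
    then have gx: "g x = x" using g by (simp add: permutes_not_in)
    then have "orbit g x = {x}" by (simp add: orbit_eq_singleton_iff)
    then have "r x = x" using r_in[of x] by simp
    then show "h x = x" using h_pow[of x 0] by simp
  next
    show "\<exists>!x. h x = y" for y by (metis hh)
  qed
  moreover have "inv h = h"
    by (rule inv_unique_comp) (auto simp: hh)
  moreover have "h \<circ> g \<circ> h = inv g"
    by (rule ext) (simp add: hg hh)
  ultimately show thesis using that by metis
qed

text \<open>
  This is why the inner product of characters below needs no inverse in one of its arguments.
\<close>

lemma rep_character_inv:
  assumes "sym_module m V" "g permutes {1..m}"
  shows "rep_character V (inv g) = rep_character V g"
  using rep_character_conjugate[OF assms] conjugate_to_inverse[OF assms(2)] by metis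

section \<open>Schur orthogonality\<close>

definition char_inner :: "nat \<Rightarrow> ((nat \<Rightarrow> nat) \<Rightarrow> rat) \<Rightarrow> ((nat \<Rightarrow> nat) \<Rightarrow> rat) \<Rightarrow> rat" where
  "char_inner m \<chi> \<psi> = (\<Sum>g | g permutes {1..m}. \<chi> g * \<psi> g) / fact m"

text \<open>
  For a semisimple module over \<open>\<rat>\<close> this means that it stays simple over every extension field. In
  this form simplicity is what Schur orthogonality uses and what polytabloids provide.
\<close>

definition absolutely_simple :: "nat \<Rightarrow> 'v::ab_group_add sym_rep \<Rightarrow> bool" where
  "absolutely_simple m V \<longleftrightarrow> sym_module m V \<and> space V \<noteq> {0} \<and>
     (\<forall>f. equivariant m V V f \<longrightarrow> (\<exists>c. \<forall>v\<in>space V. f v = scale V c v))"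

text \<open>
  The matrix unit that sends the basis vector \<open>b\<close> to \<open>c\<close> and the others to zero.
\<close>

definition elementary ::
    "'v::ab_group_add sym_rep \<Rightarrow> 'v set \<Rightarrow> 'w::ab_group_add sym_rep \<Rightarrow> 'v \<Rightarrow> 'w \<Rightarrow> 'v \<Rightarrow> 'w" where
  "elementary V B W b c x = scale W (module.representation (scale V) B x b) c"

lemma elementary_linmap:
  assumes V: "fin_dim_subspace (scale V) (space V)" and W: "fin_dim_subspace (scale W) (space W)"
    and B: "fin_dim_subspace.basis (scale V) (space V) B" and c: "c \<in> space W"
  shows "elementary V B W b c \<in> linmaps V W"
proof -
  interpret V: fin_dim_subspace "scale V" "space V" by fact
  interpret W: fin_dim_subspace "scale W" "space W" by fact
  show ?thesis
    unfolding elementary_def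
    by (intro linmapI W.subspace_scale[OF W.subspace c])
       (auto simp: V.coord_add[OF B] V.coord_scale[OF B] W.scale_left_distrib)
qed

text \<open>
  Both characters are sums of diagonal matrix entries, and a product of a matrix entry of \<open>g\<^sup>-\<^sup>1\<close> and
  one of \<open>g\<close> is a matrix entry of a conjugated matrix unit. So the inner product only sees
  averaged, that is equivariant, maps.
\<close>

lemma char_inner_average:
  assumes V: "sym_module m V" and W: "sym_module m W"
    and B: "fin_dim_subspace.basis (scale V) (space V) B"
    and C: "fin_dim_subspace.basis (scale W) (space W) C"
  shows "fact m * char_inner m (rep_character V) (rep_character W) =
    (\<Sum>b\<in>B. \<Sum>c\<in>C. module.representation (scale W) C (average m V W (elementary V B W b c) b) c)"
proof -
  interpret V: fin_dim_subspace "scale V" "space V" by (rule sym_module_fin_dim[OF V])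
  interpret W: fin_dim_subspace "scale W" "space W" by (rule sym_module_fin_dim[OF W])
  note E = elementary_linmap[OF V.fin_dim_subspace_axioms W.fin_dim_subspace_axioms B]
  have *: "rep_character V g * rep_character W g =
      (\<Sum>b\<in>B. \<Sum>c\<in>C. W.representation C (act W g (elementary V B W b c (act V (inv g) b))) c)"
    if g: "g permutes {1..m}" for g
  proof -
    have "rep_character V g * rep_character W g = rep_character V (inv g) * rep_character W g"
      by (simp add: rep_character_inv[OF V g])
    also have "\<dots> = (\<Sum>b\<in>B. V.representation B (act V (inv g) b) b) * (\<Sum>c\<in>C. W.representation C (act W g c) c)"
      unfolding rep_character_def
      by (simp only: trace_on_eq[OF V.fin_dim_subspace_axioms B act_linmap[OF V permutes_inv[OF g]]]
          trace_on_eq[OF W.fin_dim_subspace_axioms C act_linmap[OF W g]])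
    also have "\<dots> = (\<Sum>b\<in>B. \<Sum>c\<in>C. V.representation B (act V (inv g) b) b * W.representation C (act W g c) c)"
      by (simp add: sum_product)
    also have "\<dots> = (\<Sum>b\<in>B. \<Sum>c\<in>C. W.representation C (act W g (elementary V B W b c (act V (inv g) b))) c)"
      using W.basis_subset[OF C] act_in[OF W g] unfolding elementary_def
      by (intro sum.cong refl) (simp add: linmap_scale[OF act_linmap[OF W g]] W.coord_scale[OF C])
    finally show ?thesis .
  qed
  have **: "W.representation C (average m V W (elementary V B W b c) b) c
      = (\<Sum>g | g permutes {1..m}. W.representation C (act W g (elementary V B W b c (act V (inv g) b))) c)"
    if "b \<in> B" "c \<in> C" for b c
    unfolding average_def
    using linmap_in[OF average_term_linmap[OF V W E[OF W.basis_subset[OF C that(2)]]] V.basis_subset[OF B that(1)]]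
    by (intro W.coord_sum[OF C]) auto
  have "fact m * char_inner m (rep_character V) (rep_character W) =
      (\<Sum>g | g permutes {1..m}. \<Sum>b\<in>B. \<Sum>c\<in>C.
         W.representation C (act W g (elementary V B W b c (act V (inv g) b))) c)"
    unfolding char_inner_def by (simp add: *)
  also have "\<dots> = (\<Sum>b\<in>B. \<Sum>g | g permutes {1..m}. \<Sum>c\<in>C.
         W.representation C (act W g (elementary V B W b c (act V (inv g) b))) c)"
    by (rule sum.swap)
  also have "\<dots> = (\<Sum>b\<in>B. \<Sum>c\<in>C. \<Sum>g | g permutes {1..m}.
         W.representation C (act W g (elementary V B W b c (act V (inv g) b))) c)"
    by (intro sum.cong refl sum.swap)
  also have "\<dots> = (\<Sum>b\<in>B. \<Sum>c\<in>C. W.representation C (average m V W (elementary V B W b c) b) c)"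
    by (intro sum.cong refl **[symmetric])
  finally show ?thesis .
qed

text \<open>
  Schur orthogonality: the average of a matrix unit is a scalar, which its trace determines.
\<close>

lemma absolutely_simple_norm:
  assumes V: "absolutely_simple m V"
  shows "char_inner m (rep_character V) (rep_character V) = 1"
proof -
  have sV: "sym_module m V" and ne: "space V \<noteq> {0}" using V unfolding absolutely_simple_def by auto
  note fd = sym_module_fin_dim[OF sV]
  interpret V: fin_dim_subspace "scale V" "space V" by (rule fd)
  obtain B where B: "V.basis B" using V.ex_basis by blast
  have n0: "card B \<noteq> 0"
    using trace_id_eq_0_iff[OF fd] trace_id_basis[OF fd B] ne by auto
  have diag: "V.representation B (average m V V (elementary V B V b c) b) c
      = (if b = c then fact m / of_nat (card B) else 0)" if b: "b \<in> B" and c: "c \<in> B" for b c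
  proof -
    note E = elementary_linmap[OF fd fd B V.basis_subset[OF B c], of b]
    obtain k where k: "\<And>v. v \<in> space V \<Longrightarrow> average m V V (elementary V B V b c) v = scale V k v"
      using V average_equivariant[OF sV sV E] unfolding absolutely_simple_def by blast
    have l: "(\<lambda>x. V.representation B x b) \<in> linmap (scale V) (space V) (*) UNIV"
      by (intro linmapI) (auto simp: V.coord_add[OF B] V.coord_scale[OF B])
    have "rep_trace V (elementary V B V b c) = V.representation B c b"
      unfolding elementary_def by (rule trace_rank_one[OF fd l V.basis_subset[OF B c]])
    then have "fact m * (if b = c then 1 else 0) = rep_trace V (average m V V (elementary V B V b c))"
      using trace_average[OF sV E] c V.coord_basis[OF B c, of b] by auto
    also have "\<dots> = rep_trace V (\<lambda>x. scale V k x)"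
      by (rule trace_cong[OF fd equivariant_linmap[OF average_equivariant[OF sV sV E]] k])
    also have "\<dots> = k * of_nat (card B)"
      using trace_scale[OF fd linmap_id, of k] by (simp add: trace_id_basis[OF fd B])
    finally have "k = fact m * (if b = c then 1 else 0) / of_nat (card B)"
      using n0 by (simp add: field_simps)
    then show ?thesis
      using k[OF V.basis_subset[OF B b]] V.basis_subset[OF B b]
      by (simp add: V.coord_scale[OF B] V.coord_basis[OF B b])
  qed
  have "fact m * char_inner m (rep_character V) (rep_character V)
      = (\<Sum>b\<in>B. \<Sum>c\<in>B. if b = c then fact m / of_nat (card B) else 0)"
    unfolding char_inner_average[OF sV sV B B] by (intro sum.cong refl diag)
  also have "\<dots> = fact m"
    using n0 V.finite_basis[OF B] by simp
  finally show ?thesis by simp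
qed

text \<open>
  A nonzero inner product produces an equivariant \<open>f\<close> with a nonzero diagonal entry. Averaging the
  opposite matrix unit gives \<open>p\<close> back to \<open>S\<close>, and \<open>p f\<close> is a scalar whose trace is a nonzero multiple
  of that entry.
\<close>

lemma simple_splits:
  assumes S: "absolutely_simple m S" and V: "sym_module m V"
    and ne: "char_inner m (rep_character S) (rep_character V) \<noteq> 0"
  obtains f p where "equivariant m S V f" "equivariant m V S p" "\<And>x. x \<in> space S \<Longrightarrow> p (f x) = x"
proof -
  have sS: "sym_module m S" using S unfolding absolutely_simple_def by auto
  note fS = sym_module_fin_dim[OF sS] and fV = sym_module_fin_dim[OF V]
  interpret S: fin_dim_subspace "scale S" "space S" by (rule fS)
  interpret V: fin_dim_subspace "scale V" "space V" by (rule fV)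
  obtain B where B: "S.basis B" using S.ex_basis by blast
  obtain C where C: "V.basis C" using V.ex_basis by blast
  have "(\<Sum>b\<in>B. \<Sum>c\<in>C. V.representation C (average m S V (elementary S B V b c) b) c) \<noteq> 0"
    using char_inner_average[OF sS V B C] ne by auto
  then obtain b where b: "b \<in> B" "(\<Sum>c\<in>C. V.representation C (average m S V (elementary S B V b c) b) c) \<noteq> 0"
    by (meson sum.neutral)
  then obtain c where c: "c \<in> C" "V.representation C (average m S V (elementary S B V b c) b) c \<noteq> 0"
    by (meson sum.neutral)
  define f where "f = average m S V (elementary S B V b c)"
  define e where "e = elementary V C S c b"
  define p where "p = average m V S e"
  have b': "b \<in> space S" and c': "c \<in> space V"
    using S.basis_subset[OF B b(1)] V.basis_subset[OF C c(1)] .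
  have f: "equivariant m S V f"
    unfolding f_def by (rule average_equivariant[OF sS V elementary_linmap[OF fS fV B c']])
  have e: "e \<in> linmaps V S"
    unfolding e_def by (rule elementary_linmap[OF fV fS C b'])
  have p: "equivariant m V S p"
    unfolding p_def by (rule average_equivariant[OF V sS e])
  note ef = linmap_comp[OF equivariant_linmap[OF f] e]
  have pf: "p (f x) = average m S S (\<lambda>y. e (f y)) x" if "x \<in> space S" for x
    unfolding p_def average_def
    using that by (intro sum.cong refl) (simp add: equivariant_act[OF f permutes_inv])
  obtain k where k: "\<And>v. v \<in> space S \<Longrightarrow> average m S S (\<lambda>y. e (f y)) v = scale S k v"
    using S average_equivariant[OF sS sS ef] unfolding absolutely_simple_def by blast
  have l: "(\<lambda>x. V.representation C (f x) c) \<in> linmap (scale S) (space S) (*) UNIV"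
    using linmap_in[OF equivariant_linmap[OF f]]
    by (intro linmapI) (auto simp: linmap_add[OF equivariant_linmap[OF f]]
        linmap_scale[OF equivariant_linmap[OF f]] V.coord_add[OF C] V.coord_scale[OF C])
  have "rep_trace S (\<lambda>y. e (f y)) = V.representation C (f b) c"
    unfolding e_def elementary_def by (rule trace_rank_one[OF fS l b'])
  then have "rep_trace S (average m S S (\<lambda>y. e (f y))) \<noteq> 0"
    using c(2) trace_average[OF sS ef] unfolding f_def by simp
  moreover have "rep_trace S (average m S S (\<lambda>y. e (f y)))
      = rep_trace S (\<lambda>x. scale S k x)"
    by (rule trace_cong[OF fS equivariant_linmap[OF average_equivariant[OF sS sS ef]] k])
  ultimately have k0: "k \<noteq> 0"
    using trace_scale[OF fS linmap_id, of k] by auto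
  show thesis
  proof (rule that[OF f])
    show "equivariant m V S (\<lambda>x. scale S (1 / k) (p x))"
      using p linmap_in[OF equivariant_linmap[OF p]] linmap_scaled[OF fS equivariant_linmap[OF p]]
      unfolding equivariant_def by (auto simp: linmap_scale[OF act_linmap[OF sS]])
    show "scale S (1 / k) (p (f x)) = x" if "x \<in> space S" for x
      using k0 by (simp add: pf[OF that] k[OF that])
  qed
qed

section \<open>Decomposition into absolutely simple summands\<close>

lemma rep_character_id:
  assumes "sym_module m V"
  shows "rep_character V id = rep_trace V (\<lambda>x. x)"
  unfolding rep_character_def
  by (rule trace_cong[OF sym_module_fin_dim[OF assms] act_linmap[OF assms permutes_id]])
     (rule act_id[OF assms])

text \<open>
  A direct summand \<open>S\<close> of \<open>V\<close>, with the kernel of the projection as complement.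
\<close>

locale split_module =
  fixes m :: nat and S :: "'s::ab_group_add sym_rep" and V :: "'v::ab_group_add sym_rep"
    and f :: "'s \<Rightarrow> 'v" and p :: "'v \<Rightarrow> 's"
  assumes S: "sym_module m S" and V: "sym_module m V"
    and f: "equivariant m S V f" and p: "equivariant m V S p"
    and retract: "\<And>x. x \<in> space S \<Longrightarrow> p (f x) = x"
begin

definition kernel :: "'v sym_rep" where
  "kernel = V\<lparr>space := {v \<in> space V. p v = 0}\<rparr>"

lemma kernel_simps [simp]:
  "scale kernel = scale V" "act kernel = act V" "space kernel = {v \<in> space V. p v = 0}"
  by (simp_all add: kernel_def)

lemmas fS = sym_module_fin_dim[OF S]
lemmas fV = sym_module_fin_dim[OF V]
lemmas f_lin = equivariant_linmap[OF f]
lemmas p_lin = equivariant_linmap[OF p]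

sublocale S: fin_dim_subspace "scale S" "space S" by (rule fS)
sublocale V: fin_dim_subspace "scale V" "space V" by (rule fV)

lemma fp_lin: "(\<lambda>v. f (p v)) \<in> linmaps V V"
  by (rule linmap_comp[OF p_lin f_lin])

lemma proj_lin: "(\<lambda>v. v - f (p v)) \<in> linmaps V V"
  by (rule linmap_minus[OF fV linmap_id fp_lin])

lemma proj_kernel: "v \<in> space V \<Longrightarrow> p (v - f (p v)) = 0"
  using linmap_in[OF fp_lin] linmap_in[OF p_lin]
  by (subst linmap_diff[OF fV p_lin]) (auto simp: retract)

lemma proj_lin_kernel: "(\<lambda>v. v - f (p v)) \<in> linmap (scale V) (space V) (scale V) (space kernel)"
  using proj_lin linmap_in[OF proj_lin] proj_kernel unfolding linmap_def by simp

lemma f_0: "f 0 = 0"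
  by (rule linmap_0[OF fS f_lin])

lemma proj_image: "(\<lambda>v. v - f (p v)) ` space V = space kernel"
proof (intro equalityI subsetI)
  fix v assume "v \<in> space kernel"
  then show "v \<in> (\<lambda>v. v - f (p v)) ` space V"
    by (intro image_eqI[where x = v]) (simp_all add: f_0)
qed (use proj_kernel linmap_in[OF proj_lin] in auto)

lemma fK: "fin_dim_subspace (scale V) (space kernel)"
  using fin_dim_subspace_image[OF fV fV proj_lin] by (simp only: proj_image)

lemma act_0: "g permutes {1..m} \<Longrightarrow> act S g 0 = 0"
  by (rule linmap_0[OF fS act_linmap[OF S]])

lemma kernel_sym_module: "sym_module m kernel"
proof -
  interpret K: fin_dim_subspace "scale V" "space kernel" by (rule fK)
  have "act V g v \<in> space kernel" if "g permutes {1..m}" "v \<in> space kernel" for g v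
    using that equivariant_act[OF p that(1)] act_in[OF V that(1)] by (simp add: act_0)
  then show ?thesis
    using V V.vector_space_axioms K.subspace K.generated
    unfolding sym_module_def kernel_simps(1,2) by auto
qed

lemma kernel_character:
  assumes g: "g permutes {1..m}"
  shows "rep_character kernel g = rep_character V g - rep_character S g"
proof -
  note gV = act_linmap[OF V g]
  have gK: "act V g \<in> linmap (scale V) (space kernel) (scale V) (space V)"
    using gV unfolding linmap_def by simp
  note a = linmap_comp[OF p_lin linmap_comp[OF f_lin gV]]
  note b = linmap_comp[OF proj_lin_kernel gK]
  have "rep_character V g = rep_trace V (\<lambda>v. act V g (f (p v)) + act V g (v - f (p v)))"
    unfolding rep_character_def
  proof (rule trace_cong[OF fV gV])
    fix v assume v: "v \<in> space V"
    show "act V g v = act V g (f (p v)) + act V g (v - f (p v))"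
      using linmap_add[OF gV linmap_in[OF fp_lin v] linmap_in[OF proj_lin v]] by simp
  qed
  also have "\<dots> = rep_trace V (\<lambda>v. act V g (f (p v)))
      + rep_trace V (\<lambda>v. act V g (v - f (p v)))"
    by (rule trace_add[OF fV a b])
  also have "rep_trace V (\<lambda>v. act V g (f (p v)))
      = rep_trace S (\<lambda>x. p (act V g (f x)))"
    by (rule trace_cyclic[OF fV fS p_lin linmap_comp[OF f_lin gV]])
  also have "\<dots> = rep_character S g"
    unfolding rep_character_def
  proof (rule trace_cong[OF fS linmap_comp[OF linmap_comp[OF f_lin gV] p_lin]])
    fix x assume x: "x \<in> space S"
    show "p (act V g (f x)) = act S g x"
      using equivariant_act[OF f g x] retract[OF act_in[OF S g x]] by simp
  qed
  also have "rep_trace V (\<lambda>v. act V g (v - f (p v)))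
      = trace_on (scale V) (space kernel) (\<lambda>x. act V g x - f (p (act V g x)))"
    by (rule trace_cyclic[OF fV fK proj_lin_kernel gK])
  also have "\<dots> = rep_character kernel g"
    unfolding rep_character_def kernel_simps(1,2)
  proof (rule trace_cong[OF fK linmap_comp[OF gK proj_lin_kernel]])
    fix x assume x: "x \<in> space kernel"
    then show "act V g x - f (p (act V g x)) = act V g x"
      using equivariant_act[OF p g] by (simp add: act_0[OF g] f_0)
  qed
  finally show ?thesis by simp
qed

lemma kernel_iso_extend:
  assumes iso: "rep_iso m kernel (direct_sum I F)" and k: "k \<notin> I" and F: "F k = S"
    and scale_0: "\<And>i c. scale (F i) c 0 = 0"
  shows "rep_iso m V (direct_sum (insert k I) F)"
proof -
  let ?D = "direct_sum I F" and ?E = "direct_sum (insert k I) F"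
  obtain u where u: "bij_betw u (space kernel) (space ?D)"
    and u_add: "\<And>v w. v \<in> space kernel \<Longrightarrow> w \<in> space kernel \<Longrightarrow> u (v + w) = u v + u w"
    and u_scale: "\<And>c v. v \<in> space kernel \<Longrightarrow> u (scale V c v) = scale ?D c (u v)"
    and u_act: "\<And>g v. g permutes {1..m} \<Longrightarrow> v \<in> space kernel \<Longrightarrow> u (act V g v) = act ?D g (u v)"
    using iso unfolding rep_iso_def by auto
  define q where "q v = v - f (p v)" for v
  have q: "q \<in> linmap (scale V) (space V) (scale V) (space kernel)"
    using proj_lin_kernel unfolding q_def by simp
  define w where "w v = (u (q v))(k := p v)" for v
  have u_in: "u v \<in> space ?D" if "v \<in> space kernel" for v
    using u that bij_betwE by blast
  have uk: "u v k = 0" if "v \<in> space kernel" for v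
    using u_in[OF that] k by (simp add: direct_sum_def)
  have q_act: "q (act V g v) = act V g (q v)" if "g permutes {1..m}" "v \<in> space V" for g v
    using that linmap_in[OF fp_lin that(2)] linmap_in[OF p_lin that(2)]
    by (simp add: q_def equivariant_act[OF p] equivariant_act[OF f, symmetric] linmap_diff[OF fV act_linmap[OF V]])
  have q_kernel: "q (x + f y) = x" "p (x + f y) = y" if "x \<in> space kernel" "y \<in> space S" for x y
    using that linmap_in[OF f_lin] by (auto simp: q_def linmap_add[OF p_lin] retract)
  have "bij_betw w (space V) (space ?E)"
  proof (rule bij_betwI)
    show "w \<in> space V \<rightarrow> space ?E"
    proof
      fix v assume v: "v \<in> space V"
      have "finite (insert k {i. u (q v) i \<noteq> 0})"
        using u_in[OF linmap_in[OF q v]] by (simp add: direct_sum_def)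
      then have "finite {i. w v i \<noteq> 0}"
        by (rule rev_finite_subset) (auto simp: w_def)
      then show "w v \<in> space ?E"
        using u_in[OF linmap_in[OF q v]] linmap_in[OF p_lin v]
        by (auto simp: direct_sum_def w_def F)
    qed
    let ?back = "\<lambda>h. inv_into (space kernel) u (h(k := 0)) + f (h k)"
    have down: "h(k := 0) \<in> space ?D" "h k \<in> space S" if "h \<in> space ?E" for h
    proof -
      have "finite {i. h i \<noteq> 0}" using that by (simp add: direct_sum_def)
      then have "finite {i. (h(k := 0)) i \<noteq> 0}"
        by (rule rev_finite_subset) auto
      then show "h(k := 0) \<in> space ?D" "h k \<in> space S"
        using that k by (auto simp: direct_sum_def F)
    qed
    have back_in: "inv_into (space kernel) u h \<in> space kernel" if "h \<in> space ?D" for h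
      using that u by (metis bij_betw_imp_surj_on inv_into_into)
    show "?back \<in> space ?E \<rightarrow> space V"
      using back_in[OF down(1)] linmap_in[OF f_lin down(2)] V.subspace_add[OF V.subspace] by auto
    show "?back (w v) = v" if v: "v \<in> space V" for v
    proof -
      have "(w v)(k := 0) = u (q v)"
        using uk[OF linmap_in[OF q v]] by (auto simp: w_def)
      then show ?thesis
        using bij_betw_inv_into_left[OF u linmap_in[OF q v]] by (simp add: w_def q_def)
    qed
    show "w (?back h) = h" if h: "h \<in> space ?E" for h
      using q_kernel[OF back_in[OF down(1)[OF h]] down(2)[OF h]] bij_betw_inv_into_right[OF u down(1)[OF h]]
      by (auto simp: w_def)
  qed
  moreover have "w (v + v') = w v + w v'" if "v \<in> space V" "v' \<in> space V" for v v'
    using that by (auto simp: w_def linmap_add[OF q] linmap_add[OF p_lin] u_add[OF linmap_in[OF q] linmap_in[OF q]])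
  moreover have "w (scale V c v) = scale ?E c (w v)" if "v \<in> space V" for c v
    using that by (auto simp: w_def linmap_scale[OF q] linmap_scale[OF p_lin] u_scale[OF linmap_in[OF q]]
        direct_sum_def F fun_eq_iff)
  moreover have "w (act V g v) = act ?E g (w v)" if "g permutes {1..m}" "v \<in> space V" for g v
    using that k by (auto simp: w_def q_act u_act[OF _ linmap_in[OF q]] equivariant_act[OF p]
        direct_sum_def F fun_eq_iff)
  ultimately show ?thesis
    unfolding rep_iso_def by blast
qed

end

lemma char_inner_cong:
  assumes "\<And>g. g permutes {1..m} \<Longrightarrow> \<chi> g = \<chi>' g" "\<And>g. g permutes {1..m} \<Longrightarrow> \<psi> g = \<psi>' g"
  shows "char_inner m \<chi> \<psi> = char_inner m \<chi>' \<psi>'"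
  unfolding char_inner_def using assms by simp

lemma char_inner_commute: "char_inner m \<chi> \<psi> = char_inner m \<psi> \<chi>"
  unfolding char_inner_def by (simp add: mult.commute)

lemma char_inner_lincomb:
  "char_inner m \<chi> (\<lambda>g. \<Sum>l\<in>L. c l * \<psi> l g) = (\<Sum>l\<in>L. c l * char_inner m \<chi> (\<psi> l))"
proof -
  have "(\<Sum>g | g permutes {1..m}. \<chi> g * (\<Sum>l\<in>L. c l * \<psi> l g))
      = (\<Sum>g | g permutes {1..m}. \<Sum>l\<in>L. c l * (\<chi> g * \<psi> l g))"
    by (simp add: sum_distrib_left mult_ac)
  also have "\<dots> = (\<Sum>l\<in>L. c l * (\<Sum>g | g permutes {1..m}. \<chi> g * \<psi> l g))"
    by (subst sum.swap) (simp add: sum_distrib_left)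
  finally show ?thesis
    unfolding char_inner_def by (simp flip: sum_divide_distrib)
qed

text \<open>
  By orthonormality the coefficient \<open>c k\<close> is the inner product of the characters of \<open>S k\<close> and \<open>V\<close>. If it is
  not zero, then \<open>S k\<close> splits off, which lowers \<open>c k\<close> by one and the dimension of \<open>V\<close>. If all
  coefficients vanish, then so does the character, hence \<open>V\<close>. So the coefficients are natural numbers.
\<close>

theorem decomposition_from_character:
  fixes S :: "'l \<Rightarrow> 's::ab_group_add sym_rep" and V :: "'v::ab_group_add sym_rep"
  assumes L: "finite L"
    and simple: "\<And>l. l \<in> L \<Longrightarrow> absolutely_simple m (S l)"
    and orth: "\<And>l l'. l \<in> L \<Longrightarrow> l' \<in> L \<Longrightarrow> l \<noteq> l' \<Longrightarrow>
      char_inner m (rep_character (S l)) (rep_character (S l')) = 0"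
    and scale_0: "\<And>l c. scale (S l) c 0 = 0"
    and V: "sym_module m V"
    and char: "\<And>g. g permutes {1..m} \<Longrightarrow> rep_character V g = (\<Sum>l\<in>L. c l * rep_character (S l) g)"
  shows "\<exists>n. (\<forall>l\<in>L. c l = of_nat (n l)) \<and>
    rep_iso m V (direct_sum {(l, j). l \<in> L \<and> j < n l} (\<lambda>(l, j :: nat). S l))"
proof -
  have "\<exists>d::nat. rep_character V id = of_nat d"
    using trace_id_basis[OF sym_module_fin_dim[OF V]]
      fin_dim_subspace.ex_basis[OF sym_module_fin_dim[OF V]]
    by (auto simp: rep_character_id[OF V])
  then obtain d :: nat where "rep_character V id = of_nat d" by blast
  then show ?thesis
    using V char
  proof (induction d arbitrary: V c rule: less_induct)
    case (less d)
    note V = less.prems(2) and char = less.prems(3)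
    show ?case
    proof (cases "\<forall>l\<in>L. c l = 0")
      case True
      then have "rep_character V id = 0" unfolding char[OF permutes_id] by simp
      then have "space V = {0}"
        using trace_id_eq_0_iff[OF sym_module_fin_dim[OF V]] rep_character_id[OF V] by simp
      moreover have "space (direct_sum {} (\<lambda>(l, j::nat). S l)) = {0}"
        by (auto simp: direct_sum_def fun_eq_iff)
      ultimately have "rep_iso m V (direct_sum {} (\<lambda>(l, j::nat). S l))"
        using act_in[OF V] unfolding rep_iso_def
        by (intro exI[of _ "\<lambda>_. 0"]) (auto simp: bij_betw_def direct_sum_def fun_eq_iff scale_0)
      with True show ?thesis
        by (intro exI[of _ "\<lambda>_. 0"]) simp
    next
      case False
      then obtain k where k: "k \<in> L" "c k \<noteq> 0" by blast
      have "char_inner m (rep_character (S k)) (rep_character V)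
          = char_inner m (rep_character (S k)) (\<lambda>g. \<Sum>l\<in>L. c l * rep_character (S l) g)"
        by (rule char_inner_cong) (simp_all add: char)
      also have "\<dots> = (\<Sum>l\<in>L. c l * char_inner m (rep_character (S k)) (rep_character (S l)))"
        by (rule char_inner_lincomb)
      also have "\<dots> = (\<Sum>l\<in>L. if l = k then c k else 0)"
        using k orth absolutely_simple_norm[OF simple[OF k(1)]] by (intro sum.cong refl) auto
      also have "\<dots> = c k" using k L by simp
      finally have "char_inner m (rep_character (S k)) (rep_character V) \<noteq> 0" using k by simp
      from simple_splits[OF simple[OF k(1)] V this]
      obtain f p where fp: "equivariant m (S k) V f" "equivariant m V (S k) p"
        "\<And>x. x \<in> space (S k) \<Longrightarrow> p (f x) = x" by blast
      have Sk: "sym_module m (S k)" "space (S k) \<noteq> {0}"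
        using simple[OF k(1)] unfolding absolutely_simple_def by auto
      interpret split_module m "S k" V f p
        using Sk V fp by unfold_locales
      obtain d' :: nat where d': "rep_character kernel id = of_nat d'"
        using trace_id_basis[OF sym_module_fin_dim[OF kernel_sym_module]]
          fin_dim_subspace.ex_basis[OF sym_module_fin_dim[OF kernel_sym_module]]
        by (auto simp: rep_character_id[OF kernel_sym_module])
      obtain e :: nat where e: "rep_character (S k) id = of_nat e"
        using trace_id_basis[OF fS] S.ex_basis by (auto simp: rep_character_id[OF Sk(1)])
      have "e \<noteq> 0"
        using e trace_id_eq_0_iff[OF fS] Sk(2) rep_character_id[OF Sk(1)] by auto
      moreover have "(of_nat d :: rat) = of_nat (d' + e)"
        using kernel_character[OF permutes_id] d' e less.prems(1) by simp
      then have "d = d' + e" by (simp only: of_nat_eq_iff)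
      ultimately have "d' < d" by simp
      define c' where "c' = c(k := c k - 1)"
      have char': "rep_character kernel g = (\<Sum>l\<in>L. c' l * rep_character (S l) g)"
        if g: "g permutes {1..m}" for g
      proof -
        have "(\<Sum>l\<in>L. c' l * rep_character (S l) g)
            = (\<Sum>l\<in>L. c l * rep_character (S l) g - (if l = k then rep_character (S k) g else 0))"
          unfolding c'_def by (intro sum.cong refl) (auto simp: algebra_simps)
        also have "\<dots> = rep_character V g - rep_character (S k) g"
          using k(1) L by (simp add: sum_subtractf char[OF g])
        finally show ?thesis by (simp add: kernel_character[OF g])
      qed
      from less.IH[OF \<open>d' < d\<close> d' kernel_sym_module char']
      obtain n where n: "\<forall>l\<in>L. c' l = of_nat (n l)"
        and iso: "rep_iso m kernel (direct_sum {(l, j). l \<in> L \<and> j < n l} (\<lambda>(l, j). S l))" by blast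
      define n' where "n' = n(k := Suc (n k))"
      have "{(l, j). l \<in> L \<and> j < n' l} = insert (k, n k) {(l, j). l \<in> L \<and> j < n l}"
        using k(1) unfolding n'_def by (auto split: if_splits)
      then have "rep_iso m V (direct_sum {(l, j). l \<in> L \<and> j < n' l} (\<lambda>(l, j). S l))"
        using kernel_iso_extend[OF iso, of "(k, n k)"] scale_0 by auto
      moreover have "\<forall>l\<in>L. c l = of_nat (n' l)"
        using n k(1) unfolding c'_def n'_def by (auto simp: algebra_simps split: if_splits)
      ultimately show ?thesis by blast
    qed
  qed
qed

text \<open>
  The identity of \<open>V\<close> is the sum of the compositions of the projections \<open>V \<rightarrow> F i\<close> with the
  inclusions \<open>F i \<rightarrow> V\<close>. By cyclicity each of them contributes the trace on \<open>F i\<close>.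
\<close>

lemma rep_character_direct_sum:
  fixes V :: "'v::ab_group_add sym_rep" and F :: "'i \<Rightarrow> 's::ab_group_add sym_rep"
  assumes V: "sym_module m V" and I: "finite I" and F: "\<And>i. i \<in> I \<Longrightarrow> sym_module m (F i)"
    and scale_0: "\<And>i c. scale (F i) c 0 = 0"
    and iso: "rep_iso m V (direct_sum I F)" and g: "g permutes {1..m}"
  shows "rep_character V g = (\<Sum>i\<in>I. rep_character (F i) g)"
proof -
  let ?D = "direct_sum I F"
  note fV = sym_module_fin_dim[OF V] and gV = act_linmap[OF V g]
  interpret V: fin_dim_subspace "scale V" "space V" by (rule fV)
  obtain u where u: "bij_betw u (space V) (space ?D)"
    and u_add: "\<And>v w. v \<in> space V \<Longrightarrow> w \<in> space V \<Longrightarrow> u (v + w) = u v + u w"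
    and u_scale: "\<And>c v. v \<in> space V \<Longrightarrow> u (scale V c v) = scale ?D c (u v)"
    and u_act: "\<And>g v. g permutes {1..m} \<Longrightarrow> v \<in> space V \<Longrightarrow> u (act V g v) = act ?D g (u v)"
    using iso unfolding rep_iso_def by auto
  have u_lin: "u \<in> linmap (scale V) (space V) (scale ?D) (space ?D)"
    using u by (intro linmapI u_add u_scale) (auto simp: bij_betw_def)
  have inj: "v = w" if "u v = u w" "v \<in> space V" "w \<in> space V" for v w
    using u that unfolding bij_betw_def inj_on_def by blast
  define e where "e i x = (\<lambda>j. if j = i then x else 0)" for i :: 'i and x :: 's
  have e_in: "e i x \<in> space ?D" if "i \<in> I" "x \<in> space (F i)" for i x
  proof -
    have "0 \<in> space (F j)" if "j \<in> I" for j
    proof -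
      interpret fin_dim_subspace "scale (F j)" "space (F j)"
        by (rule sym_module_fin_dim[OF F[OF that]])
      show ?thesis by (rule subspace_0[OF subspace])
    qed
    moreover have "finite {j. e i x j \<noteq> 0}"
      by (rule finite_subset[of _ "{i}"]) (auto simp: e_def)
    ultimately show ?thesis using that by (auto simp: direct_sum_def e_def)
  qed
  define \<iota> where "\<iota> i x = inv_into (space V) u (e i x)" for i x
  have \<iota>: "\<iota> i x \<in> space V" "u (\<iota> i x) = e i x" if "i \<in> I" "x \<in> space (F i)" for i x
    unfolding \<iota>_def using e_in[OF that] u
    by (auto simp: bij_betw_def inv_into_into f_inv_into_f)
  have F_add: "x + y \<in> space (F i)" and F_scale: "scale (F i) c x \<in> space (F i)"
    if "i \<in> I" "x \<in> space (F i)" "y \<in> space (F i)" for i x y c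
  proof -
    interpret fin_dim_subspace "scale (F i)" "space (F i)"
      by (rule sym_module_fin_dim[OF F[OF that(1)]])
    show "x + y \<in> space (F i)" "scale (F i) c x \<in> space (F i)"
      using subspace_add[OF subspace] subspace_scale[OF subspace] that by auto
  qed
  have \<iota>_lin: "\<iota> i \<in> linmaps (F i) V" if i: "i \<in> I" for i
  proof (rule linmapI)
    show "\<iota> i (x + y) = \<iota> i x + \<iota> i y" if "x \<in> space (F i)" "y \<in> space (F i)" for x y
      using i that F_add[OF i that]
      by (intro inj) (auto simp: \<iota> u_add e_def fun_eq_iff intro!: V.subspace_add[OF V.subspace])
    show "\<iota> i (scale (F i) c x) = scale V c (\<iota> i x)" if "x \<in> space (F i)" for x c
      using i that F_scale[OF i that that]
      by (intro inj) (auto simp: \<iota> u_scale e_def fun_eq_iff direct_sum_def scale_0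
          intro!: V.subspace_scale[OF V.subspace])
  qed (rule \<iota>(1)[OF i])
  have \<pi>_lin: "(\<lambda>v. u v i) \<in> linmaps V (F i)" if i: "i \<in> I" for i
    using linmap_in[OF u_lin] i by (intro linmapI) (auto simp: u_add u_scale direct_sum_def)
  have expand: "(\<Sum>i\<in>I. \<iota> i (u v i)) = v" if v: "v \<in> space V" for v
  proof (rule inj)
    note in1 = \<iota>(1)[OF _ linmap_in[OF \<pi>_lin v]]
    show "(\<Sum>i\<in>I. \<iota> i (u v i)) \<in> space V"
      using in1 by (intro V.subspace_sum[OF V.subspace]) auto
    have "u (\<Sum>i\<in>I. \<iota> i (u v i)) = (\<Sum>i\<in>I. u (\<iota> i (u v i)))"
      using in1 by (intro linmap_sum[OF fV u_lin]) auto
    also have "\<dots> = (\<Sum>i\<in>I. e i (u v i))"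
      by (intro sum.cong refl \<iota>(2) linmap_in[OF \<pi>_lin v])
    also have "\<dots> = u v"
    proof
      fix j
      have "(\<Sum>i\<in>I. e i (u v i)) j = (\<Sum>i\<in>I. if j = i then u v i else 0)"
        by (induction I rule: infinite_finite_induct) (auto simp: e_def)
      also have "\<dots> = u v j"
        using I linmap_in[OF u_lin v] by (auto simp: direct_sum_def)
      finally show "(\<Sum>i\<in>I. e i (u v i)) j = u v j" .
    qed
    finally show "u (\<Sum>i\<in>I. \<iota> i (u v i)) = u v" .
  qed (rule v)
  have "rep_character V g = rep_trace V (\<lambda>v. \<Sum>i\<in>I. act V g (\<iota> i (u v i)))"
    unfolding rep_character_def
  proof (rule trace_cong[OF fV gV])
    fix v assume v: "v \<in> space V"
    have "act V g v = act V g (\<Sum>i\<in>I. \<iota> i (u v i))" by (simp add: expand[OF v])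
    also have "\<dots> = (\<Sum>i\<in>I. act V g (\<iota> i (u v i)))"
      using \<iota>(1)[OF _ linmap_in[OF \<pi>_lin v]] by (intro linmap_sum[OF fV gV]) auto
    finally show "act V g v = (\<Sum>i\<in>I. act V g (\<iota> i (u v i)))" .
  qed
  also have "\<dots> = (\<Sum>i\<in>I. rep_trace V (\<lambda>v. act V g (\<iota> i (u v i))))"
    using linmap_comp[OF \<pi>_lin linmap_comp[OF \<iota>_lin gV]] by (intro trace_sum[OF fV]) auto
  also have "\<dots> = (\<Sum>i\<in>I. rep_character (F i) g)"
  proof (rule sum.cong[OF refl])
    fix i assume i: "i \<in> I"
    note fF = sym_module_fin_dim[OF F[OF i]]
    have "rep_trace V (\<lambda>v. act V g (\<iota> i (u v i)))
        = rep_trace (F i) (\<lambda>x. u (act V g (\<iota> i x)) i)"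
      by (rule trace_cyclic[OF fV fF \<pi>_lin[OF i] linmap_comp[OF \<iota>_lin[OF i] gV]])
    also have "\<dots> = rep_character (F i) g"
      unfolding rep_character_def
      using i by (intro trace_cong[OF fF linmap_comp[OF linmap_comp[OF \<iota>_lin[OF i] gV] \<pi>_lin[OF i]]])
        (simp add: u_act[OF g] \<iota> direct_sum_def e_def)
    finally show "rep_trace V (\<lambda>v. act V g (\<iota> i (u v i))) = rep_character (F i) g" .
  qed
  finally show ?thesis .
qed

section \<open>Counting matrices with signs\<close>

text \<open>
  The vector \<open>(l - 1, \<dots>, 1, 0)\<close>. Adding it turns partitions into strictly decreasing vectors.
\<close>

definition staircase :: "nat \<Rightarrow> nat \<Rightarrow> int" where
  "staircase l i = int l - 1 - int i"

text \<open>
  The coefficient of \<open>x\<^sup>a\<close> in the Vandermonde determinant in \<open>l\<close> variables.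
\<close>

definition alternant :: "nat \<Rightarrow> (nat \<Rightarrow> int) \<Rightarrow> int" where
  "alternant l a = (\<Sum>\<pi> | \<pi> permutes {..<l}. sign \<pi> * (if \<forall>i<l. a i = staircase l (\<pi> i) then 1 else 0))"

text \<open>
  The vectors \<open>b\<close> for which \<open>x\<^sup>a\<^sup>-\<^sup>b\<close> is a monomial of degree \<open>r\<close>. Outside of the first \<open>l\<close> indices
  they agree with \<open>a\<close>, so that the set is finite.
\<close>

definition below :: "nat \<Rightarrow> (nat \<Rightarrow> int) \<Rightarrow> int \<Rightarrow> (nat \<Rightarrow> int) set" where
  "below l a r = {b. (\<forall>i\<ge>l. b i = a i) \<and> (\<forall>i<l. b i \<le> a i) \<and> (\<Sum>i<l. a i - b i) = r}"

text \<open>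
  In terms of generating functions, \<open>signed_count l \<beta> n a\<close> is the coefficient of \<open>x\<^sup>a\<close> in
  the product of the Vandermonde alternant in \<open>l\<close> variables and the complete homogeneous symmetric
  functions of degrees \<open>\<beta> 0, \<dots>, \<beta> (n - 1)\<close>.
\<close>

primrec signed_count :: "nat \<Rightarrow> (nat \<Rightarrow> int) \<Rightarrow> nat \<Rightarrow> (nat \<Rightarrow> int) \<Rightarrow> int" where
  "signed_count l \<beta> 0 a = alternant l a"
| "signed_count l \<beta> (Suc n) a = (\<Sum>b\<in>below l a (\<beta> n). signed_count l \<beta> n b)"

lemma finite_below: "finite (below l a r)"
proof (rule inj_on_finite)
  show "inj_on (\<lambda>b. restrict b {..<l}) (below l a r)"
  proof (rule inj_onI)
    fix b c assume b: "b \<in> below l a r" and c: "c \<in> below l a r"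
      and eq: "restrict b {..<l} = restrict c {..<l}"
    show "b = c"
    proof
      fix i
      show "b i = c i"
      proof (cases "i < l")
        case True then show ?thesis using fun_cong[OF eq, of i] by simp
      next
        case False then show ?thesis using b c by (simp add: below_def)
      qed
    qed
  qed
  show "(\<lambda>b. restrict b {..<l}) ` below l a r \<subseteq> (\<Pi>\<^sub>E i\<in>{..<l}. {a i - r..a i})"
  proof (intro image_subsetI PiE_I)
    fix b i assume b: "b \<in> below l a r" and i: "i \<in> {..<l}"
    have "a i - b i \<le> (\<Sum>i<l. a i - b i)"
      using b i by (intro member_le_sum) (auto simp: below_def)
    then show "restrict b {..<l} i \<in> {a i - r..a i}" using b i by (auto simp: below_def)
  qed auto
  show "finite (\<Pi>\<^sub>E i\<in>{..<l}. {a i - r..a i})" by (intro finite_PiE) auto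
qed

lemma transpose_permutes: "Suc i < l \<Longrightarrow> transpose i (Suc i) permutes {..<l}"
  by (intro permutes_swap_id) auto

lemma all_less_transpose: "Suc i < l \<Longrightarrow> (\<forall>j<l. P (transpose i (Suc i) j)) \<longleftrightarrow> (\<forall>j<l. P j)"
  using permutes_in_image[OF transpose_permutes] by (metis lessThan_iff transpose_involutory)

lemma alternant_swap:
  assumes i: "Suc i < l"
  shows "alternant l (a \<circ> transpose i (Suc i)) = - alternant l a"
proof -
  let ?t = "transpose i (Suc i)"
  have t: "?t permutes {..<l}" by (rule transpose_permutes[OF i])
  have "alternant l (a \<circ> ?t)
      = (\<Sum>\<pi> | \<pi> permutes {..<l}. sign (\<pi> \<circ> ?t) * (if \<forall>j<l. (a \<circ> ?t) j = staircase l ((\<pi> \<circ> ?t) j) then 1 else 0))"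
    unfolding alternant_def by (rule sum_permutations_compose_right[OF t])
  also have "\<dots> = (\<Sum>\<pi> | \<pi> permutes {..<l}. - (sign \<pi> * (if \<forall>j<l. a j = staircase l (\<pi> j) then 1 else 0)))"
  proof (rule sum.cong[OF refl])
    fix \<pi> assume "\<pi> \<in> {\<pi>. \<pi> permutes {..<l}}"
    then have "permutation \<pi>" using permutes_imp_permutation[OF finite_lessThan] by blast
    then have "sign (\<pi> \<circ> ?t) = - sign \<pi>"
      by (simp add: sign_compose permutation_swap_id sign_swap_id)
    moreover have "(\<forall>j<l. (a \<circ> ?t) j = staircase l ((\<pi> \<circ> ?t) j)) \<longleftrightarrow> (\<forall>j<l. a j = staircase l (\<pi> j))"
      using all_less_transpose[OF i, of "\<lambda>j. a j = staircase l (\<pi> j)"] by simp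
    ultimately show "sign (\<pi> \<circ> ?t) * (if \<forall>j<l. (a \<circ> ?t) j = staircase l ((\<pi> \<circ> ?t) j) then 1 else 0)
        = - (sign \<pi> * (if \<forall>j<l. a j = staircase l (\<pi> j) then 1 else 0))" by simp
  qed
  finally show ?thesis by (simp add: alternant_def sum_negf)
qed

lemma sum_transpose: "Suc i < l \<Longrightarrow> (\<Sum>j<l. f (transpose i (Suc i) j)) = (\<Sum>j<l. f j)"
  using sum.permute[OF transpose_permutes, of i l f] by (simp add: comp_def)

lemma below_swap_iff:
  assumes i: "Suc i < l"
  shows "b \<circ> transpose i (Suc i) \<in> below l (a \<circ> transpose i (Suc i)) r \<longleftrightarrow> b \<in> below l a r"
proof -
  let ?t = "transpose i (Suc i)"
  have "?t j = j" if "j \<ge> l" for j using that i by (simp add: transpose_def)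
  then have "(\<forall>j\<ge>l. (b \<circ> ?t) j = (a \<circ> ?t) j) \<longleftrightarrow> (\<forall>j\<ge>l. b j = a j)" by simp
  moreover have "(\<forall>j<l. (b \<circ> ?t) j \<le> (a \<circ> ?t) j) \<longleftrightarrow> (\<forall>j<l. b j \<le> a j)"
    using all_less_transpose[OF i, of "\<lambda>j. b j \<le> a j"] by simp
  moreover have "(\<Sum>j<l. (a \<circ> ?t) j - (b \<circ> ?t) j) = (\<Sum>j<l. a j - b j)"
    using sum_transpose[OF i, of "\<lambda>j. a j - b j"] by simp
  ultimately show ?thesis unfolding below_def by simp
qed

lemma comp_transpose_twice: "(b \<circ> transpose i j) \<circ> transpose i j = b"
  by (simp add: comp_assoc)

lemma signed_count_swap:
  assumes i: "Suc i < l"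
  shows "signed_count l \<beta> n (a \<circ> transpose i (Suc i)) = - signed_count l \<beta> n a"
proof (induction n arbitrary: a)
  case (Suc n)
  let ?t = "transpose i (Suc i)"
  have "(\<Sum>b\<in>below l (a \<circ> ?t) (\<beta> n). signed_count l \<beta> n b)
      = (\<Sum>b\<in>below l a (\<beta> n). signed_count l \<beta> n (b \<circ> ?t))"
    using below_swap_iff[OF i, of _ a] below_swap_iff[OF i, of "_ \<circ> ?t" a]
    by (intro sum.reindex_bij_witness[of _ "\<lambda>b. b \<circ> ?t" "\<lambda>b. b \<circ> ?t"]) (simp_all only: comp_transpose_twice)
  then show ?case by (simp only: signed_count.simps Suc.IH sum_negf)
qed (simp add: alternant_swap[OF i])

text \<open>
  Terms that violate interlacing cancel in pairs: at the first violation \<open>i\<close> both \<open>b i\<close> and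
  \<open>b (i + 1)\<close> are at most \<open>a (i + 1)\<close>, so that exchanging them stays below \<open>a\<close>, keeps the
  first violation in place, and changes the sign.
\<close>

lemma pieri_cancellation:
  fixes f :: "(nat \<Rightarrow> int) \<Rightarrow> int"
  assumes alt: "\<And>i b. Suc i < l \<Longrightarrow> f (b \<circ> transpose i (Suc i)) = - f b"
    and a: "\<And>i. Suc i < l \<Longrightarrow> a (Suc i) < a i"
  shows "(\<Sum>b\<in>below l a r. f b) = (\<Sum>b\<in>{b\<in>below l a r. \<forall>i. Suc i < l \<longrightarrow> a (Suc i) < b i}. f b)"
proof -
  let ?bad = "\<lambda>b i. Suc i < l \<and> b i \<le> a (Suc i)"
  let ?B = "{b\<in>below l a r. \<exists>i. ?bad b i}"
  define first where "first b = (LEAST i. ?bad b i)" for b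
  \<comment> \<open>the sign reversing involution on the vectors that violate interlacing\<close>
  define sw where "sw b = b \<circ> transpose (first b) (Suc (first b))" for b :: "nat \<Rightarrow> int"
  have first: "?bad b (first b)" "\<And>j. j < first b \<Longrightarrow> \<not> ?bad b j" if "b \<in> ?B" for b
  proof -
    have "\<exists>i. ?bad b i" using that by simp
    then show "?bad b (first b)" unfolding first_def by (rule LeastI_ex)
    show "\<not> ?bad b j" if "j < first b" for j
      using that unfolding first_def by (rule not_less_Least)
  qed
  have swap: "sw b \<in> ?B \<and> first (sw b) = first b" if b: "b \<in> ?B" for b
  proof -
    define i where "i = first b"
    have i: "Suc i < l" "b i \<le> a (Suc i)" "\<And>j. j < i \<Longrightarrow> \<not> ?bad b j"
      using first[OF b] unfolding i_def by auto
    have sw: "sw b = b \<circ> transpose i (Suc i)" unfolding sw_def i_def ..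
    have le: "b j \<le> a j" if "j < l" for j using b that by (auto simp: below_def)
    have out: "b j = a j" if "j \<ge> l" for j using b that by (auto simp: below_def)
    have "sw b j \<le> a j" if "j < l" for j
      using le[OF that] le[of "Suc i"] i a[of i] unfolding sw by (auto simp: transpose_def)
    moreover have "sw b j = a j" if "j \<ge> l" for j
      using out that i unfolding sw by (auto simp: transpose_def)
    moreover have "(\<Sum>j<l. a j - sw b j) = r"
      using b sum_transpose[OF i(1), of b] unfolding sw by (simp add: below_def sum_subtractf)
    moreover have bad: "?bad (sw b) i"
      using le[of "Suc i"] i unfolding sw by (simp add: transpose_def)
    moreover have before: "\<not> ?bad (sw b) j" if "j < i" for j
      using i(3)[OF that] that unfolding sw by (simp add: transpose_def)
    ultimately have in_B: "sw b \<in> ?B"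
      unfolding below_def by blast
    have "first (sw b) = i"
      unfolding first_def
    proof (rule Least_equality)
      show "?bad (sw b) i" by (rule bad)
      show "i \<le> j" if "?bad (sw b) j" for j
        using before[of j] that linorder_not_less by blast
    qed
    with in_B show ?thesis unfolding i_def by simp
  qed
  have sw_sw: "sw (sw b) = b" if "b \<in> ?B" for b
  proof -
    have "sw (sw b) = sw b \<circ> transpose (first b) (Suc (first b))"
      using swap[OF that] by (simp add: sw_def[of "sw b"])
    then show ?thesis by (simp only: sw_def comp_transpose_twice)
  qed
  have "(\<Sum>b\<in>?B. f b) = (\<Sum>b\<in>?B. f (sw b))"
    by (rule sum.reindex_bij_witness[of _ sw sw]) (simp_all only: sw_sw swap)
  also have "\<dots> = - (\<Sum>b\<in>?B. f b)"
    unfolding sum_negf[symmetric]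
  proof (intro sum.cong refl)
    fix b assume "b \<in> ?B"
    then show "f (sw b) = - f b"
      unfolding sw_def using first(1)[OF \<open>b \<in> ?B\<close>] by (intro alt) blast
  qed
  finally have "(\<Sum>b\<in>?B. f b) = 0" by simp
  moreover have "below l a r = ?B \<union> {b\<in>below l a r. \<forall>i. Suc i < l \<longrightarrow> a (Suc i) < b i}" by auto
  then have "(\<Sum>b\<in>below l a r. f b)
      = (\<Sum>b\<in>?B \<union> {b\<in>below l a r. \<forall>i. Suc i < l \<longrightarrow> a (Suc i) < b i}. f b)" by simp
  then have "(\<Sum>b\<in>below l a r. f b)
      = (\<Sum>b\<in>?B. f b) + (\<Sum>b\<in>{b\<in>below l a r. \<forall>i. Suc i < l \<longrightarrow> a (Suc i) < b i}. f b)"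
    using finite_below[of l a r]
    by (subst (asm) sum.union_disjoint) auto
  ultimately show ?thesis by simp
qed

definition strictly_decreasing :: "nat \<Rightarrow> (nat \<Rightarrow> int) \<Rightarrow> bool" where
  "strictly_decreasing l a \<longleftrightarrow> (\<forall>i. Suc i < l \<longrightarrow> a (Suc i) < a i)"

text \<open>
  For strictly decreasing \<open>a\<close>, which is a partition plus the staircase, the members are the partitions
  obtained by removing a horizontal strip of \<open>r\<close> boxes.
\<close>

definition interlacing :: "nat \<Rightarrow> (nat \<Rightarrow> int) \<Rightarrow> int \<Rightarrow> (nat \<Rightarrow> int) set" where
  "interlacing l a r = {b\<in>below l a r. \<forall>i. Suc i < l \<longrightarrow> a (Suc i) < b i}"

lemma signed_count_Suc:
  "strictly_decreasing l a \<Longrightarrow>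
    signed_count l \<beta> (Suc n) a = (\<Sum>b\<in>interlacing l a (\<beta> n). signed_count l \<beta> n b)"
  unfolding interlacing_def strictly_decreasing_def
  by (simp add: pieri_cancellation[OF signed_count_swap])

lemma interlacing_strictly_decreasing:
  assumes "b \<in> interlacing l a r"
  shows "strictly_decreasing l b"
  unfolding strictly_decreasing_def
proof (intro allI impI)
  fix i assume i: "Suc i < l"
  then have "b (Suc i) \<le> a (Suc i)" "a (Suc i) < b i"
    using assms by (auto simp: interlacing_def below_def)
  then show "b (Suc i) < b i" by simp
qed

lemma alternant_strictly_decreasing:
  assumes a: "strictly_decreasing l a" and nz: "alternant l a \<noteq> 0"
  shows "\<forall>i<l. a i = staircase l i"
proof -
  from nz obtain \<pi> where "\<pi> \<in> {\<pi>. \<pi> permutes {..<l}}"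
    and "sign \<pi> * (if \<forall>i<l. a i = staircase l (\<pi> i) then 1 else 0) \<noteq> 0"
    unfolding alternant_def by (rule sum.not_neutral_contains_not_neutral)
  then have \<pi>: "\<pi> permutes {..<l}" and eq: "\<forall>i<l. a i = staircase l (\<pi> i)"
    by (auto split: if_splits)
  have step: "\<pi> i < \<pi> (Suc i)" if "Suc i < l" for i
    using a eq that unfolding strictly_decreasing_def staircase_def by force
  have "i < l \<Longrightarrow> i \<le> \<pi> i" for i
  proof (induction i)
    case (Suc i)
    then show ?case using step[of i] by simp
  qed simp
  then have "\<pi> = id"
    by (intro permutes_natset_ge[OF \<pi>]) auto
  then show ?thesis using eq by simp
qed

lemma alternant_staircase:
  assumes "\<forall>i<l. a i = staircase l i"
  shows "alternant l a = 1"
proof -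
  have "(\<forall>i<l. a i = staircase l (\<pi> i)) \<longleftrightarrow> \<pi> = id" if "\<pi> permutes {..<l}" for \<pi>
  proof
    assume "\<forall>i<l. a i = staircase l (\<pi> i)"
    then have "\<pi> i = i" if "i < l" for i using assms that by (auto simp: staircase_def)
    then show "\<pi> = id" using permutes_not_in[OF that] by (intro ext) (metis id_apply lessThan_iff)
  qed (use assms in auto)
  then have "alternant l a = (\<Sum>\<pi> | \<pi> permutes {..<l}. if \<pi> = id then 1 else 0)"
    unfolding alternant_def by (intro sum.cong) auto
  then show ?thesis by (simp add: finite_permutations permutes_id)
qed

text \<open>
  Each column adds at most one row, and a nonvanishing count forces the entries of the first \<open>j\<close>
  columns into the first \<open>j\<close> rows. This is the dominance order.
\<close>

lemma signed_count_nonzero: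
  assumes "strictly_decreasing l a" "n \<le> l" "signed_count l \<beta> n a \<noteq> 0"
  shows "(\<forall>i. n \<le> i \<and> i < l \<longrightarrow> a i = staircase l i) \<and>
    (\<Sum>i<l. a i - staircase l i) = (\<Sum>j<n. \<beta> j) \<and>
    (\<forall>j\<le>n. (\<Sum>i<j. \<beta> i) \<le> (\<Sum>i<j. a i - staircase l i))"
  using assms
proof (induction n arbitrary: a)
  case 0
  then show ?case using alternant_strictly_decreasing[of l a] by auto
next
  case (Suc n)
  from Suc.prems(3) obtain b where b: "b \<in> interlacing l a (\<beta> n)" and nz: "signed_count l \<beta> n b \<noteq> 0"
    unfolding signed_count_Suc[OF Suc.prems(1)] by (meson sum.neutral)
  from Suc.IH[OF interlacing_strictly_decreasing[OF b] _ nz] Suc.prems(2)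
  have tail: "\<And>i. n \<le> i \<Longrightarrow> i < l \<Longrightarrow> b i = staircase l i"
    and total: "(\<Sum>i<l. b i - staircase l i) = (\<Sum>j<n. \<beta> j)"
    and dom: "\<And>j. j \<le> n \<Longrightarrow> (\<Sum>i<j. \<beta> i) \<le> (\<Sum>i<j. b i - staircase l i)" by auto
  have le: "b i \<le> a i" for i
    using b by (cases "i < l") (auto simp: interlacing_def below_def)
  have tail': "a i = staircase l i" if i: "Suc n \<le> i" "i < l" for i
  proof -
    obtain k where k: "i = Suc k" using i by (cases i) auto
    then have "a i < b k" using b i by (auto simp: interlacing_def)
    then show ?thesis
      using tail[of k] tail[of i] le[of i] i k by (simp add: staircase_def)
  qed
  have "(\<Sum>i<l. a i - b i) = \<beta> n" using b by (simp add: interlacing_def below_def)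
  with total have total': "(\<Sum>i<l. a i - staircase l i) = (\<Sum>j<Suc n. \<beta> j)"
    by (simp add: sum_subtractf)
  have "(\<Sum>i<j. \<beta> i) \<le> (\<Sum>i<j. a i - staircase l i)" if j: "j \<le> Suc n" for j
  proof (cases "j = Suc n")
    case True
    have "(\<Sum>i<Suc n. a i - staircase l i) = (\<Sum>i<l. a i - staircase l i)"
      using Suc.prems(2) tail' by (intro sum.mono_neutral_left) auto
    with total' True show ?thesis by simp
  next
    case False
    then have "(\<Sum>i<j. \<beta> i) \<le> (\<Sum>i<j. b i - staircase l i)" using dom j by simp
    also have "\<dots> \<le> (\<Sum>i<j. a i - staircase l i)" using le by (intro sum_mono) simp
    finally show ?thesis .
  qed
  with tail' total' show ?case by auto
qed

definition shifted :: "nat \<Rightarrow> (nat \<Rightarrow> nat) \<Rightarrow> nat \<Rightarrow> nat \<Rightarrow> int" where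
  "shifted l \<nu> n i = (if i < l then (if i < n then int (\<nu> i) else 0) + staircase l i else 0)"

lemma shifted_strictly_decreasing:
  assumes "antimono \<nu>"
  shows "strictly_decreasing l (shifted l \<nu> n)"
proof -
  have "int (\<nu> (Suc i)) < 1 + int (\<nu> i)" for i
    using antimonoD[OF assms, of i "Suc i"] by simp
  then show ?thesis
    unfolding strictly_decreasing_def shifted_def staircase_def by auto
qed

text \<open>
  Equality in the dominance bound leaves only one sequence of horizontal strips: each is the whole
  last row of what is left.
\<close>

lemma signed_count_shifted:
  assumes \<nu>: "antimono \<nu>" and n: "n \<le> l"
  shows "signed_count l (\<lambda>i. int (\<nu> i)) n (shifted l \<nu> n) = 1"
  using n
proof (induction n)
  case 0
  then show ?case by (simp add: alternant_staircase shifted_def)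
next
  case (Suc n)
  let ?a = "shifted l \<nu>"
  have "?a n \<in> interlacing l (?a (Suc n)) (int (\<nu> n))"
  proof -
    have "(\<Sum>i<l. ?a (Suc n) i - ?a n i) = (\<Sum>i<l. if i = n then int (\<nu> n) else 0)"
      by (intro sum.cong) (auto simp: shifted_def)
    moreover have "int (\<nu> (Suc i)) < 1 + int (\<nu> i)" for i
      using antimonoD[OF \<nu>, of i "Suc i"] by simp
    ultimately show ?thesis
      using Suc.prems
      unfolding interlacing_def below_def by (auto simp: shifted_def staircase_def)
  qed
  moreover have "b = ?a n"
    if b: "b \<in> interlacing l (?a (Suc n)) (int (\<nu> n))"
      and nz: "signed_count l (\<lambda>i. int (\<nu> i)) n b \<noteq> 0" for b
  proof
    fix i
    have le: "b i \<le> ?a (Suc n) i" for i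
      using b by (cases "i < l") (auto simp: interlacing_def below_def)
    have tail: "b i = staircase l i" if "n \<le> i" "i < l" for i
      using signed_count_nonzero[OF interlacing_strictly_decreasing[OF b] _ nz] Suc.prems that by auto
    have "(\<Sum>i<l. ?a (Suc n) i - b i) = int (\<nu> n)" using b by (simp add: interlacing_def below_def)
    moreover have "(\<Sum>i<l. ?a (Suc n) i - b i)
        = (?a (Suc n) n - b n) + (\<Sum>i\<in>{..<l} - {n}. ?a (Suc n) i - b i)"
      using Suc.prems by (intro sum.remove) auto
    moreover have "?a (Suc n) n - b n = int (\<nu> n)"
      using tail[of n] Suc.prems by (simp add: shifted_def)
    ultimately have "(\<Sum>i\<in>{..<l} - {n}. ?a (Suc n) i - b i) = 0" by simp
    then have rest: "\<forall>i\<in>{..<l} - {n}. ?a (Suc n) i - b i = 0"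
      using le by (subst (asm) sum_nonneg_eq_0_iff) auto
    show "b i = ?a n i"
    proof (cases "i < l")
      case True
      show ?thesis
      proof (cases "i = n")
        case True
        then show ?thesis using tail[of n] \<open>i < l\<close> by (simp add: shifted_def)
      next
        case False
        then have "?a (Suc n) i - b i = 0" using rest \<open>i < l\<close> by blast
        then show ?thesis using False \<open>i < l\<close> by (auto simp: shifted_def)
      qed
    next
      case False
      then show ?thesis using b by (simp add: interlacing_def below_def shifted_def)
    qed
  qed
  ultimately have "(\<Sum>b\<in>interlacing l (?a (Suc n)) (int (\<nu> n)). signed_count l (\<lambda>i. int (\<nu> i)) n b)
      = (\<Sum>b\<in>{?a n}. signed_count l (\<lambda>i. int (\<nu> i)) n b)"
    using finite_below by (intro sum.mono_neutral_right) (auto simp: interlacing_def)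
  also have "\<dots> = 1" using Suc by simp
  finally show ?case
    by (subst signed_count_Suc[OF shifted_strictly_decreasing[OF \<nu>]])
qed

lemma permutes_eq_id_of_partial_sums:
  assumes \<tau>: "\<tau> permutes {..<l}"
    and le: "\<And>j. j \<le> l \<Longrightarrow> (\<Sum>i<j. int (\<tau> i)) \<le> (\<Sum>i<j. int i)"
  shows "\<tau> = id"
proof -
  have fix_: "i < l \<Longrightarrow> \<tau> i = i" for i
  proof (induction i rule: less_induct)
    case (less j)
    have ge: "j \<le> \<tau> j"
    proof (rule ccontr)
      assume "\<not> j \<le> \<tau> j"
      then have "\<tau> (\<tau> j) = \<tau> j" using less by auto
      then have "\<tau> j = j" using permutes_inj[OF \<tau>] by (auto dest: injD)
      with \<open>\<not> j \<le> \<tau> j\<close> show False by simp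
    qed
    have "(\<Sum>i<j. int (\<tau> i)) = (\<Sum>i<j. int i)"
      using less by (intro sum.cong) auto
    then have "int (\<tau> j) \<le> int j" using le[of "Suc j"] less.prems by simp
    with ge show ?case by simp
  qed
  show ?thesis
  proof
    fix i show "\<tau> i = id i"
      using fix_[of i] permutes_not_in[OF \<tau>, of i] by (cases "i < l") auto
  qed
qed

text \<open>
  The partial sums of \<open>i \<mapsto> \<nu> i + \<tau> i - i\<close> cannot all be dominated by those of \<open>\<nu>\<close> unless \<open>\<tau>\<close>
  is the identity.
\<close>

lemma signed_count_permuted:
  assumes \<nu>: "antimono \<nu>" and \<tau>: "\<tau> permutes {..<l}"
  shows "signed_count l (\<lambda>i. int (\<nu> i) + int (\<tau> i) - int i) l (shifted l \<nu> l) = (if \<tau> = id then 1 else 0)"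
proof (cases "\<tau> = id")
  case True
  then show ?thesis using signed_count_shifted[OF \<nu>, of l] by simp
next
  case False
  have "signed_count l (\<lambda>i. int (\<nu> i) + int (\<tau> i) - int i) l (shifted l \<nu> l) = 0"
  proof (rule ccontr)
    assume "\<not> ?thesis"
    note dom = signed_count_nonzero[OF shifted_strictly_decreasing[OF \<nu>] order_refl this]
    have "(\<Sum>i<j. int (\<tau> i)) \<le> (\<Sum>i<j. int i)" if j: "j \<le> l" for j
    proof -
      have "(\<Sum>i<j. shifted l \<nu> l i - staircase l i) = (\<Sum>i<j. int (\<nu> i))"
        using j by (intro sum.cong) (auto simp: shifted_def)
      then show ?thesis using dom j by (auto simp: sum.distrib sum_subtractf)
    qed
    from permutes_eq_id_of_partial_sums[OF \<tau> this] False show False by simp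
  qed
  with False show ?thesis by simp
qed

section \<open>Colourings fixed by a permutation\<close>

definition colourings :: "'d set \<Rightarrow> 'j set \<Rightarrow> ('j \<Rightarrow> int) \<Rightarrow> ('d \<Rightarrow> 'j) set" where
  "colourings D J \<alpha> = {f \<in> D \<rightarrow>\<^sub>E J. \<forall>j\<in>J. int (card {k\<in>D. f k = j}) = \<alpha> j}"

definition colouring_character :: "nat \<Rightarrow> nat \<Rightarrow> (nat \<Rightarrow> int) \<Rightarrow> (nat \<Rightarrow> nat) \<Rightarrow> rat" where
  "colouring_character m l \<alpha> g = of_nat (card {f \<in> colourings {1..m} {..<l} \<alpha>. \<forall>k\<in>{1..m}. f (g k) = f k})"

lemma finite_colourings: "finite D \<Longrightarrow> finite J \<Longrightarrow> finite (colourings D J \<alpha>)"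
  unfolding colourings_def by (rule rev_finite_subset[OF finite_PiE[of D "\<lambda>_. J"]]) auto

lemma colourings_cong: "(\<And>j. j \<in> J \<Longrightarrow> \<alpha> j = \<beta> j) \<Longrightarrow> colourings D J \<alpha> = colourings D J \<beta>"
  unfolding colourings_def by auto

lemma colouring_character_cong:
  "(\<And>j. j < l \<Longrightarrow> \<alpha> j = \<beta> j) \<Longrightarrow> colouring_character m l \<alpha> g = colouring_character m l \<beta> g"
  unfolding colouring_character_def using colourings_cong[of "{..<l}" \<alpha> \<beta> "{1..m}"] by simp

lemma permutes_in_interval: "g permutes {1..m} \<Longrightarrow> k \<in> {1..m} \<Longrightarrow> g k \<in> {1..m}"
  by (simp only: permutes_in_image)

lemma card_fibre_permutes:
  assumes g: "g permutes {1..m}"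
  shows "card {k\<in>{1..m}. f (g k) = j} = card {k\<in>{1..m}. f k = j}"
proof (rule bij_betw_same_card[of g], rule bij_betw_byWitness[of _ "inv g"])
  show "g ` {k\<in>{1..m}. f (g k) = j} \<subseteq> {k\<in>{1..m}. f k = j}"
    using permutes_in_interval[OF g] by blast
  show "inv g ` {k\<in>{1..m}. f k = j} \<subseteq> {k\<in>{1..m}. f (g k) = j}"
  proof (rule image_subsetI)
    fix k assume "k \<in> {k\<in>{1..m}. f k = j}"
    then show "inv g k \<in> {k\<in>{1..m}. f (g k) = j}"
      using permutes_in_interval[OF permutes_inv[OF g], of k] by (simp only: mem_Collect_eq permutes_inverses[OF g])
  qed
qed (simp_all add: permutes_inverses[OF g])

lemma colourings_transitive:
  fixes f f' :: "nat \<Rightarrow> 'j"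
  assumes f: "f \<in> colourings {1..m} J \<alpha>" and f': "f' \<in> colourings {1..m} J \<alpha>"
  obtains h where "h permutes {1..m}" "\<forall>k\<in>{1..m}. f k = f' (h k)"
proof -
  have fin: "finite {1..m}" by (rule finite_atLeastAtMost)
  have out: "{k\<in>{1..m}. f k = j} = {}" if "f \<in> colourings {1..m} J \<alpha>" "j \<notin> J" for f j
    using that PiE_mem[of f "{1..m}" "\<lambda>_. J"] unfolding colourings_def by auto
  have "card {k\<in>{1..m}. f k = j} = card {k\<in>{1..m}. f' k = j}" for j
  proof (cases "j \<in> J")
    case True
    then have "int (card {k\<in>{1..m}. f k = j}) = int (card {k\<in>{1..m}. f' k = j})"
      using f f' unfolding colourings_def by auto
    then show ?thesis by (simp only: of_nat_eq_iff)
  next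
    case False
    show ?thesis unfolding out[OF f False] out[OF f' False] ..
  qed
  then have "image_mset f (mset_set {1..m}) = image_mset f' (mset_set {1..m})"
    by (intro multiset_eqI) (simp only: count_image_mset_eq_card_vimage[OF fin])
  from image_mset_eq_implies_permutes[OF fin this] show thesis using that by blast
qed

lemma colourings_nonempty:
  assumes J: "finite J" and A: "(\<Sum>j\<in>J. A j) = m"
  shows "colourings {1..m::nat} J (\<lambda>j. int (A j)) \<noteq> {}"
proof -
  define S where "S = (SIGMA j:J. {..<A j})"
  have S: "finite S" "card S = m" unfolding S_def using J A by auto
  then obtain h where h: "bij_betw h {1..m} S"
    using finite_same_card_bij[of "{1..m}" S] by auto
  define f where "f = restrict (fst \<circ> h) {1..m}"
  have "f \<in> {1..m} \<rightarrow>\<^sub>E J"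
    using bij_betwE[OF h] unfolding f_def S_def by force
  moreover have "card {k\<in>{1..m}. f k = j} = A j" if j: "j \<in> J" for j
  proof -
    have "h ` {k\<in>{1..m}. f k = j} = {j} \<times> {..<A j}"
    proof
      show "h ` {k\<in>{1..m}. f k = j} \<subseteq> {j} \<times> {..<A j}"
        using bij_betwE[OF h] unfolding f_def S_def by force
      show "{j} \<times> {..<A j} \<subseteq> h ` {k\<in>{1..m}. f k = j}"
      proof
        fix x assume x: "x \<in> {j} \<times> {..<A j}"
        then have "x \<in> h ` {1..m}" using h j unfolding S_def bij_betw_def by auto
        then obtain k where k: "k \<in> {1..m}" "x = h k" by blast
        then have "f k = j" using x unfolding f_def by auto
        with k show "x \<in> h ` {k\<in>{1..m}. f k = j}" by blast
      qed
    qed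
    moreover have "inj_on h {k\<in>{1..m}. f k = j}"
      by (rule inj_on_subset[OF bij_betw_imp_inj_on[OF h]]) blast
    ultimately show ?thesis using card_image[of h "{k\<in>{1..m}. f k = j}"] by simp
  qed
  ultimately have "f \<in> colourings {1..m} J (\<lambda>j. int (A j))" unfolding colourings_def by simp
  then show ?thesis by blast
qed

text \<open>
  The symmetric group acts transitively on the colourings of a given content, and the average number
  of fixed points of a transitive action is one.
\<close>

lemma sum_fixed_colourings:
  assumes J: "finite J" and A: "(\<Sum>j\<in>J. A j) = m"
  shows "(\<Sum>g | g permutes {1..m}. card {f \<in> colourings {1..m} J (\<lambda>j. int (A j)). \<forall>k\<in>{1..m}. f (g k) = f k}) = fact m"
proof -
  let ?C = "colourings {1..m} J (\<lambda>j. int (A j))" and ?G = "{g. g permutes {1..m}}"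
  have fG: "finite ?G" by (rule finite_permutations) simp
  obtain f0 where f0: "f0 \<in> ?C" using colourings_nonempty[OF assms] by blast
  have "card {g\<in>?G. \<forall>k\<in>{1..m}. f (g k) = f k} = card {g\<in>?G. \<forall>k\<in>{1..m}. f0 (g k) = f k}" if f: "f \<in> ?C" for f
  proof -
    obtain h where h: "h permutes {1..m}" and hf: "\<forall>k\<in>{1..m}. f k = f0 (h k)"
      using colourings_transitive[OF f f0] .
    show ?thesis
    proof (rule bij_betw_same_card[of "\<lambda>g. h \<circ> g"], rule bij_betw_byWitness[of _ "\<lambda>g. inv h \<circ> g"])
      show "\<forall>g\<in>{g\<in>?G. \<forall>k\<in>{1..m}. f (g k) = f k}. inv h \<circ> (h \<circ> g) = g"
        by (simp add: permutes_inv_o[OF h] flip: comp_assoc)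
      show "\<forall>g\<in>{g\<in>?G. \<forall>k\<in>{1..m}. f0 (g k) = f k}. h \<circ> (inv h \<circ> g) = g"
        by (simp add: permutes_inv_o[OF h] flip: comp_assoc)
      show "(\<lambda>g. h \<circ> g) ` {g\<in>?G. \<forall>k\<in>{1..m}. f (g k) = f k} \<subseteq> {g\<in>?G. \<forall>k\<in>{1..m}. f0 (g k) = f k}"
      proof safe
        fix g k assume g: "g permutes {1..m}" "\<forall>k\<in>{1..m}. f (g k) = f k" and k: "k \<in> {1..m}"
        show "f0 ((h \<circ> g) k) = f k"
          using bspec[OF hf permutes_in_interval[OF g(1) k]] bspec[OF g(2) k] by simp
      qed (intro permutes_compose h)
      show "(\<lambda>g. inv h \<circ> g) ` {g\<in>?G. \<forall>k\<in>{1..m}. f0 (g k) = f k} \<subseteq> {g\<in>?G. \<forall>k\<in>{1..m}. f (g k) = f k}"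
      proof safe
        fix g k assume g: "g permutes {1..m}" "\<forall>k\<in>{1..m}. f0 (g k) = f k" and k: "k \<in> {1..m}"
        have "(inv h \<circ> g) k \<in> {1..m}"
          using permutes_in_interval[OF permutes_compose[OF g(1) permutes_inv[OF h]] k] .
        then show "f ((inv h \<circ> g) k) = f k"
          using bspec[OF hf, of "(inv h \<circ> g) k"] bspec[OF g(2) k] by (simp add: permutes_inverses[OF h])
      qed (intro permutes_compose permutes_inv h)
    qed
  qed
  then have "(\<Sum>g\<in>?G. card {f\<in>?C. \<forall>k\<in>{1..m}. f (g k) = f k}) = (\<Sum>f\<in>?C. card {g\<in>?G. \<forall>k\<in>{1..m}. f0 (g k) = f k})"
    by (intro sum_multicount_gen fG finite_colourings finite_atLeastAtMost J ballI)
  also have "\<dots> = (\<Sum>g\<in>?G. card {f\<in>?C. \<forall>k\<in>{1..m}. f0 (g k) = f k})"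
    by (rule sum_multicount_gen[symmetric]) (auto intro: fG finite_colourings finite_atLeastAtMost J)
  also have "\<dots> = (\<Sum>g\<in>?G. 1)"
  proof (rule sum.cong[OF refl])
    fix g assume "g \<in> ?G"
    then have g: "g permutes {1..m}" by simp
    let ?f = "restrict (f0 \<circ> g) {1..m}"
    have "{k\<in>{1..m}. ?f k = j} = {k\<in>{1..m}. f0 (g k) = j}" for j by auto
    then have f_in: "?f \<in> ?C"
      using f0 permutes_in_interval[OF g] card_fibre_permutes[OF g, of f0]
      unfolding colourings_def by auto
    have f_unique: "f = ?f" if "f \<in> ?C" "\<forall>k\<in>{1..m}. f0 (g k) = f k" for f
      using that unfolding colourings_def by (intro extensionalityI[of _ "{1..m}"]) (auto simp: PiE_def)
    have "{f\<in>?C. \<forall>k\<in>{1..m}. f0 (g k) = f k} = {?f}"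
    proof (intro equalityI subsetI)
      fix f assume "f \<in> {f\<in>?C. \<forall>k\<in>{1..m}. f0 (g k) = f k}"
      then show "f \<in> {?f}" using f_unique[of f] by blast
    next
      fix f assume "f \<in> {?f}"
      then show "f \<in> {f\<in>?C. \<forall>k\<in>{1..m}. f0 (g k) = f k}" using f_in by simp
    qed
    then show "card {f\<in>?C. \<forall>k\<in>{1..m}. f0 (g k) = f k} = 1" by simp
  qed
  also have "\<dots> = fact m" by (simp add: card_permutations)
  finally show ?thesis .
qed

section \<open>Inner products of colouring characters\<close>

text \<open>
  The column \<open>j\<close> of such a matrix is \<open>A j\<close>, its row sums are \<open>\<alpha>\<close>, its column sums \<open>\<beta>\<close>. Matrices are
  extended by zero to make the set finite.
\<close>

definition matrices :: "nat \<Rightarrow> (nat \<Rightarrow> int) \<Rightarrow> nat \<Rightarrow> (nat \<Rightarrow> int) \<Rightarrow> (nat \<Rightarrow> nat \<Rightarrow> nat) set" where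
  "matrices l \<beta> n \<alpha> = {A. (\<forall>j<n. (\<forall>i\<ge>l. A j i = 0) \<and> int (\<Sum>i<l. A j i) = \<beta> j) \<and>
     (\<forall>j\<ge>n. A j = (\<lambda>_. 0)) \<and> (\<forall>i<l. int (\<Sum>j<n. A j i) = \<alpha> i)}"

primrec matrix_count :: "nat \<Rightarrow> (nat \<Rightarrow> int) \<Rightarrow> nat \<Rightarrow> (nat \<Rightarrow> int) \<Rightarrow> int" where
  "matrix_count l \<beta> 0 \<alpha> = (if \<forall>i<l. \<alpha> i = 0 then 1 else 0)"
| "matrix_count l \<beta> (Suc n) \<alpha> = (\<Sum>b\<in>below l \<alpha> (\<beta> n). matrix_count l \<beta> n b)"

lemma card_matrices: "finite (matrices l \<beta> n \<alpha>) \<and> int (card (matrices l \<beta> n \<alpha>)) = matrix_count l \<beta> n \<alpha>"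
proof (induction n arbitrary: \<alpha>)
  case 0
  have "matrices l \<beta> 0 \<alpha> = (if \<forall>i<l. \<alpha> i = 0 then {\<lambda>_ _. 0} else {})"
    unfolding matrices_def by auto
  then show ?case by simp
next
  case (Suc n)
  define pack where "pack A = ((\<lambda>i. \<alpha> i - int (A n i)), A(n := \<lambda>_. 0))" for A :: "nat \<Rightarrow> nat \<Rightarrow> nat"
  define unpack where "unpack = (\<lambda>(b, A). A(n := \<lambda>i. nat (\<alpha> i - b i)))"
    for b :: "nat \<Rightarrow> int" and A :: "nat \<Rightarrow> nat \<Rightarrow> nat"
  have upd: "(\<Sum>j<n. (A(n := c)) j i) = (\<Sum>j<n. A j i)" for A :: "nat \<Rightarrow> nat \<Rightarrow> nat" and c i
    by (intro sum.cong) auto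
  have "bij_betw pack (matrices l \<beta> (Suc n) \<alpha>) (SIGMA b:below l \<alpha> (\<beta> n). matrices l \<beta> n b)"
  proof (rule bij_betw_byWitness[of _ unpack])
    show "\<forall>A\<in>matrices l \<beta> (Suc n) \<alpha>. unpack (pack A) = A"
      unfolding unpack_def pack_def by simp
    show "\<forall>x\<in>(SIGMA b:below l \<alpha> (\<beta> n). matrices l \<beta> n b). pack (unpack x) = x"
    proof safe
      fix b A assume b: "b \<in> below l \<alpha> (\<beta> n)" and A: "A \<in> matrices l \<beta> n b"
      have "b i \<le> \<alpha> i" for i using b by (cases "i < l") (auto simp: below_def)
      moreover have "A(n := \<lambda>_. 0) = A" using A by (auto simp: matrices_def)
      ultimately show "pack (unpack (b, A)) = (b, A)"
        by (simp add: unpack_def pack_def)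
    qed
    show "pack ` matrices l \<beta> (Suc n) \<alpha> \<subseteq> (SIGMA b:below l \<alpha> (\<beta> n). matrices l \<beta> n b)"
    proof (rule image_subsetI)
      fix A assume A: "A \<in> matrices l \<beta> (Suc n) \<alpha>"
      have "(\<lambda>i. \<alpha> i - int (A n i)) \<in> below l \<alpha> (\<beta> n)"
        using A by (simp add: below_def matrices_def)
      moreover have "A(n := \<lambda>_. 0) \<in> matrices l \<beta> n (\<lambda>i. \<alpha> i - int (A n i))"
        unfolding matrices_def mem_Collect_eq upd
      proof (intro conjI allI impI)
        show "(A(n := \<lambda>_. 0)) j = (\<lambda>_. 0)" if "j \<ge> n" for j
          using A that by (cases "j = n") (auto simp: matrices_def)
        show "int (\<Sum>j<n. A j i) = \<alpha> i - int (A n i)" if "i < l" for i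
          using A that by (auto simp: matrices_def)
      qed (use A in \<open>auto simp: matrices_def\<close>)
      ultimately show "pack A \<in> (SIGMA b:below l \<alpha> (\<beta> n). matrices l \<beta> n b)"
        unfolding pack_def by simp
    qed
    show "unpack ` (SIGMA b:below l \<alpha> (\<beta> n). matrices l \<beta> n b) \<subseteq> matrices l \<beta> (Suc n) \<alpha>"
    proof safe
      fix b A assume b: "b \<in> below l \<alpha> (\<beta> n)" and A: "A \<in> matrices l \<beta> n b"
      have le: "b i \<le> \<alpha> i" for i using b by (cases "i < l") (auto simp: below_def)
      have "A(n := \<lambda>i. nat (\<alpha> i - b i)) \<in> matrices l \<beta> (Suc n) \<alpha>"
        unfolding matrices_def mem_Collect_eq sum.lessThan_Suc upd
      proof (intro conjI allI impI)
        show "int (\<Sum>i<l. (A(n := \<lambda>i. nat (\<alpha> i - b i))) j i) = \<beta> j" if "j < Suc n" for j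
          using A b le that by (cases "j = n") (auto simp: matrices_def below_def)
        show "(A(n := \<lambda>i. nat (\<alpha> i - b i))) j i = 0" if "j < Suc n" "i \<ge> l" for j i
          using A b that by (cases "j = n") (auto simp: matrices_def below_def)
        show "int ((\<Sum>j<n. A j i) + (A(n := \<lambda>i. nat (\<alpha> i - b i))) n i) = \<alpha> i" if "i < l" for i
          using A le[of i] that by (auto simp: matrices_def)
      qed (use A in \<open>auto simp: matrices_def\<close>)
      then show "unpack (b, A) \<in> matrices l \<beta> (Suc n) \<alpha>"
        by (simp add: unpack_def)
    qed
  qed
  then have "finite (matrices l \<beta> (Suc n) \<alpha>) \<longleftrightarrow> finite (SIGMA b:below l \<alpha> (\<beta> n). matrices l \<beta> n b)"
    and "card (matrices l \<beta> (Suc n) \<alpha>) = card (SIGMA b:below l \<alpha> (\<beta> n). matrices l \<beta> n b)"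
    by (rule bij_betw_finite, rule bij_betw_same_card)
  then show ?case using Suc finite_below by simp
qed

lemma signed_count_eq_matrix_count:
  "signed_count l \<beta> n a = (\<Sum>\<pi> | \<pi> permutes {..<l}.
     sign \<pi> * matrix_count l \<beta> n (\<lambda>i. a i - (if i < l then staircase l (\<pi> i) else 0)))"
proof (induction n arbitrary: a)
  case 0
  show ?case
    unfolding signed_count.simps alternant_def by (intro sum.cong) auto
next
  case (Suc n)
  let ?s = "\<lambda>\<pi> i. if i < l then staircase l (\<pi> i) else 0"
  have shift: "(\<Sum>b\<in>below l a r. matrix_count l \<beta> n (\<lambda>i. b i - ?s \<pi> i))
      = (\<Sum>b\<in>below l (\<lambda>i. a i - ?s \<pi> i) r. matrix_count l \<beta> n b)" for \<pi> r
    by (rule sum.reindex_bij_witness[of _ "\<lambda>b i. b i + ?s \<pi> i" "\<lambda>b i. b i - ?s \<pi> i"])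
       (auto simp: below_def fun_eq_iff sum_subtractf sum.distrib)
  show ?case
    unfolding signed_count.simps matrix_count.simps Suc shift[symmetric] sum_distrib_left
    by (rule sum.swap)
qed

text \<open>
  A pair of colourings is a colouring by pairs, and the number of points with each pair of colours is
  a matrix whose row and column sums are the two contents.
\<close>

lemma card_fixed_colourings_product:
  fixes D :: "'d set"
  assumes D: "finite D" and gk: "\<And>k. k \<in> D \<Longrightarrow> g k \<in> D"
  shows "card {f \<in> colourings D {..<l} \<alpha>. \<forall>k\<in>D. f (g k) = f k} *
      card {f \<in> colourings D {..<l} \<beta>. \<forall>k\<in>D. f (g k) = f k} =
    (\<Sum>A\<in>matrices l \<beta> l \<alpha>.
      card {f \<in> colourings D ({..<l} \<times> {..<l}) (\<lambda>x. int (A (snd x) (fst x))). \<forall>k\<in>D. f (g k) = f k})"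
proof -
  let ?J = "{..<l} \<times> {..<l}"
  let ?fixed = "\<lambda>f. \<forall>k\<in>D. f (g k) = f k"
  define content where "content f j i = (if i < l \<and> j < l then card {k\<in>D. f k = (i, j)} else 0)"
    for f :: "'d \<Rightarrow> nat \<times> nat" and i j
  define P where "P = {f \<in> D \<rightarrow>\<^sub>E ?J. ?fixed f \<and> content f \<in> matrices l \<beta> l \<alpha>}"
  have fib1: "(\<Sum>j<l. content f j i) = card {k\<in>D. fst (f k) = i}"
    and fib2: "(\<Sum>j<l. content f i j) = card {k\<in>D. snd (f k) = i}"
    if f: "f \<in> D \<rightarrow>\<^sub>E ?J" and i: "i < l" for f i
  proof -
    have fk: "fst (f k) < l" "snd (f k) < l" if "k \<in> D" for k
      using PiE_mem[OF f that] by auto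
    have "{k\<in>D. fst (f k) = i} = (\<Union>j<l. {k\<in>D. f k = (i, j)})"
      using fk by (auto simp: prod_eq_iff)
    then have "card {k\<in>D. fst (f k) = i} = (\<Sum>j<l. card {k\<in>D. f k = (i, j)})"
      using D by (subst card_UN_disjoint[symmetric]) auto
    then show "(\<Sum>j<l. content f j i) = card {k\<in>D. fst (f k) = i}"
      using i by (simp add: content_def)
    have "{k\<in>D. snd (f k) = i} = (\<Union>j<l. {k\<in>D. f k = (j, i)})"
      using fk by (auto simp: prod_eq_iff)
    then have "card {k\<in>D. snd (f k) = i} = (\<Sum>j<l. card {k\<in>D. f k = (j, i)})"
      using D by (subst card_UN_disjoint[symmetric]) auto
    then show "(\<Sum>j<l. content f i j) = card {k\<in>D. snd (f k) = i}"
      using i by (simp add: content_def)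
  qed
  have P_iff: "f \<in> P \<longleftrightarrow> f \<in> D \<rightarrow>\<^sub>E ?J \<and> ?fixed f \<and>
      (\<forall>i<l. int (card {k\<in>D. fst (f k) = i}) = \<alpha> i) \<and>
      (\<forall>i<l. int (card {k\<in>D. snd (f k) = i}) = \<beta> i)" for f
  proof (cases "f \<in> D \<rightarrow>\<^sub>E ?J")
    case True
    have "\<forall>j\<ge>l. content f j = (\<lambda>_. 0)" "\<forall>j i. l \<le> i \<longrightarrow> content f j i = 0"
      unfolding content_def by auto
    then show ?thesis
      unfolding P_def matrices_def using fib1[OF True] fib2[OF True] True
      by (simp flip: of_nat_sum) blast
  qed (auto simp: P_def)
  let ?C = "\<lambda>\<alpha>. {f \<in> colourings D {..<l} \<alpha>. ?fixed f}"
  have "bij_betw (\<lambda>(f1, f2). restrict (\<lambda>k. (f1 k, f2 k)) D) (?C \<alpha> \<times> ?C \<beta>) P"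
  proof (rule bij_betw_byWitness[of _ "\<lambda>f. (restrict (\<lambda>k. fst (f k)) D, restrict (\<lambda>k. snd (f k)) D)"])
    have fst_eq: "{k\<in>D. restrict h D k = i} = {k\<in>D. h k = i}" for h :: "'d \<Rightarrow> nat" and i
      by auto
    have pair_eq: "{k\<in>D. fst (restrict (\<lambda>k. (f1 k, f2 k)) D k) = i} = {k\<in>D. f1 k = i}"
      "{k\<in>D. snd (restrict (\<lambda>k. (f1 k, f2 k)) D k) = i} = {k\<in>D. f2 k = i}"
      for f1 f2 :: "'d \<Rightarrow> nat" and i by auto
    show "\<forall>x\<in>?C \<alpha> \<times> ?C \<beta>. (\<lambda>f. (restrict (\<lambda>k. fst (f k)) D, restrict (\<lambda>k. snd (f k)) D))
        ((\<lambda>(f1, f2). restrict (\<lambda>k. (f1 k, f2 k)) D) x) = x"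
      unfolding colourings_def by (auto simp: fun_eq_iff PiE_def extensional_def)
    show "\<forall>f\<in>P. (\<lambda>(f1, f2). restrict (\<lambda>k. (f1 k, f2 k)) D)
        (restrict (\<lambda>k. fst (f k)) D, restrict (\<lambda>k. snd (f k)) D) = f"
      unfolding P_def by (auto simp: fun_eq_iff PiE_def extensional_def)
    show "(\<lambda>(f1, f2). restrict (\<lambda>k. (f1 k, f2 k)) D) ` (?C \<alpha> \<times> ?C \<beta>) \<subseteq> P"
    proof safe
      fix f1 f2 assume f: "f1 \<in> colourings D {..<l} \<alpha>" "f2 \<in> colourings D {..<l} \<beta>" "?fixed f1" "?fixed f2"
      then show "restrict (\<lambda>k. (f1 k, f2 k)) D \<in> P"
        unfolding P_iff pair_eq using gk by (auto simp: colourings_def)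
    qed
    show "(\<lambda>f. (restrict (\<lambda>k. fst (f k)) D, restrict (\<lambda>k. snd (f k)) D)) ` P \<subseteq> ?C \<alpha> \<times> ?C \<beta>"
    proof (rule image_subsetI)
      fix f assume f: "f \<in> P"
      then have "f k \<in> ?J" if "k \<in> D" for k
        using that PiE_mem[of f "D" "\<lambda>_. ?J" k] unfolding P_iff by blast
      then have "fst (f k) < l" "snd (f k) < l" if "k \<in> D" for k
        using that by (simp_all only: mem_Times_iff lessThan_iff)
      then have "restrict (\<lambda>k. fst (f k)) D \<in> colourings D {..<l} \<alpha>"
        "restrict (\<lambda>k. snd (f k)) D \<in> colourings D {..<l} \<beta>"
        using f unfolding P_iff colourings_def mem_Collect_eq fst_eq by auto
      moreover have "?fixed (restrict (\<lambda>k. fst (f k)) D)" "?fixed (restrict (\<lambda>k. snd (f k)) D)"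
        using f gk unfolding P_iff by auto
      ultimately show "(restrict (\<lambda>k. fst (f k)) D, restrict (\<lambda>k. snd (f k)) D) \<in> ?C \<alpha> \<times> ?C \<beta>"
        by simp
    qed
  qed
  from bij_betw_same_card[OF this]
  have product: "card (?C \<alpha>) * card (?C \<beta>) = card P" by (simp add: card_cartesian_product)
  have finP: "finite P"
    unfolding P_def by (rule finite_subset[of _ "D \<rightarrow>\<^sub>E ?J"]) (auto intro: finite_PiE D)
  have "card P = (\<Sum>A\<in>matrices l \<beta> l \<alpha>. card {f \<in> P. content f = A})"
  proof -
    have "content ` P \<subseteq> matrices l \<beta> l \<alpha>" unfolding P_def by blast
    from sum.group[OF finP conjunct1[OF card_matrices] this, of "\<lambda>_. 1::nat"]
    show ?thesis by simp
  qed
  also have "\<dots> = (\<Sum>A\<in>matrices l \<beta> l \<alpha>.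
      card {f \<in> colourings D ?J (\<lambda>x. int (A (snd x) (fst x))). ?fixed f})"
  proof (intro sum.cong refl arg_cong[where f = card] Collect_cong)
    fix A f assume A: "A \<in> matrices l \<beta> l \<alpha>"
    have A0: "A j i = 0" if "\<not> (i < l \<and> j < l)" for i j
      using A that unfolding matrices_def by (cases "j < l") auto
    have "content f = A \<longleftrightarrow> (\<forall>x\<in>?J. card {k\<in>D. f k = x} = A (snd x) (fst x))"
      unfolding fun_eq_iff content_def using A0 by auto
    then show "f \<in> P \<and> content f = A \<longleftrightarrow>
        f \<in> colourings D ?J (\<lambda>x. int (A (snd x) (fst x))) \<and> ?fixed f"
      using A unfolding P_def colourings_def by auto
  qed
  finally show ?thesis unfolding product .
qed

lemma colouring_character_product:
  assumes g: "g permutes {1..m}"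
  shows "colouring_character m l \<alpha> g * colouring_character m l \<beta> g =
    of_nat (\<Sum>A\<in>matrices l \<beta> l \<alpha>.
      card {f \<in> colourings {1..m} ({..<l} \<times> {..<l}) (\<lambda>x. int (A (snd x) (fst x))). \<forall>k\<in>{1..m}. f (g k) = f k})"
  using card_fixed_colourings_product[of "{1..m}" g l \<alpha> \<beta>] permutes_in_interval[OF g]
  unfolding colouring_character_def of_nat_mult[symmetric] by (simp only: finite_atLeastAtMost)

text \<open>
  Each matrix contributes the average number of fixed points of a transitive action, which is one.
\<close>

theorem char_inner_colouring_character:
  assumes \<beta>: "(\<Sum>j<l. \<beta> j) = int m"
  shows "char_inner m (colouring_character m l \<alpha>) (colouring_character m l \<beta>) = of_int (matrix_count l \<beta> l \<alpha>)"
proof -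
  let ?J = "{..<l} \<times> {..<l}"
  let ?N = "\<lambda>A g. card {f \<in> colourings {1..m} ?J (\<lambda>x. int (A (snd x) (fst x))). \<forall>k\<in>{1..m}. f (g k) = f k}"
  have "(\<Sum>g | g permutes {1..m}. \<Sum>A\<in>matrices l \<beta> l \<alpha>. ?N A g) = (\<Sum>A\<in>matrices l \<beta> l \<alpha>. fact m)"
    unfolding sum.swap[of _ "matrices l \<beta> l \<alpha>"]
  proof (rule sum.cong[OF refl])
    fix A assume A: "A \<in> matrices l \<beta> l \<alpha>"
    have "(\<Sum>x\<in>?J. A (snd x) (fst x)) = (\<Sum>i<l. \<Sum>j<l. A j i)"
      by (simp add: sum.cartesian_product case_prod_unfold)
    also have "\<dots> = (\<Sum>j<l. \<Sum>i<l. A j i)" by (rule sum.swap)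
    finally have "int (\<Sum>x\<in>?J. A (snd x) (fst x)) = (\<Sum>j<l. int (\<Sum>i<l. A j i))" by simp
    also have "\<dots> = (\<Sum>j<l. \<beta> j)" using A by (intro sum.cong) (auto simp: matrices_def)
    finally have "(\<Sum>x\<in>?J. A (snd x) (fst x)) = m" using \<beta> by (simp only: of_nat_eq_iff)
    from sum_fixed_colourings[OF _ this]
    show "(\<Sum>g | g permutes {1..m}. ?N A g) = fact m" by simp
  qed
  then have "(\<Sum>g | g permutes {1..m}. rat_of_nat (\<Sum>A\<in>matrices l \<beta> l \<alpha>. ?N A g))
      = of_nat (card (matrices l \<beta> l \<alpha>) * fact m)"
    unfolding of_nat_sum[symmetric] by (simp only: sum_constant of_nat_id)
  moreover have "(\<Sum>g | g permutes {1..m}. colouring_character m l \<alpha> g * colouring_character m l \<beta> g)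
      = (\<Sum>g | g permutes {1..m}. rat_of_nat (\<Sum>A\<in>matrices l \<beta> l \<alpha>. ?N A g))"
    by (intro sum.cong refl colouring_character_product) simp
  moreover have "(of_int (matrix_count l \<beta> l \<alpha>) :: rat) = of_nat (card (matrices l \<beta> l \<alpha>))"
    using conjunct2[OF card_matrices[of l \<beta> l \<alpha>]] by (metis of_int_of_nat_eq)
  ultimately show ?thesis
    unfolding char_inner_def by simp
qed

section \<open>The determinantal class function\<close>

text \<open>
  The determinant of the matrix with the entry \<open>h\<close> of index \<open>\<nu> i + j - i\<close> in row \<open>i\<close> and column \<open>j\<close>,
  expanded. A negative multiplicity has no colourings and contributes zero, as it should.
\<close>

definition jacobi_trudi :: "nat \<Rightarrow> nat \<Rightarrow> (nat \<Rightarrow> nat) \<Rightarrow> (nat \<Rightarrow> nat) \<Rightarrow> rat" where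
  "jacobi_trudi m l \<nu> g = (\<Sum>\<pi> | \<pi> permutes {..<l}.
     of_int (sign \<pi>) * colouring_character m l (\<lambda>i. int (\<nu> i) + int (\<pi> i) - int i) g)"

lemma char_inner_jacobi_trudi:
  "char_inner m \<chi> (jacobi_trudi m l \<nu>) = (\<Sum>\<pi> | \<pi> permutes {..<l}.
     of_int (sign \<pi>) * char_inner m \<chi> (colouring_character m l (\<lambda>i. int (\<nu> i) + int (\<pi> i) - int i)))"
  unfolding jacobi_trudi_def by (rule char_inner_lincomb)

lemma sum_permuted_shape:
  assumes "\<pi> permutes {..<l}"
  shows "(\<Sum>i<l. int (\<nu> i) + int (\<pi> i) - int i) = int (\<Sum>i<l. \<nu> i)"
  using sum.permute[OF assms, of int] by (simp add: sum.distrib sum_subtractf comp_def)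

text \<open>
  Expanding one factor gives alternating sums of matrix counts, and these are signed counts. Only the
  term of the identity survives in the other factor.
\<close>

theorem jacobi_trudi_norm:
  assumes \<nu>: "antimono \<nu>" and m: "(\<Sum>i<l. \<nu> i) = m"
  shows "char_inner m (jacobi_trudi m l \<nu>) (jacobi_trudi m l \<nu>) = 1"
proof -
  let ?\<alpha> = "\<lambda>\<pi> i. int (\<nu> i) + int (\<pi> i) - int i"
  have "char_inner m (jacobi_trudi m l \<nu>) (colouring_character m l (?\<alpha> \<tau>)) = (if \<tau> = id then 1 else 0)"
    if \<tau>: "\<tau> permutes {..<l}" for \<tau>
  proof -
    have "char_inner m (jacobi_trudi m l \<nu>) (colouring_character m l (?\<alpha> \<tau>))
        = (\<Sum>\<pi> | \<pi> permutes {..<l}. of_int (sign \<pi>) *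
            char_inner m (colouring_character m l (?\<alpha> \<pi>)) (colouring_character m l (?\<alpha> \<tau>)))"
      unfolding char_inner_commute[of m "jacobi_trudi m l \<nu>"] char_inner_jacobi_trudi
      by (intro sum.cong refl arg_cong2[where f = "(*)"] char_inner_commute)
    also have "\<dots> = (\<Sum>\<pi> | \<pi> permutes {..<l}. of_int (sign \<pi> * matrix_count l (?\<alpha> \<tau>) l
        (\<lambda>i. shifted l \<nu> l i - (if i < l then staircase l (\<pi> i) else 0))))"
    proof (rule sum.cong[OF refl])
      fix \<pi>
      let ?\<beta> = "\<lambda>i. shifted l \<nu> l i - (if i < l then staircase l (\<pi> i) else 0)"
      have "char_inner m (colouring_character m l (?\<alpha> \<pi>)) (colouring_character m l (?\<alpha> \<tau>))
          = char_inner m (colouring_character m l ?\<beta>) (colouring_character m l (?\<alpha> \<tau>))"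
        by (intro char_inner_cong colouring_character_cong refl) (simp add: shifted_def staircase_def)
      also have "\<dots> = of_int (matrix_count l (?\<alpha> \<tau>) l ?\<beta>)"
        using sum_permuted_shape[OF \<tau>, of \<nu>] m by (intro char_inner_colouring_character) simp
      finally show "of_int (sign \<pi>) *
            char_inner m (colouring_character m l (?\<alpha> \<pi>)) (colouring_character m l (?\<alpha> \<tau>))
          = of_int (sign \<pi> * matrix_count l (?\<alpha> \<tau>) l ?\<beta>)" by simp
    qed
    also have "\<dots> = of_int (signed_count l (?\<alpha> \<tau>) l (shifted l \<nu> l))"
      unfolding signed_count_eq_matrix_count[of l _ l] of_int_sum ..
    finally show ?thesis by (simp add: signed_count_permuted[OF \<nu> \<tau>])
  qed
  then have "char_inner m (jacobi_trudi m l \<nu>) (jacobi_trudi m l \<nu>)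
      = (\<Sum>\<tau> | \<tau> permutes {..<l}. if \<tau> = id then 1 else 0)"
    unfolding char_inner_jacobi_trudi[of m "jacobi_trudi m l \<nu>"] by (intro sum.cong) auto
  then show ?thesis by (simp add: finite_permutations permutes_id)
qed

section \<open>Tableaux and column antisymmetric vectors\<close>

(* Keeps membership in {1..m} folded, so that quantifiers bounded by this interval apply. *)
declare atLeastAtMost_iff [simp del]

definition part :: "nat list \<Rightarrow> nat \<Rightarrow> nat" where
  "part \<nu> i = (if i < length \<nu> then \<nu> ! i else 0)"

lemma antimono_part:
  assumes "is_partition \<nu>"
  shows "antimono (part \<nu>)"
proof (rule antimonoI)
  fix i j :: nat assume "i \<le> j"
  then show "part \<nu> j \<le> part \<nu> i"
    using assms sorted_wrt_nth_less[of "(\<ge>)" \<nu> i j] unfolding is_partition_def part_def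
    by (cases "i = j") auto
qed

lemma sum_part: "length \<nu> \<le> l \<Longrightarrow> (\<Sum>i<l. part \<nu> i) = sum_list \<nu>"
proof -
  assume "length \<nu> \<le> l"
  then have "(\<Sum>i<l. part \<nu> i) = (\<Sum>i<length \<nu>. part \<nu> i)"
    by (intro sum.mono_neutral_right) (auto simp: part_def)
  also have "\<dots> = (\<Sum>i<length \<nu>. \<nu> ! i)" by (simp add: part_def)
  finally show ?thesis by (simp add: sum_list_sum_nth atLeast0LessThan)
qed

lemma mem_cells: "(i, j) \<in> cells \<nu> \<longleftrightarrow> j < part \<nu> i"
  by (auto simp: cells_def part_def)

lemma cells_row: "{c \<in> cells \<nu>. fst c = i} = {i} \<times> {..<part \<nu> i}"
  by (auto simp: mem_cells)

lemma cells_Sigma: "cells \<nu> = (SIGMA i:{..<length \<nu>}. {..<\<nu> ! i})"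
  by (auto simp: cells_def)

lemma finite_cells: "finite (cells \<nu>)"
  by (simp add: cells_Sigma)

lemma card_cells: "card (cells \<nu>) = sum_list \<nu>"
  by (simp add: cells_Sigma sum_list_sum_nth atLeast0LessThan)

lemma card_eq_sum_fibres:
  assumes "finite S" "finite C" "h ` S \<subseteq> C"
  shows "card S = (\<Sum>c\<in>C. card {k\<in>S. h k = c})"
  using sum.group[OF assms, of "\<lambda>_. 1::nat"] by simp

locale tableau_shape =
  fixes \<nu> :: "nat list"
  assumes partition: "is_partition \<nu>"
begin

abbreviation D :: "nat set" where "D \<equiv> {1..sum_list \<nu>}"
abbreviation C :: "(nat \<Rightarrow> nat \<times> nat) \<Rightarrow> (nat \<Rightarrow> nat) set" where "C t \<equiv> column_stabilizer \<nu> t"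
abbreviation T :: "(nat \<Rightarrow> nat \<times> nat) \<Rightarrow> nat \<Rightarrow> nat" where "T t \<equiv> tabloid \<nu> t"
abbreviation e :: "(nat \<Rightarrow> nat \<times> nat) \<Rightarrow> (nat \<Rightarrow> nat) \<Rightarrow> rat" where "e t \<equiv> polytabloid \<nu> t"

lemma finD: "finite D" by simp

lemma in_D: "g permutes D \<Longrightarrow> k \<in> D \<Longrightarrow> g k \<in> D"
  by (rule permutes_in_interval)

lemma ex_tableau: "\<exists>t. is_tableau \<nu> t"
  unfolding is_tableau_def using finite_same_card_bij[OF finD finite_cells] by (simp add: card_cells)

lemma tableau_inj: "is_tableau \<nu> t \<Longrightarrow> a \<in> D \<Longrightarrow> b \<in> D \<Longrightarrow> t a = t b \<Longrightarrow> a = b"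
  unfolding is_tableau_def bij_betw_def inj_on_def by blast

lemma tableau_cell: "is_tableau \<nu> t \<Longrightarrow> k \<in> D \<Longrightarrow> t k \<in> cells \<nu>"
  unfolding is_tableau_def bij_betw_def by blast

lemma tableau_surj: "is_tableau \<nu> t \<Longrightarrow> c \<in> cells \<nu> \<Longrightarrow> \<exists>k\<in>D. t k = c"
  unfolding is_tableau_def bij_betw_def by (metis imageE)

lemma tableau_comp: "is_tableau \<nu> t \<Longrightarrow> g permutes D \<Longrightarrow> is_tableau \<nu> (t \<circ> g)"
  unfolding is_tableau_def by (rule bij_betw_trans[OF permutes_imp_bij])

lemma tabloid_comp:
  assumes "g permutes D"
  shows "T (t \<circ> g) = T t \<circ> g"
proof
  fix k show "T (t \<circ> g) k = (T t \<circ> g) k"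
    using in_D[OF assms, of k] permutes_not_in[OF assms, of k] by (cases "k \<in> D") (auto simp: tabloid_def)
qed

lemma card_tableau_row: "is_tableau \<nu> t \<Longrightarrow> card {k\<in>D. fst (t k) = i} = part \<nu> i"
proof -
  assume t: "is_tableau \<nu> t"
  have "bij_betw t {k\<in>D. fst (t k) = i} {c \<in> cells \<nu>. fst c = i}"
  proof (rule bij_betw_subset[OF t[unfolded is_tableau_def]])
    show "t ` {k\<in>D. fst (t k) = i} = {c \<in> cells \<nu>. fst c = i}"
    proof (intro equalityI subsetI)
      fix c assume c: "c \<in> {c \<in> cells \<nu>. fst c = i}"
      then obtain k where "k \<in> D" "t k = c" using tableau_surj[OF t, of c] by blast
      with c show "c \<in> t ` {k\<in>D. fst (t k) = i}" by blast
    qed (use tableau_cell[OF t] in blast)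
  qed blast
  then show ?thesis by (simp add: bij_betw_same_card cells_row)
qed

lemma tabloid_row: "{k\<in>D. T t k = i} = {k\<in>D. fst (t k) = i}"
  by (auto simp: tabloid_def)

lemma tabloid_colouring:
  assumes t: "is_tableau \<nu> t" and l: "length \<nu> \<le> l"
  shows "T t \<in> colourings D {..<l} (\<lambda>i. int (part \<nu> i))"
proof -
  have "fst (t k) < l" if "k \<in> D" for k
    using tableau_cell[OF t that] l by (auto simp: cells_def)
  then show ?thesis
    unfolding colourings_def mem_Collect_eq tabloid_row card_tableau_row[OF t]
    by (auto simp: tabloid_def)
qed

definition column_injective :: "(nat \<Rightarrow> nat \<times> nat) \<Rightarrow> (nat \<Rightarrow> nat) \<Rightarrow> bool" where
  "column_injective t f \<longleftrightarrow> (\<forall>a\<in>D. \<forall>b\<in>D. snd (t a) = snd (t b) \<and> f a = f b \<longrightarrow> a = b)"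

text \<open>
  On a column \<open>f\<close> is injective, so it takes at most \<open>i\<close> values below \<open>i\<close>. The column has \<open>i\<close> cells in
  the first \<open>i\<close> rows unless it is shorter than that.
\<close>

lemma column_count_le:
  assumes t: "is_tableau \<nu> t" and f: "column_injective t f"
  shows "card {k\<in>D. snd (t k) = c \<and> f k < i} \<le> card {k\<in>D. snd (t k) = c \<and> fst (t k) < i}"
proof (cases "\<exists>k\<in>D. snd (t k) = c \<and> i \<le> fst (t k)")
  case True
  then obtain k where k: "k \<in> D" "snd (t k) = c" "i \<le> fst (t k)" by blast
  have "(r, c) \<in> t ` {k\<in>D. snd (t k) = c \<and> fst (t k) < i}" if "r < i" for r
  proof -
    have "(fst (t k), c) \<in> cells \<nu>" using tableau_cell[OF t k(1)] k(2) by (metis prod.collapse)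
    moreover have "part \<nu> (fst (t k)) \<le> part \<nu> r"
      using antimonoD[OF antimono_part[OF partition]] that k(3) by simp
    ultimately have "(r, c) \<in> cells \<nu>" by (simp add: mem_cells)
    then obtain k' where "k' \<in> D" "t k' = (r, c)" using tableau_surj[OF t] by blast
    then show ?thesis using that by (intro image_eqI[of _ _ k']) auto
  qed
  then have "(\<lambda>r. (r, c)) ` {..<i} \<subseteq> t ` {k\<in>D. snd (t k) = c \<and> fst (t k) < i}" by blast
  then have "card ((\<lambda>r. (r, c)) ` {..<i}) \<le> card (t ` {k\<in>D. snd (t k) = c \<and> fst (t k) < i})"
    by (intro card_mono) auto
  also have "\<dots> \<le> card {k\<in>D. snd (t k) = c \<and> fst (t k) < i}" by (intro card_image_le) simp
  finally have "i \<le> card {k\<in>D. snd (t k) = c \<and> fst (t k) < i}"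
    by (simp add: card_image inj_on_def)
  moreover have "card {k\<in>D. snd (t k) = c \<and> f k < i} \<le> card {..<i}"
    using f by (intro card_inj_on_le[of f]) (auto simp: column_injective_def inj_on_def)
  ultimately show ?thesis by simp
next
  case False
  then show ?thesis by (intro card_mono) (auto simp: not_le)
qed

lemma card_by_columns:
  "card {k\<in>D. P k} = (\<Sum>c\<in>(\<lambda>k. snd (t k)) ` D. card {k\<in>D. snd (t k) = c \<and> P k})"
proof -
  have "card {k\<in>D. P k} = (\<Sum>c\<in>(\<lambda>k. snd (t k)) ` D. card {k \<in> {k\<in>D. P k}. snd (t k) = c})"
    by (intro card_eq_sum_fibres) auto
  moreover have "{k \<in> {k\<in>D. P k}. snd (t k) = c} = {k\<in>D. snd (t k) = c \<and> P k}" for c by auto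
  ultimately show ?thesis by (simp only:)
qed

lemma column_injective_dominated:
  assumes "is_tableau \<nu> t" "column_injective t f"
  shows "card {k\<in>D. f k < i} \<le> card {k\<in>D. fst (t k) < i}"
proof -
  have "(\<Sum>c\<in>(\<lambda>k. snd (t k)) ` D. card {k\<in>D. snd (t k) = c \<and> f k < i})
      \<le> (\<Sum>c\<in>(\<lambda>k. snd (t k)) ` D. card {k\<in>D. snd (t k) = c \<and> fst (t k) < i})"
    by (intro sum_mono column_count_le assms)
  then show ?thesis
    using card_by_columns[where t = t and P = "\<lambda>k. f k < i"]
      card_by_columns[where t = t and P = "\<lambda>k. fst (t k) < i"] by linarith
qed

lemma column_injective_cell:
  assumes t: "is_tableau \<nu> t" and f: "column_injective t f"
    and eq: "\<And>i. card {k\<in>D. f k < i} = card {k\<in>D. fst (t k) < i}" and k: "k \<in> D"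
  shows "(f k, snd (t k)) \<in> cells \<nu>"
proof (rule ccontr)
  assume out: "(f k, snd (t k)) \<notin> cells \<nu>"
  let ?i = "f k" and ?c = "snd (t k)"
  have rows: "fst (t k') < ?i" if "k' \<in> D" "snd (t k') = ?c" for k'
  proof (rule ccontr)
    assume "\<not> fst (t k') < ?i"
    then have "part \<nu> (fst (t k')) \<le> part \<nu> ?i"
      using antimonoD[OF antimono_part[OF partition]] by simp
    moreover have "snd (t k') < part \<nu> (fst (t k'))"
      using tableau_cell[OF t that(1)] by (simp flip: mem_cells)
    ultimately show False using out that by (simp add: mem_cells)
  qed
  have "(\<Sum>c\<in>(\<lambda>k. snd (t k)) ` D. card {k\<in>D. snd (t k) = c \<and> f k < ?i})
      = (\<Sum>c\<in>(\<lambda>k. snd (t k)) ` D. card {k\<in>D. snd (t k) = c \<and> fst (t k) < ?i})"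
    using eq[of ?i] card_by_columns[where t = t and P = "\<lambda>k. f k < ?i"]
      card_by_columns[where t = t and P = "\<lambda>k. fst (t k) < ?i"] by linarith
  from sum_mono_inv[OF this column_count_le[OF t f] imageI[OF k]]
  have "card {k'\<in>D. snd (t k') = ?c \<and> f k' < ?i} = card {k'\<in>D. snd (t k') = ?c \<and> fst (t k') < ?i}" by simp
  also have "{k'\<in>D. snd (t k') = ?c \<and> fst (t k') < ?i} = {k'\<in>D. snd (t k') = ?c}" using rows by auto
  finally have "{k'\<in>D. snd (t k') = ?c \<and> f k' < ?i} = {k'\<in>D. snd (t k') = ?c}"
    by (intro card_subset_eq) auto
  then show False using k by blast
qed

lemma column_stabilizer_iff:
  "\<sigma> \<in> C t \<longleftrightarrow> \<sigma> permutes D \<and> (\<forall>k\<in>D. snd (t (\<sigma> k)) = snd (t k))"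
  by (simp add: column_stabilizer_def)

lemma C_permutes: "\<sigma> \<in> C t \<Longrightarrow> \<sigma> permutes D"
  by (simp add: column_stabilizer_iff)

lemma C_comp: "\<sigma> \<in> C t \<Longrightarrow> \<tau> \<in> C t \<Longrightarrow> \<sigma> \<circ> \<tau> \<in> C t"
  unfolding column_stabilizer_iff by (auto intro: permutes_compose simp: in_D)

lemma C_inv: "\<sigma> \<in> C t \<Longrightarrow> inv \<sigma> \<in> C t"
  unfolding column_stabilizer_iff
  by (metis in_D permutes_inv permutes_inverses(1))

lemma finite_C: "finite (C t)"
  by (rule finite_subset[OF _ finite_permutations[OF finD]]) (auto simp: column_stabilizer_iff)

lemma sign_comp: "\<sigma> permutes D \<Longrightarrow> \<tau> permutes D \<Longrightarrow> sign (\<sigma> \<circ> \<tau>) = sign \<sigma> * sign \<tau>"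
  by (intro sign_compose permutes_imp_permutation[OF finD])

lemma sign_inv: "\<sigma> permutes D \<Longrightarrow> sign (inv \<sigma>) = sign \<sigma>"
  by (intro sign_inverse permutes_imp_permutation[OF finD])

text \<open>
  Equality in the dominance bound forces the colours of a column to fill exactly its rows, so that the
  colouring is a rearrangement of the tableau within its columns.
\<close>

lemma column_injective_rearrangement:
  assumes t: "is_tableau \<nu> t" and f: "column_injective t f"
    and l: "length \<nu> \<le> l" and content: "f \<in> colourings D {..<l} (\<lambda>i. int (part \<nu> i))"
  obtains \<tau> where "\<tau> \<in> C t" "f = T t \<circ> \<tau>"
proof -
  have row: "card {k\<in>D. f k = j} = part \<nu> j" for j
  proof (cases "j < l")
    case True
    then show ?thesis using content by (simp add: colourings_def)
  next
    case False
    then have "{k\<in>D. f k = j} = {}"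
      using content PiE_mem[of f D "\<lambda>_. {..<l}"] by (auto simp: colourings_def)
    then show ?thesis using False l by (simp add: part_def)
  qed
  have "card {k\<in>D. f k < i} = card {k\<in>D. fst (t k) < i}" for i
  proof -
    have "card {k\<in>D. h k < i} = (\<Sum>j<i. card {k\<in>D. h k = j})" for h :: "nat \<Rightarrow> nat"
    proof -
      have "card {k\<in>D. h k < i} = (\<Sum>j<i. card {k \<in> {k\<in>D. h k < i}. h k = j})"
        by (intro card_eq_sum_fibres) auto
      also have "\<dots> = (\<Sum>j<i. card {k\<in>D. h k = j})"
        by (intro sum.cong refl arg_cong[where f = card]) auto
      finally show ?thesis .
    qed
    then show ?thesis by (simp add: row card_tableau_row[OF t])
  qed
  note cell = column_injective_cell[OF t f this]
  \<comment> \<open>move each point within its column to the row named by its colour\<close>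
  define \<tau> where "\<tau> k = (if k \<in> D then inv_into D t (f k, snd (t k)) else k)" for k
  have tD: "t ` D = cells \<nu>" using t by (simp add: is_tableau_def bij_betw_def)
  have \<tau>: "\<tau> k \<in> D" "t (\<tau> k) = (f k, snd (t k))" if "k \<in> D" for k
    using cell[OF that] that unfolding \<tau>_def tD[symmetric] by (auto simp: inv_into_into f_inv_into_f)
  have "inj_on \<tau> D"
  proof (rule inj_onI)
    fix a b assume ab: "a \<in> D" "b \<in> D" "\<tau> a = \<tau> b"
    then have "(f a, snd (t a)) = (f b, snd (t b))" using \<tau>(2)[of a] \<tau>(2)[of b] by simp
    then show "a = b" using f ab unfolding column_injective_def by blast
  qed
  moreover have "\<tau> ` D \<subseteq> D" using \<tau>(1) by blast
  ultimately have "bij_betw \<tau> D D"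
    using endo_inj_surj[OF finD] by (simp add: bij_betw_def)
  then have perm: "\<tau> permutes D"
    by (rule bij_imp_permutes) (simp add: \<tau>_def)
  then have "\<tau> \<in> C t" using \<tau>(2) by (simp add: column_stabilizer_iff)
  moreover have "f = T t \<circ> \<tau>"
  proof
    fix k
    show "f k = (T t \<circ> \<tau>) k"
    proof (cases "k \<in> D")
      case True
      then show ?thesis using \<tau> by (simp add: tabloid_def)
    next
      case False
      then have "f k = undefined" using content by (auto simp: colourings_def)
      then show ?thesis using False by (simp add: tabloid_def \<tau>_def)
    qed
  qed
  ultimately show thesis using that by blast
qed

lemma polytabloid_eq: "e t x = (\<Sum>\<sigma>\<in>C t. of_int (sign \<sigma>) * (if x = T t \<circ> inv \<sigma> then 1 else 0))"
  unfolding polytabloid_def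
  by (intro sum.cong refl) (simp add: tabloid_comp permutes_inv C_permutes)

lemma comp_eq_iff: "\<sigma> permutes D \<Longrightarrow> x \<circ> \<sigma> = y \<longleftrightarrow> x = y \<circ> inv \<sigma>"
  by (metis comp_assoc comp_id permutes_inv_o)

lemma polytabloid_antisymmetric:
  assumes \<sigma>: "\<sigma> \<in> C t"
  shows "e t (x \<circ> \<sigma>) = of_int (sign \<sigma>) * e t x"
proof -
  have *: "of_int (sign \<rho>) * (if x \<circ> \<sigma> = T t \<circ> inv \<rho> then 1 else 0)
      = (of_int (sign \<sigma>) * (of_int (sign (\<sigma> \<circ> \<rho>)) * (if x = T t \<circ> inv (\<sigma> \<circ> \<rho>) then 1 else 0)) :: rat)"
    if "\<rho> \<in> C t" for \<rho>
  proof -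
    have "inv (\<sigma> \<circ> \<rho>) = inv \<rho> \<circ> inv \<sigma>"
      by (intro o_inv_distrib permutes_bij[OF C_permutes[OF \<sigma>]] permutes_bij[OF C_permutes[OF that]])
    then have shift: "x \<circ> \<sigma> = T t \<circ> inv \<rho> \<longleftrightarrow> x = T t \<circ> inv (\<sigma> \<circ> \<rho>)"
      by (simp add: comp_eq_iff[OF C_permutes[OF \<sigma>]] comp_assoc)
    have "sign \<rho> = sign \<sigma> * sign (\<sigma> \<circ> \<rho>)"
      using sign_comp[OF C_permutes[OF \<sigma>] C_permutes[OF that]] by simp
    then have "(of_int (sign \<rho>) :: rat) = of_int (sign \<sigma>) * of_int (sign (\<sigma> \<circ> \<rho>))"
      by (simp only: of_int_mult)
    then show ?thesis unfolding shift by (simp only: mult.assoc)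
  qed
  have "e t (x \<circ> \<sigma>) = (\<Sum>\<rho>\<in>C t. of_int (sign \<sigma>) * (of_int (sign (\<sigma> \<circ> \<rho>)) * (if x = T t \<circ> inv (\<sigma> \<circ> \<rho>) then 1 else 0)))"
    unfolding polytabloid_eq by (intro sum.cong refl *)
  also have "\<dots> = (\<Sum>\<rho>\<in>C t. of_int (sign \<sigma>) * (of_int (sign \<rho>) * (if x = T t \<circ> inv \<rho> then 1 else 0)))"
    by (rule sum.reindex_bij_witness[of _ "\<lambda>\<rho>. inv \<sigma> \<circ> \<rho>" "\<lambda>\<rho>. \<sigma> \<circ> \<rho>"])
       (auto simp: permutes_inv_o[OF C_permutes[OF \<sigma>]] C_comp \<sigma> C_inv simp flip: comp_assoc)
  also have "\<dots> = of_int (sign \<sigma>) * e t x"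
    unfolding polytabloid_eq by (rule sum_distrib_left[symmetric])
  finally show ?thesis .
qed

lemma polytabloid_self:
  assumes t: "is_tableau \<nu> t"
  shows "e t (T t) = 1"
proof -
  have "T t = T t \<circ> inv \<sigma> \<longleftrightarrow> \<sigma> = id" if \<sigma>: "\<sigma> \<in> C t" for \<sigma>
  proof
    assume eq: "T t = T t \<circ> inv \<sigma>"
    have "\<sigma> k = k" for k
    proof (cases "k \<in> D")
      case True
      have "fst (t (\<sigma> k)) = fst (t k)"
        using fun_cong[OF eq, of "\<sigma> k"] True in_D[OF C_permutes[OF \<sigma>] True]
        by (simp add: tabloid_def permutes_inverses[OF C_permutes[OF \<sigma>]])
      moreover have "snd (t (\<sigma> k)) = snd (t k)" using \<sigma> True by (simp add: column_stabilizer_iff)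
      ultimately show ?thesis
        using tableau_inj[OF t in_D[OF C_permutes[OF \<sigma>] True] True] by (simp add: prod_eq_iff)
    qed (rule permutes_not_in[OF C_permutes[OF \<sigma>]])
    then show "\<sigma> = id" by auto
  qed simp
  then have "e t (T t) = (\<Sum>\<sigma>\<in>C t. if \<sigma> = id then 1 else 0)"
    unfolding polytabloid_eq by (intro sum.cong) auto
  then show ?thesis
    using finite_C permutes_id[of D] by (simp add: column_stabilizer_iff)
qed

lemma polytabloid_support:
  assumes t: "is_tableau \<nu> t" and l: "length \<nu> \<le> l" and x: "x \<notin> colourings D {..<l} (\<lambda>i. int (part \<nu> i))"
  shows "e t x = 0"
proof -
  have "x \<noteq> T t \<circ> inv \<sigma>" if "\<sigma> \<in> C t" for \<sigma>
    using tabloid_colouring[OF tableau_comp[OF t permutes_inv[OF C_permutes[OF that]]] l] x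
      tabloid_comp[OF permutes_inv[OF C_permutes[OF that]], of t] by auto
  then show ?thesis unfolding polytabloid_eq by (intro sum.neutral) auto
qed

lemma swap_in_C: "a \<in> D \<Longrightarrow> b \<in> D \<Longrightarrow> snd (t a) = snd (t b) \<Longrightarrow> transpose a b \<in> C t"
  unfolding column_stabilizer_iff by (auto intro: permutes_swap_id simp: transpose_def)

lemma comp_transpose_same: "x a = x b \<Longrightarrow> x \<circ> transpose a b = x"
  by (auto simp: transpose_def fun_eq_iff)

lemma antisymmetric_vanishes:
  fixes w :: "(nat \<Rightarrow> nat) \<Rightarrow> rat"
  assumes anti: "\<And>\<sigma> x. \<sigma> \<in> C t \<Longrightarrow> w (x \<circ> \<sigma>) = of_int (sign \<sigma>) * w x"
    and x: "\<not> column_injective t x"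
  shows "w x = 0"
proof -
  obtain a b where ab: "a \<in> D" "b \<in> D" "snd (t a) = snd (t b)" "x a = x b" "a \<noteq> b"
    using x unfolding column_injective_def by blast
  have "w x = w (x \<circ> transpose a b)" using comp_transpose_same[of x a b] ab(4) by simp
  also have "\<dots> = - w x" using anti[OF swap_in_C[OF ab(1-3)], of x] ab(5) by (simp add: sign_swap_id)
  finally show ?thesis by simp
qed

text \<open>
  Up to scalars the polytabloid of \<open>t\<close> is the only vector of the permutation module that is
  antisymmetric under the column stabilizer of \<open>t\<close>.
\<close>

lemma antisymmetric_unique:
  fixes w :: "(nat \<Rightarrow> nat) \<Rightarrow> rat"
  assumes t: "is_tableau \<nu> t"
    and anti: "\<And>\<sigma> x. \<sigma> \<in> C t \<Longrightarrow> w (x \<circ> \<sigma>) = of_int (sign \<sigma>) * w x"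
    and supp: "\<And>x. x \<notin> colourings D {..<length \<nu>} (\<lambda>i. int (part \<nu> i)) \<Longrightarrow> w x = 0"
  shows "w x = w (T t) * e t x"
proof (cases "x \<in> colourings D {..<length \<nu>} (\<lambda>i. int (part \<nu> i)) \<and> column_injective t x")
  case True
  then obtain \<tau> where \<tau>: "\<tau> \<in> C t" "x = T t \<circ> \<tau>"
    using column_injective_rearrangement[OF t _ order_refl] by blast
  show ?thesis
    unfolding \<tau>(2) anti[OF \<tau>(1)] polytabloid_antisymmetric[OF \<tau>(1)] polytabloid_self[OF t] by simp
next
  case False
  moreover have "w x = 0" "e t x = 0" if "\<not> column_injective t x"
    using that by (auto intro: antisymmetric_vanishes[of t w, OF anti]
        antisymmetric_vanishes[of t "e t", OF polytabloid_antisymmetric])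
  ultimately have "w x = 0" "e t x = 0"
    using supp[of x] polytabloid_support[OF t order_refl, of x] by blast+
  then show ?thesis by simp
qed

lemma polytabloid_translate:
  assumes g: "g permutes D"
  shows "e t (x \<circ> g) = e (t \<circ> inv g) x"
proof -
  let ?s = "t \<circ> inv g"
  note gi = permutes_inv[OF g]
  have conj: "g \<circ> \<sigma> \<circ> inv g \<in> C ?s" if "\<sigma> \<in> C t" for \<sigma>
    using that in_D[OF gi] unfolding column_stabilizer_iff
    by (auto intro!: permutes_compose gi g simp: permutes_inverses[OF g])
  have conj': "inv g \<circ> \<sigma> \<circ> g \<in> C t" if "\<sigma> \<in> C ?s" for \<sigma>
  proof -
    have "snd (t (inv g (\<sigma> (g k)))) = snd (t k)" if "k \<in> D" for k
      using \<open>\<sigma> \<in> C ?s\<close> in_D[OF g that] by (auto simp: column_stabilizer_iff permutes_inverses[OF g])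
    then show ?thesis
      using that unfolding column_stabilizer_iff by (auto intro!: permutes_compose gi g)
  qed
  have "e t (x \<circ> g) = (\<Sum>\<sigma>\<in>C t. of_int (sign (g \<circ> \<sigma> \<circ> inv g)) *
      (if x = T ?s \<circ> inv (g \<circ> \<sigma> \<circ> inv g) then 1 else 0))"
    unfolding polytabloid_eq
  proof (rule sum.cong[OF refl])
    fix \<sigma> assume \<sigma>: "\<sigma> \<in> C t"
    note p = C_permutes[OF \<sigma>]
    have "inv (g \<circ> \<sigma> \<circ> inv g) = g \<circ> inv \<sigma> \<circ> inv g"
      using permutes_bij[OF g] permutes_bij[OF p] permutes_bij[OF gi]
      by (simp add: o_inv_distrib bij_comp permutes_inv_inv[OF g] comp_assoc)
    then have "T ?s \<circ> inv (g \<circ> \<sigma> \<circ> inv g) = T t \<circ> inv \<sigma> \<circ> inv g"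
      by (simp add: tabloid_comp[OF gi] fun_eq_iff permutes_inverses[OF g])
    moreover have "sign (g \<circ> \<sigma> \<circ> inv g) = sign \<sigma>"
      using sign_comp[OF permutes_compose[OF p g] gi] sign_comp[OF g p] sign_inv[OF g] by simp
    ultimately show "of_int (sign \<sigma>) * (if x \<circ> g = T t \<circ> inv \<sigma> then 1 else 0)
        = (of_int (sign (g \<circ> \<sigma> \<circ> inv g)) * (if x = T ?s \<circ> inv (g \<circ> \<sigma> \<circ> inv g) then 1 else 0) :: rat)"
      by (simp only: comp_eq_iff[OF g])
  qed
  also have "\<dots> = e ?s x"
    unfolding polytabloid_eq
    by (rule sum.reindex_bij_witness[of _ "\<lambda>\<sigma>. inv g \<circ> \<sigma> \<circ> g" "\<lambda>\<sigma>. g \<circ> \<sigma> \<circ> inv g"])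
       (auto simp: conj conj' fun_eq_iff permutes_inverses[OF g])
  finally show ?thesis .
qed

lemma polytabloid_cong:
  assumes "\<And>k. k \<in> D \<Longrightarrow> t k = t' k"
  shows "e t = e t'"
proof -
  have "C t = C t'"
    using assms by (auto simp: column_stabilizer_iff in_D)
  moreover have "T t = T t'"
    using assms by (auto simp: tabloid_def)
  ultimately show ?thesis by (simp add: fun_eq_iff polytabloid_eq)
qed

lemma tableau_translate:
  assumes t: "is_tableau \<nu> t" and t': "is_tableau \<nu> t'"
  obtains g where "g permutes D" "\<forall>k\<in>D. t' k = t (g k)"
proof -
  define g where "g k = (if k \<in> D then inv_into D t (t' k) else k)" for k
  have bij: "bij_betw t D (cells \<nu>)" "bij_betw t' D (cells \<nu>)" using t t' by (simp_all add: is_tableau_def)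
  have "bij_betw (inv_into D t \<circ> t') D D"
    by (rule bij_betw_trans[OF bij(2) bij_betw_inv_into[OF bij(1)]])
  then have "bij_betw g D D"
    by (rule bij_betw_cong[THEN iffD1, rotated]) (simp add: g_def)
  then have "g permutes D" by (rule bij_imp_permutes) (simp add: g_def)
  moreover have "t' k = t (g k)" if "k \<in> D" for k
    using that bij_betw_inv_into_right[OF bij(1) tableau_cell[OF t' that]] by (simp add: g_def)
  ultimately show thesis using that by blast
qed

end

section \<open>Specht modules\<close>

interpretation tabloid_vectors: vector_space "\<lambda>c (v :: (nat \<Rightarrow> nat) \<Rightarrow> rat) r. c * v r"
  by unfold_locales (auto simp: fun_eq_iff algebra_simps)

context tableau_shape
begin

abbreviation S :: "((nat \<Rightarrow> nat) \<Rightarrow> rat) sym_rep" where "S \<equiv> specht \<nu>"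

lemma specht_simps:
  "scale S = (\<lambda>c v r. c * v r)" "act S = (\<lambda>g v r. v (r \<circ> g))"
  "space S = tabloid_vectors.span (e ` {t. is_tableau \<nu> t})"
  by (simp_all add: specht_def)

lemma polytabloid_in_space: "is_tableau \<nu> t \<Longrightarrow> e t \<in> space S"
  unfolding specht_simps by (intro tabloid_vectors.span_base) blast

lemma space_induct [consumes 1, case_names zero step]:
  assumes "v \<in> space S" "P 0"
    "\<And>c t v. is_tableau \<nu> t \<Longrightarrow> v \<in> space S \<Longrightarrow> P v \<Longrightarrow> P ((\<lambda>r. c * e t r) + v)"
  shows "P v"
proof -
  have "v \<in> tabloid_vectors.span (e ` {t. is_tableau \<nu> t})" using assms(1) by (simp add: specht_simps)
  then have "v \<in> space S \<and> P v"
  proof (induction rule: tabloid_vectors.span_induct_alt)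
    case base
    show ?case unfolding specht_simps(3) using assms(2) tabloid_vectors.span_zero by blast
  next
    case (step c x y)
    then obtain t where t: "is_tableau \<nu> t" "x = e t" by blast
    then have "(\<lambda>r. c * x r) + y \<in> space S"
      using step polytabloid_in_space[OF t(1)] unfolding specht_simps(3)
      by (intro tabloid_vectors.span_add tabloid_vectors.span_scale) auto
    moreover have "P ((\<lambda>r. c * x r) + y)"
      unfolding t(2) using step(2) by (intro assms(3)[OF t(1)]) auto
    ultimately show ?case ..
  qed
  then show ?thesis ..
qed

lemma finite_polytabloids: "finite (e ` {t. is_tableau \<nu> t})"
proof (rule finite_subset)
  show "e ` {t. is_tableau \<nu> t} \<subseteq> e ` (D \<rightarrow>\<^sub>E cells \<nu>)"
  proof (rule image_subsetI)
    fix t assume "t \<in> {t. is_tableau \<nu> t}"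
    then have "restrict t D \<in> D \<rightarrow>\<^sub>E cells \<nu>" by (auto simp: tableau_cell)
    moreover have "e t = e (restrict t D)" by (rule polytabloid_cong) simp
    ultimately show "e t \<in> e ` (D \<rightarrow>\<^sub>E cells \<nu>)" by blast
  qed
  show "finite (e ` (D \<rightarrow>\<^sub>E cells \<nu>))"
    by (intro finite_imageI finite_PiE finD finite_cells)
qed

lemma act_polytabloid: "g permutes D \<Longrightarrow> act S g (e t) = e (t \<circ> inv g)"
  by (simp add: specht_simps fun_eq_iff polytabloid_translate)

lemma specht_act_in: "g permutes D \<Longrightarrow> v \<in> space S \<Longrightarrow> act S g v \<in> space S"
proof -
  assume g: "g permutes D" and v: "v \<in> space S"
  show "act S g v \<in> space S"
    using v
  proof (induction rule: space_induct)
    case zero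
    have "act S g 0 = 0" by (simp add: specht_simps fun_eq_iff)
    then show ?case unfolding specht_simps(3) by (simp only: tabloid_vectors.span_zero)
  next
    case (step c t v)
    have "act S g ((\<lambda>r. c * e t r) + v) = (\<lambda>r. c * act S g (e t) r) + act S g v"
      by (simp add: specht_simps fun_eq_iff)
    moreover have "act S g (e t) \<in> space S"
      using act_polytabloid[OF g] polytabloid_in_space[OF tableau_comp[OF step(1) permutes_inv[OF g]]] by simp
    ultimately show ?case
      using step(3) unfolding specht_simps(3) by (metis tabloid_vectors.span_add tabloid_vectors.span_scale)
  qed
qed

lemma specht_sym_module: "sym_module (sum_list \<nu>) S"
  unfolding sym_module_def
proof (intro conjI allI impI ballI)
  show "vector_space (scale S)"
    unfolding specht_simps by (rule tabloid_vectors.vector_space_axioms)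
  show "module.subspace (scale S) (space S)"
    unfolding specht_simps by (rule tabloid_vectors.subspace_span)
  show "\<exists>B. finite B \<and> module.span (scale S) B = space S"
    unfolding specht_simps using finite_polytabloids by blast
  show "act S g v \<in> space S" if "g permutes D" "v \<in> space S" for g v
    by (rule specht_act_in[OF that])
qed (simp_all add: specht_simps fun_eq_iff comp_assoc)

lemma specht_support:
  assumes "v \<in> space S" "length \<nu> \<le> l" "x \<notin> colourings D {..<l} (\<lambda>i. int (part \<nu> i))"
  shows "v x = 0"
  using assms(1) by (induction rule: space_induct) (simp_all add: polytabloid_support[OF _ assms(2,3)])

text \<open>
  Polytabloids span, so linear maps may be compared on them.
\<close>

lemma linmap_eqI:
  assumes f: "f \<in> linmap (scale S) (space S) s W" and g: "g \<in> linmap (scale S) (space S) s W"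
    and W: "fin_dim_subspace s W"
    and eq: "\<And>t. is_tableau \<nu> t \<Longrightarrow> f (e t) = g (e t)" and v: "v \<in> space S"
  shows "f v = g v"
proof -
  have fd: "fin_dim_subspace (scale S) (space S)" by (rule sym_module_fin_dim[OF specht_sym_module])
  show ?thesis
    using v
  proof (induction rule: space_induct)
    case zero
    show ?case by (simp only: linmap_0[OF fd f] linmap_0[OF fd g])
  next
    case (step c t v)
    have "scale S c (e t) \<in> space S"
      using polytabloid_in_space[OF step(1)] unfolding specht_simps by (rule tabloid_vectors.span_scale)
    then have "f (scale S c (e t) + v) = g (scale S c (e t) + v)"
      using step eq polytabloid_in_space
      by (simp add: linmap_add[OF f] linmap_add[OF g] linmap_scale[OF f] linmap_scale[OF g])
    then show ?case by (simp only: specht_simps)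
  qed
qed

text \<open>
  An equivariant endomorphism preserves antisymmetry under the column stabilizer of \<open>t\<close>, hence
  multiplies the polytabloid of \<open>t\<close> by a scalar, and the polytabloids form one orbit.
\<close>

lemma specht_absolutely_simple: "absolutely_simple (sum_list \<nu>) S"
  unfolding absolutely_simple_def
proof (intro conjI allI impI)
  show "sym_module (sum_list \<nu>) S" by (rule specht_sym_module)
  obtain t where t: "is_tableau \<nu> t" using ex_tableau by blast
  show "space S \<noteq> {0}"
    using polytabloid_in_space[OF t] polytabloid_self[OF t] by auto
  fix f assume f: "equivariant (sum_list \<nu>) S S f"
  note lin = equivariant_linmap[OF f]
  let ?w = "f (e t)"
  have w: "?w \<in> space S" by (rule linmap_in[OF lin polytabloid_in_space[OF t]])
  have anti: "?w (x \<circ> \<sigma>) = of_int (sign \<sigma>) * ?w x" if \<sigma>: "\<sigma> \<in> C t" for \<sigma> x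
  proof -
    have "act S \<sigma> (e t) = scale S (of_int (sign \<sigma>)) (e t)"
      by (simp add: specht_simps fun_eq_iff polytabloid_antisymmetric[OF \<sigma>])
    then have "act S \<sigma> ?w = scale S (of_int (sign \<sigma>)) ?w"
      using equivariant_act[OF f C_permutes[OF \<sigma>] polytabloid_in_space[OF t]]
        linmap_scale[OF lin polytabloid_in_space[OF t]] by simp
    then show ?thesis by (simp add: specht_simps fun_eq_iff)
  qed
  define c where "c = ?w (T t)"
  have w_eq: "?w = scale S c (e t)"
    unfolding specht_simps c_def
    by (rule ext) (rule antisymmetric_unique[OF t anti specht_support[OF w order_refl]])
  have "f v = scale S c v" if v: "v \<in> space S" for v
  proof (rule linmap_eqI[OF lin _ sym_module_fin_dim[OF specht_sym_module] _ v])
    show "scale S c \<in> linmaps S S"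
      using linmap_scaled[OF sym_module_fin_dim[OF specht_sym_module] linmap_id] .
    fix t' assume t': "is_tableau \<nu> t'"
    obtain g where g: "g permutes D" "\<forall>k\<in>D. t' k = t (g k)"
      using tableau_translate[OF t t'] .
    note gi = permutes_inv[OF g(1)]
    have "e t' = act S (inv g) (e t)"
      using polytabloid_cong[of t' "t \<circ> g"] g by (simp add: act_polytabloid[OF gi] permutes_inv_inv)
    then show "f (e t') = scale S c (e t')"
      using equivariant_act[OF f gi polytabloid_in_space[OF t]] w_eq
        linmap_scale[OF act_linmap[OF specht_sym_module gi] polytabloid_in_space[OF t]] by simp
  qed
  then show "\<exists>c. \<forall>v\<in>space S. f v = scale S c v" by blast
qed

section \<open>Young subgroups acting on Specht modules\<close>

definition stabilizer :: "(nat \<Rightarrow> nat) \<Rightarrow> (nat \<Rightarrow> nat) set" where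
  "stabilizer f = {g. g permutes D \<and> (\<forall>k\<in>D. f (g k) = f k)}"

text \<open>
  The sum of the stabilizer of \<open>f\<close>, a Young subgroup, as an operator. It is its order times the
  projection onto the invariants.
\<close>

definition symmetrize :: "(nat \<Rightarrow> nat) \<Rightarrow> ((nat \<Rightarrow> nat) \<Rightarrow> rat) \<Rightarrow> (nat \<Rightarrow> nat) \<Rightarrow> rat" where
  "symmetrize f v = (\<Sum>g\<in>stabilizer f. act S g v)"

lemma symmetrize_apply: "symmetrize f v x = (\<Sum>g\<in>stabilizer f. v (x \<circ> g))"
proof -
  have "(\<Sum>g\<in>H. act S g v) x = (\<Sum>g\<in>H. v (x \<circ> g))" for H
    by (induction H rule: infinite_finite_induct) (simp_all add: specht_simps comp_def)
  then show ?thesis by (simp add: symmetrize_def)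
qed

lemma symmetrize_linmap: "symmetrize f \<in> linmaps S S"
  unfolding symmetrize_def
  by (intro linmap_sums[OF sym_module_fin_dim[OF specht_sym_module]] act_linmap[OF specht_sym_module])
     (simp add: stabilizer_def)

lemma trace_symmetrize:
  "rep_trace S (symmetrize f) = (\<Sum>g\<in>stabilizer f. rep_character S g)"
  unfolding symmetrize_def rep_character_def
  by (intro trace_sum[OF sym_module_fin_dim[OF specht_sym_module]] act_linmap[OF specht_sym_module])
     (simp add: stabilizer_def)

lemma stabilizer_comp: "g \<in> stabilizer f \<Longrightarrow> h \<in> stabilizer f \<Longrightarrow> g \<circ> h \<in> stabilizer f"
  unfolding stabilizer_def by (auto intro: permutes_compose simp: in_D)

lemma stabilizer_inv: "g \<in> stabilizer f \<Longrightarrow> inv g \<in> stabilizer f"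
  unfolding stabilizer_def by (auto intro: permutes_inv) (metis in_D permutes_inv permutes_inverses(1))

lemma symmetrize_translate:
  assumes h: "h \<in> stabilizer f"
  shows "symmetrize f (act S h v) = symmetrize f v"
proof
  fix x
  have hp: "h permutes D" using h by (simp add: stabilizer_def)
  have "(\<Sum>g\<in>stabilizer f. v (x \<circ> g \<circ> h)) = (\<Sum>g\<in>stabilizer f. v (x \<circ> g))"
    by (rule sum.reindex_bij_witness[of _ "\<lambda>g. g \<circ> inv h" "\<lambda>g. g \<circ> h"])
       (simp_all add: comp_assoc permutes_inv_o[OF hp] stabilizer_comp stabilizer_inv h)
  then show "symmetrize f (act S h v) x = symmetrize f v x"
    by (simp add: symmetrize_apply specht_simps)
qed

text \<open>
  The transposition of two points with the same colour in the same column fixes \<open>f\<close> and negates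
  \<open>e t\<close>.
\<close>

lemma symmetrize_column_repeat:
  assumes "\<not> column_injective t f"
  shows "symmetrize f (e t) = 0"
proof -
  obtain a b where ab: "a \<in> D" "b \<in> D" "snd (t a) = snd (t b)" "f a = f b" "a \<noteq> b"
    using assms unfolding column_injective_def by blast
  let ?s = "transpose a b"
  have s: "?s \<in> stabilizer f"
    using ab permutes_swap_id[OF ab(1,2)] by (simp add: stabilizer_def transpose_def)
  have "act S ?s (e t) = scale S (- 1) (e t)"
    using polytabloid_antisymmetric[OF swap_in_C[OF ab(1-3)]] ab(5)
    by (simp add: specht_simps fun_eq_iff sign_swap_id)
  then have "symmetrize f (e t) x = - symmetrize f (e t) x" for x
    using symmetrize_translate[OF s, of "e t"]
    by (simp add: symmetrize_apply specht_simps sum_negf fun_eq_iff)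
  then have "symmetrize f (e t) x = 0" for x by (metis equal_neg_zero)
  then show ?thesis by (simp add: fun_eq_iff)
qed

lemma colouring_partial_sum:
  fixes l j :: nat
  assumes f: "f \<in> colourings D {..<l} \<alpha>" and j: "j \<le> l"
  shows "int (card {k\<in>D. f k < j}) = (\<Sum>i<j. \<alpha> i)"
proof -
  have "card {k\<in>D. f k < j} = (\<Sum>i<j. card {k \<in> {k\<in>D. f k < j}. f k = i})"
    by (intro card_eq_sum_fibres) auto
  also have "\<dots> = (\<Sum>i<j. card {k\<in>D. f k = i})"
    by (intro sum.cong refl arg_cong[where f = card]) auto
  finally have "int (card {k\<in>D. f k < j}) = (\<Sum>i<j. int (card {k\<in>D. f k = i}))" by simp
  also have "\<dots> = (\<Sum>i<j. \<alpha> i)" using f j by (intro sum.cong) (auto simp: colourings_def)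
  finally show ?thesis .
qed

text \<open>
  If the partial sums of the content are not dominated by those of the shape, then every tableau has a
  column in which \<open>f\<close> repeats a colour, and the symmetrizer is zero.
\<close>

lemma young_invariants_not_dominated:
  assumes f: "f \<in> colourings D {..<l} \<alpha>" and l: "length \<nu> \<le> l"
    and j: "j \<le> l" "(\<Sum>i<j. int (part \<nu> i)) < (\<Sum>i<j. \<alpha> i)"
  shows "(\<Sum>g\<in>stabilizer f. rep_character S g) = 0"
proof -
  have not_inj: "\<not> column_injective t f" if t: "is_tableau \<nu> t" for t
  proof
    assume "column_injective t f"
    from column_injective_dominated[OF t this, of j]
    have "int (card {k\<in>D. f k < j}) \<le> int (card {k\<in>D. T t k < j})"
      by (simp add: tabloid_def cong: conj_cong)
    then show False
      using j colouring_partial_sum[OF f j(1)] colouring_partial_sum[OF tabloid_colouring[OF t l] j(1)] by simp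
  qed
  note fd = sym_module_fin_dim[OF specht_sym_module]
  have zero: "(\<lambda>_. 0) \<in> linmaps S S"
    using linmap_sums[OF fd, of "{} :: nat set"] by simp
  have "rep_trace S (symmetrize f) = rep_trace S (\<lambda>_. 0)"
  proof (rule trace_cong[OF fd symmetrize_linmap])
    show "symmetrize f v = 0" if "v \<in> space S" for v
      by (rule linmap_eqI[OF symmetrize_linmap zero fd _ that]) (simp add: symmetrize_column_repeat not_inj)
  qed
  also have "\<dots> = 0" using trace_sum[OF fd, of "{} :: nat set"] by simp
  finally show ?thesis by (simp add: trace_symmetrize)
qed

text \<open>
  When the content of \<open>f\<close> is the shape itself, the symmetrizer has rank one: it sends \<open>v\<close> to the
  multiple, by the coefficient of \<open>v\<close> at \<open>f\<close>, of one symmetrized polytabloid.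
\<close>

lemma young_invariants_shape:
  assumes f: "f \<in> colourings D {..<l} (\<lambda>i. int (part \<nu> i))" and l: "length \<nu> \<le> l"
  shows "(\<Sum>g\<in>stabilizer f. rep_character S g) = of_nat (card (stabilizer f))"
proof -
  note fd = sym_module_fin_dim[OF specht_sym_module]
  obtain t0 where t0: "is_tableau \<nu> t0" using ex_tableau by blast
  \<comment> \<open>a tableau \<open>t\<close> with tabloid \<open>f\<close>\<close>
  obtain h where h: "h permutes D" "\<forall>k\<in>D. f k = T t0 (h k)"
    using colourings_transitive[OF f tabloid_colouring[OF t0 l]] .
  define t where "t = t0 \<circ> h"
  have t: "is_tableau \<nu> t" unfolding t_def by (rule tableau_comp[OF t0 h(1)])
  have fT: "f = T t"
  proof
    fix k show "f k = T t k"
    proof (cases "k \<in> D")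
      case True
      then show ?thesis using h(2) in_D[OF h(1) True] by (simp add: t_def tabloid_def)
    next
      case False
      then show ?thesis using f by (auto simp: tabloid_def colourings_def)
    qed
  qed
  let ?v = "symmetrize f (e t)"
  have v: "?v \<in> space S" by (rule linmap_in[OF symmetrize_linmap polytabloid_in_space[OF t]])
  have value_lin: "(\<lambda>x. x f) \<in> linmap (scale S) (space S) (*) UNIV"
    by (intro linmapI) (simp_all add: specht_simps)
  have rank: "symmetrize f (e t') = scale S (e t' f) ?v" if t': "is_tableau \<nu> t'" for t'
  proof (cases "column_injective t' f")
    case False
    have "e t' f = 0"
      by (rule antisymmetric_vanishes[OF _ False]) (rule polytabloid_antisymmetric)
    then show ?thesis
      using symmetrize_column_repeat[OF False] by (simp add: specht_simps fun_eq_iff)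
  next
    case True
    obtain \<tau> where \<tau>: "\<tau> \<in> C t'" "f = T t' \<circ> \<tau>"
      using column_injective_rearrangement[OF t' True l f] .
    note p = C_permutes[OF \<tau>(1)]
    have et': "e t' f = of_int (sign \<tau>)"
      unfolding \<tau>(2) polytabloid_antisymmetric[OF \<tau>(1)] polytabloid_self[OF t'] by simp
    have tau_t': "is_tableau \<nu> (t' \<circ> \<tau>)" by (rule tableau_comp[OF t' p])
    have "e (t' \<circ> \<tau>) = act S (inv \<tau>) (e t')"
      by (simp add: act_polytabloid[OF permutes_inv[OF p]] permutes_inv_inv[OF p])
    also have "\<dots> = scale S (of_int (sign \<tau>)) (e t')"
      by (simp add: specht_simps fun_eq_iff polytabloid_antisymmetric[OF C_inv[OF \<tau>(1)]] sign_inv[OF p])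
    finally have 1: "e (t' \<circ> \<tau>) = scale S (of_int (sign \<tau>)) (e t')" .
    obtain g where g: "g permutes D" "\<forall>k\<in>D. (t' \<circ> \<tau>) k = t (g k)"
      using tableau_translate[OF t tau_t'] .
    have T_eq: "T (t' \<circ> \<tau>) = T t" using tabloid_comp[OF p, of t'] \<tau>(2) fT by simp
    have "f (g k) = f k" if k: "k \<in> D" for k
    proof -
      have "f (g k) = fst (t (g k))" using in_D[OF g(1) k] by (simp add: fT tabloid_def)
      also have "\<dots> = T (t' \<circ> \<tau>) k" using bspec[OF g(2) k] k by (simp add: tabloid_def)
      finally show ?thesis by (simp add: T_eq fT)
    qed
    then have "inv g \<in> stabilizer f" using g(1) by (intro stabilizer_inv) (simp add: stabilizer_def)
    moreover have "e (t' \<circ> \<tau>) = act S (inv g) (e t)"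
      using polytabloid_cong[of "t' \<circ> \<tau>" "t \<circ> g"] g
      by (simp add: act_polytabloid[OF permutes_inv[OF g(1)]] permutes_inv_inv[OF g(1)])
    ultimately have "symmetrize f (e (t' \<circ> \<tau>)) = ?v" by (simp add: symmetrize_translate)
    then have "scale S (of_int (sign \<tau>)) (symmetrize f (e t')) = ?v"
      unfolding 1 using linmap_scale[OF symmetrize_linmap polytabloid_in_space[OF t']] by simp
    then have "of_int (sign \<tau>) * symmetrize f (e t') x = ?v x" for x
      by (simp add: specht_simps fun_eq_iff)
    moreover have "of_int (sign \<tau>) * (of_int (sign \<tau>) :: rat) = 1"
      by (simp flip: of_int_mult)
    ultimately have "symmetrize f (e t') x = of_int (sign \<tau>) * ?v x" for x
      by (metis mult.assoc mult_1)
    then show ?thesis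
      unfolding et' specht_simps by (rule ext)
  qed
  have lin: "(\<lambda>x. scale S (x f) ?v) \<in> linmaps S S"
  proof (rule linmapI)
    show "scale S (x f) ?v \<in> space S" for x
      using v unfolding specht_simps by (rule tabloid_vectors.span_scale)
    show "scale S ((x + y) f) ?v = scale S (x f) ?v + scale S (y f) ?v" for x y
      by (simp only: specht_simps plus_fun_apply tabloid_vectors.scale_left_distrib)
    show "scale S (scale S c x f) ?v = scale S c (scale S (x f) ?v)" for c x
      by (simp only: specht_simps mult.assoc)
  qed
  have "rep_trace S (symmetrize f) = rep_trace S (\<lambda>x. scale S (x f) ?v)"
    by (rule trace_cong[OF fd symmetrize_linmap]) (rule linmap_eqI[OF symmetrize_linmap lin fd rank])
  also have "\<dots> = ?v f" by (rule trace_rank_one[OF fd value_lin v])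
  also have "\<dots> = (\<Sum>g\<in>stabilizer f. e t f)"
    unfolding symmetrize_apply
  proof (rule sum.cong[OF refl])
    fix g assume g: "g \<in> stabilizer f"
    have "(f \<circ> g) k = f k" for k
      using g permutes_not_in[of g D k] by (cases "k \<in> D") (auto simp: stabilizer_def)
    then have "f \<circ> g = f" by blast
    then show "e t (f \<circ> g) = e t f" by simp
  qed
  also have "\<dots> = of_nat (card (stabilizer f))" using polytabloid_self[OF t] by (simp add: fT)
  finally show ?thesis by (simp add: trace_symmetrize)
qed

text \<open>
  Frobenius reciprocity for the permutation character.
\<close>

lemma char_inner_specht_colouring:
  "char_inner (sum_list \<nu>) (rep_character S) (colouring_character (sum_list \<nu>) l \<alpha>)
    = (\<Sum>f\<in>colourings D {..<l} \<alpha>. \<Sum>g\<in>stabilizer f. rep_character S g) / fact (sum_list \<nu>)"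
proof -
  let ?G = "{g. g permutes D}" and ?X = "colourings D {..<l} \<alpha>"
  have finG: "finite ?G" by (rule finite_permutations[OF finD])
  have finX: "finite ?X" by (rule finite_colourings[OF finD finite_lessThan])
  have "(\<Sum>g\<in>?G. rep_character S g * colouring_character (sum_list \<nu>) l \<alpha> g)
      = (\<Sum>g\<in>?G. \<Sum>f\<in>?X. if \<forall>k\<in>D. f (g k) = f k then rep_character S g else 0)"
    unfolding colouring_character_def
    by (intro sum.cong refl) (simp add: finX sum.If_cases Int_def mult.commute)
  also have "\<dots> = (\<Sum>f\<in>?X. \<Sum>g\<in>?G. if \<forall>k\<in>D. f (g k) = f k then rep_character S g else 0)"
    by (rule sum.swap)
  also have "\<dots> = (\<Sum>f\<in>?X. \<Sum>g\<in>stabilizer f. rep_character S g)"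
  proof (rule sum.cong[OF refl])
    fix f
    show "(\<Sum>g\<in>?G. if \<forall>k\<in>D. f (g k) = f k then rep_character S g else 0)
        = (\<Sum>g\<in>stabilizer f. rep_character S g)"
      using sum.inter_filter[OF finG, of "rep_character S" "\<lambda>g. \<forall>k\<in>D. f (g k) = f k"]
      by (simp add: stabilizer_def)
  qed
  finally show ?thesis unfolding char_inner_def by simp
qed

lemma char_inner_specht_not_dominated:
  assumes "length \<nu> \<le> l" "j \<le> l" "(\<Sum>i<j. int (part \<nu> i)) < (\<Sum>i<j. \<alpha> i)"
  shows "char_inner (sum_list \<nu>) (rep_character S) (colouring_character (sum_list \<nu>) l \<alpha>) = 0"
  unfolding char_inner_specht_colouring
  using young_invariants_not_dominated[OF _ assms] by simp

lemma char_inner_specht_shape: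
  assumes l: "length \<nu> \<le> l"
  shows "char_inner (sum_list \<nu>) (rep_character S) (colouring_character (sum_list \<nu>) l (\<lambda>i. int (part \<nu> i))) = 1"
proof -
  let ?G = "{g. g permutes D}" and ?X = "colourings D {..<l} (\<lambda>i. int (part \<nu> i))"
  have "(\<Sum>g\<in>?G. card {f\<in>?X. \<forall>k\<in>D. f (g k) = f k}) = (\<Sum>f\<in>?X. card {g\<in>?G. \<forall>k\<in>D. f (g k) = f k})"
    by (rule sum_multicount_gen)
       (auto intro: finite_permutations[OF finD] finite_colourings[OF finD finite_lessThan])
  then have "(\<Sum>f\<in>?X. card (stabilizer f)) = fact (sum_list \<nu>)"
    using sum_fixed_colourings[OF finite_lessThan sum_part[OF l]] by (simp add: stabilizer_def)
  moreover have "(\<Sum>f\<in>?X. \<Sum>g\<in>stabilizer f. rep_character S g) = of_nat (\<Sum>f\<in>?X. card (stabilizer f))"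
    using young_invariants_shape[OF _ l] by simp
  ultimately show ?thesis unfolding char_inner_specht_colouring by simp
qed

section \<open>Specht characters are determinantal\<close>

lemma char_inner_specht_jacobi_trudi:
  assumes l: "length \<nu> \<le> l"
  shows "char_inner (sum_list \<nu>) (rep_character S) (jacobi_trudi (sum_list \<nu>) l (part \<nu>)) = 1"
proof -
  let ?\<alpha> = "\<lambda>\<pi> i. int (part \<nu> i) + int (\<pi> i) - int i"
  have "char_inner (sum_list \<nu>) (rep_character S) (colouring_character (sum_list \<nu>) l (?\<alpha> \<pi>)) = (if \<pi> = id then 1 else 0)"
    if \<pi>: "\<pi> permutes {..<l}" for \<pi>
  proof (cases "\<pi> = id")
    case True
    then show ?thesis using char_inner_specht_shape[OF l] by simp
  next
    case False
    then obtain j where j: "j \<le> l" "(\<Sum>i<j. int i) < (\<Sum>i<j. int (\<pi> i))"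
      using permutes_eq_id_of_partial_sums[OF \<pi>] by (meson not_le)
    then have "(\<Sum>i<j. int (part \<nu> i)) < (\<Sum>i<j. ?\<alpha> \<pi> i)" by (simp add: sum.distrib sum_subtractf)
    then show ?thesis using False char_inner_specht_not_dominated[OF l j(1)] by simp
  qed
  then have "char_inner (sum_list \<nu>) (rep_character S) (jacobi_trudi (sum_list \<nu>) l (part \<nu>))
      = (\<Sum>\<pi> | \<pi> permutes {..<l}. if \<pi> = id then 1 else 0)"
    unfolding char_inner_jacobi_trudi by (intro sum.cong) auto
  then show ?thesis by (simp add: finite_permutations permutes_id)
qed

text \<open>
  Two class functions of norm one and inner product one coincide.
\<close>

theorem specht_character_jacobi_trudi:
  assumes l: "length \<nu> \<le> l" and g: "g permutes D"
  shows "rep_character S g = jacobi_trudi (sum_list \<nu>) l (part \<nu>) g"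
proof -
  let ?\<chi> = "rep_character S" and ?\<psi> = "jacobi_trudi (sum_list \<nu>) l (part \<nu>)" and ?m = "sum_list \<nu>"
  have inner: "(\<Sum>g | g permutes D. \<phi> g * \<theta> g) = fact ?m * char_inner ?m \<phi> \<theta>" for \<phi> \<theta>
    by (simp add: char_inner_def)
  have "(\<Sum>g | g permutes D. (?\<chi> g - ?\<psi> g)\<^sup>2)
      = (\<Sum>g | g permutes D. ?\<chi> g * ?\<chi> g) - 2 * (\<Sum>g | g permutes D. ?\<chi> g * ?\<psi> g)
        + (\<Sum>g | g permutes D. ?\<psi> g * ?\<psi> g)"
    by (simp add: power2_eq_square algebra_simps sum.distrib sum_subtractf sum_distrib_left)
  also have "\<dots> = fact ?m * (char_inner ?m ?\<chi> ?\<chi> - 2 * char_inner ?m ?\<chi> ?\<psi> + char_inner ?m ?\<psi> ?\<psi>)"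
    unfolding inner by (simp add: algebra_simps)
  also have "\<dots> = 0"
    using absolutely_simple_norm[OF specht_absolutely_simple] char_inner_specht_jacobi_trudi[OF l]
      jacobi_trudi_norm[OF antimono_part[OF partition] sum_part[OF l]] by simp
  finally have "\<forall>g\<in>{g. g permutes D}. (?\<chi> g - ?\<psi> g)\<^sup>2 = 0"
    by (subst (asm) sum_nonneg_eq_0_iff) (auto intro: finite_permutations[OF finD])
  then show ?thesis using g by simp
qed

end

lemma partial_sum_permutes_ge:
  fixes \<pi> :: "nat \<Rightarrow> nat"
  assumes \<pi>: "\<pi> permutes A"
  shows "(\<Sum>i<j. int i) \<le> (\<Sum>i<j. int (\<pi> i))"
proof -
  have *: "(\<Sum>i<card A. i) \<le> \<Sum>A" if "finite A" for A :: "nat set"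
    using that
  proof (induction "card A" arbitrary: A)
    case (Suc n)
    let ?M = "Max A"
    have ne: "A \<noteq> {}" using Suc by auto
    then have M: "?M \<in> A" using Suc by simp
    have "A \<subseteq> {..?M}" using Suc by auto
    then have "card A \<le> Suc ?M" using card_mono[of "{..?M}" A] by simp
    then have "n \<le> ?M" using Suc by simp
    moreover have "card (A - {?M}) = n" using Suc M by simp
    then have "(\<Sum>i<n. i) \<le> \<Sum>(A - {?M})" using Suc(1)[of "A - {?M}"] Suc(3) by simp
    moreover have "\<Sum>A = ?M + \<Sum>(A - {?M})" using M Suc(3) by (simp add: sum.remove)
    moreover have "(\<Sum>i<card A. i) = (\<Sum>i<n. i) + n" using Suc(2) by (simp flip: Suc(2))
    ultimately show ?case by simp
  qed simp
  have inj: "inj_on \<pi> {..<j}" using permutes_inj[OF \<pi>] by (rule inj_on_subset) simp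
  have "(\<Sum>i<j. i) \<le> \<Sum>(\<pi> ` {..<j})" using *[of "\<pi> ` {..<j}"] by (simp add: card_image[OF inj])
  also have "\<dots> = (\<Sum>i<j. \<pi> i)" by (simp add: sum.reindex[OF inj])
  finally have "int (\<Sum>i<j. i) \<le> int (\<Sum>i<j. \<pi> i)" by (rule of_nat_mono)
  then show ?thesis by (simp only: of_nat_sum)
qed

text \<open>
  Write the second character as a determinant. The partial sums of \<open>i \<mapsto> \<mu> i + \<pi> i - i\<close> are at least
  those of \<open>\<mu>\<close>, so at \<open>j\<close> they exceed those of \<open>\<nu>\<close> and no term contributes.
\<close>

lemma specht_orthogonal_not_dominated:
  assumes \<nu>: "is_partition \<nu>" and \<mu>: "is_partition \<mu>" and size: "sum_list \<mu> = sum_list \<nu>"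
    and j: "(\<Sum>i<j. part \<nu> i) < (\<Sum>i<j. part \<mu> i)"
  shows "char_inner (sum_list \<nu>) (rep_character (specht \<nu>)) (rep_character (specht \<mu>)) = 0"
proof -
  interpret \<nu>: tableau_shape \<nu> by unfold_locales fact
  interpret \<mu>: tableau_shape \<mu> by unfold_locales fact
  define l where "l = max j (max (length \<nu>) (length \<mu>))"
  have l: "j \<le> l" "length \<nu> \<le> l" "length \<mu> \<le> l" by (auto simp: l_def)
  have "char_inner (sum_list \<nu>) (rep_character (specht \<nu>)) (rep_character (specht \<mu>))
      = char_inner (sum_list \<nu>) (rep_character (specht \<nu>)) (jacobi_trudi (sum_list \<nu>) l (part \<mu>))"
    using \<mu>.specht_character_jacobi_trudi[OF l(3)] unfolding size by (intro char_inner_cong) auto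
  also have "\<dots> = 0"
    unfolding char_inner_jacobi_trudi
  proof (rule sum.neutral, rule ballI)
    fix \<pi> assume "\<pi> \<in> {\<pi>. \<pi> permutes {..<l}}"
    then have "(\<Sum>i<j. int i) \<le> (\<Sum>i<j. int (\<pi> i))" by (intro partial_sum_permutes_ge) blast
    moreover have "(\<Sum>i<j. int (part \<nu> i)) < (\<Sum>i<j. int (part \<mu> i))"
      using j by (simp flip: of_nat_sum)
    ultimately have "(\<Sum>i<j. int (part \<nu> i)) < (\<Sum>i<j. int (part \<mu> i) + int (\<pi> i) - int i)"
      by (simp add: sum.distrib sum_subtractf)
    from \<nu>.char_inner_specht_not_dominated[OF l(2,1) this]
    show "of_int (sign \<pi>) * char_inner (sum_list \<nu>) (rep_character (specht \<nu>))
        (colouring_character (sum_list \<nu>) l (\<lambda>i. int (part \<mu> i) + int (\<pi> i) - int i)) = 0" by simp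
  qed
  finally show ?thesis .
qed

lemma part_inject:
  assumes "is_partition \<nu>" "is_partition \<mu>" "part \<nu> = part \<mu>"
  shows "\<nu> = \<mu>"
proof -
  have len: "length \<nu> = (LEAST i. part \<nu> i = 0)" if "is_partition \<nu>" for \<nu>
    using that by (intro Least_equality[symmetric])
      (auto simp: is_partition_def part_def in_set_conv_nth split: if_splits intro: leI)
  have "length \<nu> = length \<mu>" using len assms by metis
  then show ?thesis
    using assms(3) by (intro nth_equalityI) (auto simp: part_def fun_eq_iff split: if_splits)
qed

text \<open>
  Two different partitions cannot both dominate each other.
\<close>

theorem specht_orthogonal:
  assumes \<nu>: "is_partition \<nu>" and \<mu>: "is_partition \<mu>" and size: "sum_list \<nu> = m" "sum_list \<mu> = m"
    and ne: "\<nu> \<noteq> \<mu>"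
  shows "char_inner m (rep_character (specht \<nu>)) (rep_character (specht \<mu>)) = 0"
proof -
  have "\<exists>j. (\<Sum>i<j. part \<nu> i) \<noteq> (\<Sum>i<j. part \<mu> i)"
  proof (rule ccontr)
    assume "\<not> ?thesis"
    then have eq: "(\<Sum>i<j. part \<nu> i) = (\<Sum>i<j. part \<mu> i)" for j by blast
    have "part \<nu> j = part \<mu> j" for j using eq[of j] eq[of "Suc j"] by simp
    then show False using part_inject[OF \<nu> \<mu>] ne by blast
  qed
  then obtain j where "(\<Sum>i<j. part \<nu> i) < (\<Sum>i<j. part \<mu> i) \<or> (\<Sum>i<j. part \<mu> i) < (\<Sum>i<j. part \<nu> i)"
    by (meson nat_neq_iff)
  then show ?thesis
    using specht_orthogonal_not_dominated[OF \<nu> \<mu>, of j] specht_orthogonal_not_dominated[OF \<mu> \<nu>, of j]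
      size char_inner_commute by metis
qed

section \<open>Polynomials in the cycle counts\<close>

abbreviation (input) "lookup \<equiv> Poly_Mapping.lookup"
abbreviation (input) "keys \<equiv> Poly_Mapping.keys"
abbreviation (input) "single \<equiv> Poly_Mapping.single"

definition monomial_value :: "(nat \<Rightarrow> rat) \<Rightarrow> monomial \<Rightarrow> rat" where
  "monomial_value x a = (\<Prod>i\<in>keys a. x i ^ lookup a i)"

definition poly_value :: "cycle_poly \<Rightarrow> (nat \<Rightarrow> rat) \<Rightarrow> rat" where
  "poly_value P x = (\<Sum>a\<in>keys P. lookup P a * monomial_value x a)"

definition cycle_counts :: "nat \<Rightarrow> (nat \<Rightarrow> nat) \<Rightarrow> nat \<Rightarrow> rat" where
  "cycle_counts m g i = of_nat (cycle_count m (i + 1) g)"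

lemma rho_eq_poly_value: "rho m P g = poly_value P (cycle_counts m g)"
  unfolding rho_def poly_value_def monomial_value_def cycle_counts_def ..

definition poly_scale :: "rat \<Rightarrow> cycle_poly \<Rightarrow> cycle_poly" where
  "poly_scale c P = Poly_Mapping.map ((*) c) P"

lemma lookup_poly_scale: "lookup (poly_scale c P) a = c * lookup P a"
  unfolding poly_scale_def by (simp add: Poly_Mapping.map.rep_eq when_def)

interpretation cycle_polys: vector_space poly_scale
  by unfold_locales (auto intro!: poly_mapping_eqI simp: lookup_poly_scale lookup_add algebra_simps)

lemma poly_value_superset:
  assumes "finite A" "keys P \<subseteq> A"
  shows "poly_value P x = (\<Sum>a\<in>A. lookup P a * monomial_value x a)"
  unfolding poly_value_def using assms by (intro sum.mono_neutral_left) (auto simp: in_keys_iff)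

lemma poly_value_add: "poly_value (P + Q) x = poly_value P x + poly_value Q x"
proof -
  let ?A = "keys P \<union> keys Q"
  have "keys (P + Q) \<subseteq> ?A" by (rule keys_add)
  then show ?thesis
    using poly_value_superset[of ?A] by (simp add: lookup_add distrib_right sum.distrib)
qed

lemma poly_value_0: "poly_value 0 x = 0"
  by (simp add: poly_value_def)

lemma poly_value_scale: "poly_value (poly_scale c P) x = c * poly_value P x"
proof -
  have "keys (poly_scale c P) \<subseteq> keys P"
    by (auto simp: in_keys_iff lookup_poly_scale)
  then show ?thesis
    by (subst poly_value_superset[of "keys P"])
       (auto simp: poly_value_def lookup_poly_scale sum_distrib_left mult.assoc)
qed

lemma poly_value_sum: "poly_value (\<Sum>i\<in>I. P i) x = (\<Sum>i\<in>I. poly_value (P i) x)"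
  by (induction I rule: infinite_finite_induct) (simp_all add: poly_value_0 poly_value_add)

lemma poly_value_diff: "poly_value (P - Q) x = poly_value P x - poly_value Q x"
  using poly_value_add[of "P - Q" Q x] by simp

lemma poly_value_single: "poly_value (single a c) x = c * monomial_value x a"
  by (simp add: poly_value_def)

definition weight_le :: "nat \<Rightarrow> cycle_poly \<Rightarrow> bool" where
  "weight_le d P \<longleftrightarrow> (\<forall>a\<in>keys P. weight a \<le> d)"

lemma weight_le_add: "weight_le d P \<Longrightarrow> weight_le d Q \<Longrightarrow> weight_le d (P + Q)"
  unfolding weight_le_def using keys_add[of P Q] by blast

lemma weight_le_scale: "weight_le d P \<Longrightarrow> weight_le d (poly_scale c P)"
  unfolding weight_le_def by (auto simp: in_keys_iff lookup_poly_scale)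

lemma weight_le_0: "weight_le d 0"
  unfolding weight_le_def by simp

lemma weight_le_sum: "(\<And>i. i \<in> I \<Longrightarrow> weight_le d (P i)) \<Longrightarrow> weight_le d (\<Sum>i\<in>I. P i)"
  by (induction I rule: infinite_finite_induct) (simp_all add: weight_le_0 weight_le_add)

lemma weight_superset:
  assumes "finite A" "keys a \<subseteq> A"
  shows "weight a = (\<Sum>i\<in>A. (i + 1) * lookup a i)"
  unfolding weight_def using assms by (intro sum.mono_neutral_left) (auto simp: in_keys_iff)

lemma weight_add: "weight (a + b) = weight a + weight b"
proof -
  let ?A = "keys a \<union> keys b"
  have "keys (a + b) \<subseteq> ?A" by (rule keys_add)
  then show ?thesis
    using weight_superset[of ?A] by (simp add: lookup_add distrib_left sum.distrib)
qed

lemma weight_single: "weight (single i k) = (i + 1) * k"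
  by (simp add: weight_def)

lemma monomial_value_superset:
  assumes "finite A" "keys a \<subseteq> A"
  shows "monomial_value x a = (\<Prod>i\<in>A. x i ^ lookup a i)"
  unfolding monomial_value_def using assms by (intro prod.mono_neutral_left) (auto simp: in_keys_iff)

lemma monomial_value_add: "monomial_value x (a + b) = monomial_value x a * monomial_value x b"
proof -
  let ?A = "keys a \<union> keys b"
  have "keys (a + b) \<subseteq> ?A" by (rule keys_add)
  then show ?thesis
    using monomial_value_superset[of ?A] by (simp add: lookup_add power_add prod.distrib)
qed

lemma monomial_value_single: "monomial_value x (single i (Suc 0)) = x i"
  by (simp add: monomial_value_def)

lemma monomial_value_0: "monomial_value x 0 = 1"
  by (simp add: monomial_value_def)

lemma monomial_induct [case_names zero step]:
  fixes a :: monomial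
  assumes "P 0" "\<And>a j. P a \<Longrightarrow> P (a + single j (Suc 0))"
  shows "P a"
proof (induction "weight a" arbitrary: a rule: less_induct)
  case less
  show ?case
  proof (cases "a = 0")
    case False
    then obtain j where j: "lookup a j \<noteq> 0" by (metis lookup_zero poly_mapping_eqI)
    define b where "b = a - single j (Suc 0)"
    have a: "a = b + single j (Suc 0)"
      using j by (intro poly_mapping_eqI) (auto simp: b_def lookup_add lookup_minus lookup_single when_def)
    have "weight b < weight a" by (simp add: a weight_add weight_single)
    then have "P b" by (rule less)
    then show ?thesis unfolding a by (rule assms(2))
  qed (simp add: assms(1))
qed

text \<open>
  The functions given by a polynomial of weighted degree at most \<open>d\<close>. Closure under substitutions is
  easier to obtain for functions than for the polynomials themselves.
\<close>

definition poly_fun :: "nat \<Rightarrow> ((nat \<Rightarrow> rat) \<Rightarrow> rat) \<Rightarrow> bool" where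
  "poly_fun d F \<longleftrightarrow> (\<exists>P. weight_le d P \<and> (\<forall>x. F x = poly_value P x))"

lemma poly_fun_mono: "poly_fun d F \<Longrightarrow> d \<le> d' \<Longrightarrow> poly_fun d' F"
  unfolding poly_fun_def weight_le_def by (meson order_trans)

lemma poly_fun_add: "poly_fun d F \<Longrightarrow> poly_fun d G \<Longrightarrow> poly_fun d (\<lambda>x. F x + G x)"
  unfolding poly_fun_def by (metis poly_value_add weight_le_add)

lemma poly_fun_scale: "poly_fun d F \<Longrightarrow> poly_fun d (\<lambda>x. c * F x)"
  unfolding poly_fun_def by (metis poly_value_scale weight_le_scale)

lemma poly_fun_0: "poly_fun d (\<lambda>_. 0)"
  unfolding poly_fun_def by (metis poly_value_0 weight_le_0)

lemma poly_fun_sum: "(\<And>i. i \<in> I \<Longrightarrow> poly_fun d (F i)) \<Longrightarrow> poly_fun d (\<lambda>x. \<Sum>i\<in>I. F i x)"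
  by (induction I rule: infinite_finite_induct) (simp_all add: poly_fun_0 poly_fun_add)

lemma poly_fun_monomial: "weight a \<le> d \<Longrightarrow> poly_fun d (\<lambda>x. monomial_value x a)"
  unfolding poly_fun_def weight_le_def
  by (intro exI[of _ "single a 1"]) (simp add: poly_value_single)

lemma poly_fun_1: "poly_fun d (\<lambda>_. 1)"
  using poly_fun_monomial[of 0 d] by (simp add: monomial_value_0 weight_def)

text \<open>
  An operator \<open>G\<close> on functions that is linear is controlled by its effect on monomials.
\<close>

lemma poly_fun_induct:
  assumes F: "poly_fun d F"
    and sum: "\<And>A c. (\<And>a. a \<in> A \<Longrightarrow> weight a \<le> d) \<Longrightarrow>
      poly_fun d' (\<lambda>x. \<Sum>a\<in>A. c a * G (\<lambda>x. monomial_value x a) x)"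
    and lin: "\<And>A c x. finite A \<Longrightarrow> G (\<lambda>x. \<Sum>a\<in>A. c a * monomial_value x a) x
      = (\<Sum>a\<in>A. c a * G (\<lambda>x. monomial_value x a) x)"
  shows "poly_fun d' (G F)"
proof -
  obtain P where P: "weight_le d P" "\<And>x. F x = poly_value P x" using F unfolding poly_fun_def by blast
  have "F = (\<lambda>x. \<Sum>a\<in>keys P. lookup P a * monomial_value x a)"
    using P(2) by (simp add: poly_value_def fun_eq_iff)
  then have "G F x = (\<Sum>a\<in>keys P. lookup P a * G (\<lambda>x. monomial_value x a) x)" for x
    using lin[of "keys P" "lookup P" x] by simp
  then have "G F = (\<lambda>x. \<Sum>a\<in>keys P. lookup P a * G (\<lambda>x. monomial_value x a) x)"
    by (rule ext)
  moreover have "poly_fun d' (\<lambda>x. \<Sum>a\<in>keys P. lookup P a * G (\<lambda>x. monomial_value x a) x)"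
    using P(1) by (intro sum) (simp add: weight_le_def)
  ultimately show ?thesis by simp
qed

lemma poly_fun_var_mult:
  assumes "poly_fun d F"
  shows "poly_fun (d + Suc i) (\<lambda>x. x i * F x)"
  using assms
proof (rule poly_fun_induct[where G = "\<lambda>F x. x i * F x"])
  fix A :: "monomial set" and c assume A: "\<And>a. a \<in> A \<Longrightarrow> weight a \<le> d"
  have "x i * monomial_value x a = monomial_value x (a + single i (Suc 0))" for x a
    by (simp add: monomial_value_add monomial_value_single)
  then show "poly_fun (d + Suc i) (\<lambda>x. \<Sum>a\<in>A. c a * (x i * monomial_value x a))"
    using A by (auto intro!: poly_fun_sum poly_fun_scale poly_fun_monomial simp: weight_add weight_single)
qed (simp add: sum_distrib_left mult.left_commute)

lemma poly_fun_shift_monomial: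
  "poly_fun (weight a) (\<lambda>x. monomial_value (x(i := x i - 1)) a)"
proof (induction a rule: monomial_induct)
  case zero
  then show ?case by (simp add: monomial_value_0 poly_fun_1)
next
  case (step a j)
  let ?F = "\<lambda>x. monomial_value (x(i := x i - 1)) a"
  have "poly_fun (weight a + Suc j) (\<lambda>x. x j * ?F x + (if j = i then - 1 else 0) * ?F x)"
    by (intro poly_fun_add poly_fun_var_mult poly_fun_scale step poly_fun_mono[OF step]) simp
  moreover have expand: "monomial_value (x(i := x i - 1)) (a + single j (Suc 0))
      = x j * ?F x + (if j = i then - 1 else 0) * ?F x" for x
    by (simp add: monomial_value_add monomial_value_single algebra_simps)
  moreover have "weight (a + single j (Suc 0)) = weight a + Suc j"
    by (simp add: weight_add weight_single)
  ultimately show ?case by (simp only: expand)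
qed

lemma poly_fun_shift:
  assumes "poly_fun d F"
  shows "poly_fun d (\<lambda>x. F (x(i := x i - 1)))"
  using assms
proof (rule poly_fun_induct[where G = "\<lambda>F x. F (x(i := x i - 1))"])
  fix A :: "monomial set" and c assume "\<And>a. a \<in> A \<Longrightarrow> weight a \<le> d"
  then show "poly_fun d (\<lambda>x. \<Sum>a\<in>A. c a * monomial_value (x(i := x i - 1)) a)"
    by (intro poly_fun_sum poly_fun_scale poly_fun_mono[OF poly_fun_shift_monomial])
qed simp

section \<open>Colourings of cycles\<close>

text \<open>
  The elements of \<open>C\<close> stand for cycles of length \<open>w\<close>. The colour \<open>0\<close> is left free: it takes all the
  points that the other colours leave.
\<close>

definition cycle_colourings :: "'c set \<Rightarrow> ('c \<Rightarrow> nat) \<Rightarrow> nat \<Rightarrow> (nat \<Rightarrow> nat) \<Rightarrow> ('c \<Rightarrow> nat) set" where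
  "cycle_colourings C w l \<beta> =
     {F \<in> C \<rightarrow>\<^sub>E {..<l}. \<forall>j\<in>{1..<l}. (\<Sum>c\<in>{c\<in>C. F c = j}. w c) = \<beta> j}"

definition length_counts :: "'c set \<Rightarrow> ('c \<Rightarrow> nat) \<Rightarrow> nat \<Rightarrow> rat" where
  "length_counts C w i = of_nat (card {c\<in>C. w c = Suc i})"

lemma finite_cycle_colourings: "finite C \<Longrightarrow> finite (cycle_colourings C w l \<beta>)"
  unfolding cycle_colourings_def by (rule rev_finite_subset[OF finite_PiE[of C "\<lambda>_. {..<l}"]]) auto

lemma card_cycle_colourings_zero:
  assumes C: "finite C" "\<And>c. c \<in> C \<Longrightarrow> 0 < w c" and \<beta>: "\<And>j. j \<in> {1..<l} \<Longrightarrow> \<beta> j = 0" and l: "0 < l"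
  shows "card (cycle_colourings C w l \<beta>) = 1"
proof -
  have "F = restrict (\<lambda>_. 0) C" if F: "F \<in> cycle_colourings C w l \<beta>" for F
  proof -
    have "F c = 0" if c: "c \<in> C" for c
    proof (rule ccontr)
      assume "F c \<noteq> 0"
      then have j: "F c \<in> {1..<l}" using F c by (auto simp: cycle_colourings_def)
      then have "(\<Sum>c'\<in>{c'\<in>C. F c' = F c}. w c') = 0"
        using F \<beta>[OF j] by (auto simp: cycle_colourings_def)
      then have "\<forall>c'\<in>{c'\<in>C. F c' = F c}. w c' = 0" using C(1) by (subst (asm) sum_eq_0_iff) auto
      then show False using C(2)[OF c] c by auto
    qed
    moreover have "F \<in> extensional C" using F by (simp add: cycle_colourings_def PiE_def)
    ultimately show ?thesis by (intro extensionalityI[of _ C]) auto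
  qed
  moreover have "restrict (\<lambda>_. 0) C \<in> cycle_colourings C w l \<beta>"
  proof -
    have "{c\<in>C. restrict (\<lambda>_. 0) C c = j} = {}" if "j \<in> {1..<l}" for j using that by auto
    then show ?thesis unfolding cycle_colourings_def using \<beta> l by simp
  qed
  ultimately have "cycle_colourings C w l \<beta> = {restrict (\<lambda>_. 0) C}" by blast
  then show ?thesis by simp
qed

lemma card_cycle_colourings_remove:
  assumes C: "finite C" and c: "c \<in> C" and j: "j \<in> {1..<l}"
  shows "card {F \<in> cycle_colourings C w l \<beta>. F c = j} =
    (if w c \<le> \<beta> j then card (cycle_colourings (C - {c}) w l (\<beta>(j := \<beta> j - w c))) else 0)"
proof (cases "w c \<le> \<beta> j")
  case True
  have sums: "(\<Sum>c'\<in>{c'\<in>C. F c' = i}. w c')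
      = (\<Sum>c'\<in>{c'\<in>C - {c}. F c' = i}. w c') + (if i = j then w c else 0)" if "F c = j" for F i
  proof -
    have "{c'\<in>C. F c' = i} = (if i = j then insert c {c'\<in>C - {c}. F c' = i} else {c'\<in>C - {c}. F c' = i})"
      using c that by auto
    then show ?thesis using C by simp
  qed
  have "bij_betw (\<lambda>F. restrict F (C - {c})) {F \<in> cycle_colourings C w l \<beta>. F c = j}
      (cycle_colourings (C - {c}) w l (\<beta>(j := \<beta> j - w c)))"
  proof (rule bij_betw_byWitness[of _ "\<lambda>F. F(c := j)"])
    show "\<forall>F\<in>{F \<in> cycle_colourings C w l \<beta>. F c = j}. (restrict F (C - {c}))(c := j) = F"
      by (auto simp: cycle_colourings_def fun_eq_iff PiE_def extensional_def)
    show "\<forall>F\<in>cycle_colourings (C - {c}) w l (\<beta>(j := \<beta> j - w c)). restrict (F(c := j)) (C - {c}) = F"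
      by (auto simp: cycle_colourings_def fun_eq_iff PiE_def extensional_def)
    show "(\<lambda>F. restrict F (C - {c})) ` {F \<in> cycle_colourings C w l \<beta>. F c = j}
        \<subseteq> cycle_colourings (C - {c}) w l (\<beta>(j := \<beta> j - w c))"
    proof (rule image_subsetI)
      fix F assume "F \<in> {F \<in> cycle_colourings C w l \<beta>. F c = j}"
      then have F: "F \<in> cycle_colourings C w l \<beta>" "F c = j" by auto
      have "{c'\<in>C - {c}. restrict F (C - {c}) c' = i} = {c'\<in>C - {c}. F c' = i}" for i by auto
      moreover have "(\<Sum>c'\<in>{c'\<in>C - {c}. F c' = i}. w c') = (\<beta>(j := \<beta> j - w c)) i" if "i \<in> {1..<l}" for i
        using sums[of F i] F that by (auto simp: cycle_colourings_def)
      ultimately show "restrict F (C - {c}) \<in> cycle_colourings (C - {c}) w l (\<beta>(j := \<beta> j - w c))"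
        using F(1) unfolding cycle_colourings_def mem_Collect_eq by (auto simp: PiE_def)
    qed
    show "(\<lambda>F. F(c := j)) ` cycle_colourings (C - {c}) w l (\<beta>(j := \<beta> j - w c))
        \<subseteq> {F \<in> cycle_colourings C w l \<beta>. F c = j}"
    proof (rule image_subsetI)
      fix F assume F: "F \<in> cycle_colourings (C - {c}) w l (\<beta>(j := \<beta> j - w c))"
      have "{c'\<in>C - {c}. (F(c := j)) c' = i} = {c'\<in>C - {c}. F c' = i}" for i by auto
      then have "(\<Sum>c'\<in>{c'\<in>C. (F(c := j)) c' = i}. w c') = \<beta> i" if "i \<in> {1..<l}" for i
        using sums[of "F(c := j)" i] F that True by (auto simp: cycle_colourings_def)
      moreover have "F(c := j) \<in> C \<rightarrow>\<^sub>E {..<l}"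
        using F c j by (auto simp: cycle_colourings_def PiE_def extensional_def)
      ultimately show "F(c := j) \<in> {F \<in> cycle_colourings C w l \<beta>. F c = j}"
        unfolding cycle_colourings_def by simp
    qed
  qed
  then show ?thesis using True by (simp add: bij_betw_same_card)
next
  case False
  have "F \<notin> cycle_colourings C w l \<beta>" if "F c = j" for F
  proof
    assume "F \<in> cycle_colourings C w l \<beta>"
    then have "(\<Sum>c'\<in>{c'\<in>C. F c' = j}. w c') = \<beta> j" using j by (simp add: cycle_colourings_def)
    moreover have "w c \<le> (\<Sum>c'\<in>{c'\<in>C. F c' = j}. w c')"
      using C c that by (intro member_le_sum) auto
    ultimately show False using False by simp
  qed
  then have none: "{F \<in> cycle_colourings C w l \<beta>. F c = j} = {}" by blast
  show ?thesis unfolding none using False by simp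
qed

lemma length_counts_remove:
  assumes "finite C" "c \<in> C" "w c = Suc i"
  shows "length_counts (C - {c}) w = (length_counts C w)(i := length_counts C w i - 1)"
proof
  fix k
  have "{c'\<in>C - {c}. w c' = Suc k} = (if k = i then {c'\<in>C. w c' = Suc k} - {c} else {c'\<in>C. w c' = Suc k})"
    using assms by auto
  moreover have "0 < card {c'\<in>C. w c' = Suc i}" using assms by (auto simp: card_gt_0_iff)
  ultimately show "length_counts (C - {c}) w k = ((length_counts C w)(i := length_counts C w i - 1)) k"
    using assms by (simp add: length_counts_def of_nat_diff)
qed

text \<open>
  Counting a colouring once for every point of colour \<open>j\<close> and removing the cycle of that point
  leads to colourings with a smaller content. The number of cycles of the removed length
  contributes the same weight that the content loses.
\<close>

lemma card_cycle_colourings_recursion: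
  assumes C: "finite C" "\<And>c. c \<in> C \<Longrightarrow> 0 < w c" and j: "j \<in> {1..<l}"
  shows "rat_of_nat (\<beta> j * card (cycle_colourings C w l \<beta>)) =
    (\<Sum>i<\<beta> j. \<Sum>c\<in>{c\<in>C. w c = Suc i}.
      of_nat (Suc i * card (cycle_colourings (C - {c}) w l (\<beta>(j := \<beta> j - Suc i)))))"
proof -
  let ?X = "cycle_colourings C w l \<beta>"
  let ?N = "\<lambda>c. card (cycle_colourings (C - {c}) w l (\<beta>(j := \<beta> j - w c)))"
  note finX = finite_cycle_colourings[OF C(1), of w l \<beta>]
  have "\<beta> j * card ?X = (\<Sum>F\<in>?X. \<Sum>c\<in>{c\<in>C. F c = j}. w c)"
    using j by (simp add: cycle_colourings_def)
  also have "\<dots> = (\<Sum>F\<in>?X. \<Sum>c\<in>C. if F c = j then w c else 0)"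
    by (simp only: sum.inter_filter[OF C(1)])
  also have "\<dots> = (\<Sum>c\<in>C. \<Sum>F\<in>?X. if F c = j then w c else 0)" by (rule sum.swap)
  also have "\<dots> = (\<Sum>c\<in>C. w c * card {F\<in>?X. F c = j})"
    by (simp add: sum.inter_filter[OF finX, symmetric] mult.commute)
  also have "\<dots> = (\<Sum>c\<in>C. if w c \<le> \<beta> j then w c * ?N c else 0)"
    by (intro sum.cong refl) (simp add: card_cycle_colourings_remove[OF C(1) _ j])
  also have "\<dots> = (\<Sum>c\<in>{c\<in>C. w c \<le> \<beta> j}. w c * ?N c)"
    by (rule sum.inter_filter[OF C(1), symmetric])
  also have "\<dots> = (\<Sum>i<\<beta> j. \<Sum>c\<in>{c\<in>{c\<in>C. w c \<le> \<beta> j}. w c - 1 = i}. w c * ?N c)"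
  proof (rule sum.group[symmetric])
    show "(\<lambda>c. w c - 1) ` {c\<in>C. w c \<le> \<beta> j} \<subseteq> {..<\<beta> j}" using C(2) by fastforce
  qed (use C(1) in auto)
  also have "\<dots> = (\<Sum>i<\<beta> j. \<Sum>c\<in>{c\<in>C. w c = Suc i}. Suc i * card (cycle_colourings (C - {c}) w l (\<beta>(j := \<beta> j - Suc i))))"
  proof (rule sum.cong[OF refl])
    fix i assume "i \<in> {..<\<beta> j}"
    then have "{c\<in>{c\<in>C. w c \<le> \<beta> j}. w c - 1 = i} = {c\<in>C. w c = Suc i}"
      using C(2) by force
    then show "(\<Sum>c\<in>{c\<in>{c\<in>C. w c \<le> \<beta> j}. w c - 1 = i}. w c * ?N c)
        = (\<Sum>c\<in>{c\<in>C. w c = Suc i}. Suc i * card (cycle_colourings (C - {c}) w l (\<beta>(j := \<beta> j - Suc i))))"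
      by simp
  qed
  finally have "rat_of_nat (\<beta> j * card ?X) = of_nat (\<Sum>i<\<beta> j. \<Sum>c\<in>{c\<in>C. w c = Suc i}.
      Suc i * card (cycle_colourings (C - {c}) w l (\<beta>(j := \<beta> j - Suc i))))" by (rule arg_cong)
  then show ?thesis unfolding of_nat_sum .
qed

text \<open>
  Induction on the number of points with a nonzero colour, by the recursion above. Removing a cycle
  of length \<open>i + 1\<close> lowers the argument \<open>x i\<close> by one, which does not affect the weighted degree, and
  the factor \<open>x i\<close> restores the weight \<open>i + 1\<close>.
\<close>

theorem cycle_colourings_polynomial:
  assumes l: "0 < l"
  shows "\<exists>Q. poly_fun (\<Sum>j\<in>{1..<l}. \<beta> j) Q \<and> (\<forall>(C :: 'c set) w. finite C \<longrightarrow> (\<forall>c\<in>C. 0 < w c) \<longrightarrow>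
    of_nat (card (cycle_colourings C w l \<beta>)) = Q (length_counts C w))"
proof (induction "\<Sum>j\<in>{1..<l}. \<beta> j" arbitrary: \<beta> rule: less_induct)
  case less
  show ?case
  proof (cases "\<forall>j\<in>{1..<l}. \<beta> j = 0")
    case True
    have "rat_of_nat (card (cycle_colourings C w l \<beta>)) = 1" if "finite C" "\<forall>c\<in>C. 0 < w c" for C :: "'c set" and w
      using card_cycle_colourings_zero[OF that(1) _ _ l, of w \<beta>] that(2) True by simp
    then show ?thesis using poly_fun_1 by blast
  next
    case False
    then obtain j where j: "j \<in> {1..<l}" "0 < \<beta> j" by auto
    define \<beta>' where "\<beta>' i = \<beta>(j := \<beta> j - Suc i)" for i
    have total: "(\<Sum>k\<in>{1..<l}. \<beta>' i k) + Suc i = (\<Sum>k\<in>{1..<l}. \<beta> k)" if "i < \<beta> j" for i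
    proof -
      have "(\<Sum>k\<in>{1..<l}. f k) = f j + (\<Sum>k\<in>{1..<l} - {j}. f k)" for f :: "nat \<Rightarrow> nat"
        using j(1) by (intro sum.remove) auto
      moreover have "(\<Sum>k\<in>{1..<l} - {j}. \<beta>' i k) = (\<Sum>k\<in>{1..<l} - {j}. \<beta> k)"
        by (intro sum.cong) (auto simp: \<beta>'_def)
      moreover have "\<beta>' i j + Suc i = \<beta> j" using that by (simp add: \<beta>'_def)
      ultimately show ?thesis by (metis add.assoc add.commute)
    qed
    have "\<forall>i. \<exists>Q. i < \<beta> j \<longrightarrow> poly_fun (\<Sum>k\<in>{1..<l}. \<beta>' i k) Q \<and>
        (\<forall>(C :: 'c set) w. finite C \<longrightarrow> (\<forall>c\<in>C. 0 < w c) \<longrightarrow>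
          of_nat (card (cycle_colourings C w l (\<beta>' i))) = Q (length_counts C w))"
      using less[of "\<beta>' i" for i] total by (metis less_add_Suc1 add.commute add_Suc_right)
    then obtain Q where Q: "\<And>i. i < \<beta> j \<Longrightarrow> poly_fun (\<Sum>k\<in>{1..<l}. \<beta>' i k) (Q i)"
      and Q_eq: "\<And>i (C :: 'c set) w. i < \<beta> j \<Longrightarrow> finite C \<Longrightarrow> (\<forall>c\<in>C. 0 < w c) \<Longrightarrow>
          of_nat (card (cycle_colourings C w l (\<beta>' i))) = Q i (length_counts C w)" by metis
    define R where "R x = (1 / of_nat (\<beta> j)) * (\<Sum>i<\<beta> j. of_nat (Suc i) * (x i * Q i (x(i := x i - 1))))"
      for x :: "nat \<Rightarrow> rat"
    have "poly_fun (\<Sum>k\<in>{1..<l}. \<beta> k) (\<lambda>x. x i * Q i (x(i := x i - 1)))" if "i < \<beta> j" for i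
      using poly_fun_var_mult[OF poly_fun_shift[OF Q[OF that], of i], of i] unfolding total[OF that] .
    then have "poly_fun (\<Sum>k\<in>{1..<l}. \<beta> k) R"
      unfolding R_def by (intro poly_fun_scale poly_fun_sum) auto
    moreover have "of_nat (card (cycle_colourings C w l \<beta>)) = R (length_counts C w)"
      if C: "finite C" "\<forall>c\<in>C. 0 < w c" for C :: "'c set" and w
    proof -
      let ?x = "length_counts C w"
      have "of_nat (\<beta> j) * rat_of_nat (card (cycle_colourings C w l \<beta>))
          = (\<Sum>i<\<beta> j. \<Sum>c\<in>{c\<in>C. w c = Suc i}. of_nat (Suc i * card (cycle_colourings (C - {c}) w l (\<beta>' i))))"
        using card_cycle_colourings_recursion[OF C(1) _ j(1), of w \<beta>] C(2) by (simp add: \<beta>'_def)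
      also have "\<dots> = (\<Sum>i<\<beta> j. of_nat (Suc i) * (?x i * Q i (?x(i := ?x i - 1))))"
      proof (rule sum.cong[OF refl])
        fix i assume i: "i \<in> {..<\<beta> j}"
        have "(\<Sum>c\<in>{c\<in>C. w c = Suc i}. rat_of_nat (Suc i * card (cycle_colourings (C - {c}) w l (\<beta>' i))))
            = (\<Sum>c\<in>{c\<in>C. w c = Suc i}. of_nat (Suc i) * Q i (?x(i := ?x i - 1)))"
        proof (rule sum.cong[OF refl])
          fix c assume "c \<in> {c\<in>C. w c = Suc i}"
          then show "rat_of_nat (Suc i * card (cycle_colourings (C - {c}) w l (\<beta>' i)))
              = of_nat (Suc i) * Q i (?x(i := ?x i - 1))"
            using Q_eq[of i "C - {c}" w] i C length_counts_remove[OF C(1), of c w i]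
            by (simp only: of_nat_mult) auto
        qed
        then show "(\<Sum>c\<in>{c\<in>C. w c = Suc i}. rat_of_nat (Suc i * card (cycle_colourings (C - {c}) w l (\<beta>' i))))
            = of_nat (Suc i) * (?x i * Q i (?x(i := ?x i - 1)))"
          by (simp add: length_counts_def)
      qed
      finally show ?thesis using j(2) by (simp add: R_def field_simps)
    qed
    ultimately show ?thesis by blast
  qed
qed

lemma orbit_permutes:
  fixes g :: "nat \<Rightarrow> nat"
  assumes g: "g permutes {1..m}"
  shows "k \<in> orbit g k" "k \<in> {1..m} \<Longrightarrow> orbit g k \<subseteq> {1..m}" "k' \<in> orbit g k \<Longrightarrow> orbit g k' = orbit g k"
proof -
  have perm: "permutation g" using permutes_imp_permutation[OF finite_atLeastAtMost g] .
  show "k \<in> orbit g k" by (rule permutation_self_in_orbit[OF perm])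
  show "k \<in> {1..m} \<Longrightarrow> orbit g k \<subseteq> {1..m}" by (rule permutes_orbit_subset[OF g])
  show "k' \<in> orbit g k \<Longrightarrow> orbit g k' = orbit g k"
    by (rule orbit_cyclic_eq3[OF cyclic_on_orbit'[OF perm]])
qed

lemma constant_on_orbit:
  fixes g :: "nat \<Rightarrow> nat"
  assumes g: "g permutes {1..m}" and f: "\<forall>k\<in>{1..m}. f (g k) = f k" and k: "k \<in> {1..m}"
    and k': "k' \<in> orbit g k"
  shows "f k' = f k"
  using k'
proof (induction rule: orbit.induct)
  case base
  show ?case using f k by blast
next
  case (step y)
  then have "y \<in> {1..m}" using orbit_permutes(2)[OF g k] by blast
  then show ?case using f step by auto
qed

lemma card_orbit_colours:
  fixes F :: "nat set \<Rightarrow> 'j" and g :: "nat \<Rightarrow> nat"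
  assumes g: "g permutes {1..m}"
  shows "card {k\<in>{1..m}. F (orbit g k) = j} = (\<Sum>U\<in>{U\<in>orbit g ` {1..m}. F U = j}. card U)"
proof -
  let ?C = "orbit g ` {1..m}"
  have "card {k\<in>{1..m}. F (orbit g k) = j}
      = (\<Sum>U\<in>{U\<in>?C. F U = j}. card {k\<in>{k\<in>{1..m}. F (orbit g k) = j}. orbit g k = U})"
    by (rule card_eq_sum_fibres) auto
  also have "\<dots> = (\<Sum>U\<in>{U\<in>?C. F U = j}. card U)"
  proof (rule sum.cong[OF refl])
    fix U assume "U \<in> {U\<in>?C. F U = j}"
    then obtain k where k: "k \<in> {1..m}" "U = orbit g k" and F: "F U = j" by blast
    have "{k\<in>{k\<in>{1..m}. F (orbit g k) = j}. orbit g k = U} = U"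
    proof (intro equalityI subsetI)
      fix x assume "x \<in> {k\<in>{k\<in>{1..m}. F (orbit g k) = j}. orbit g k = U}"
      then show "x \<in> U" using orbit_permutes(1)[OF g, of x] by blast
    next
      fix x assume "x \<in> U"
      then have "orbit g x = U" "x \<in> {1..m}"
        using k orbit_permutes(2)[OF g k(1)] orbit_permutes(3)[OF g, of x k] by blast+
      then show "x \<in> {k\<in>{k\<in>{1..m}. F (orbit g k) = j}. orbit g k = U}" using F by blast
    qed
    then show "card {k\<in>{k\<in>{1..m}. F (orbit g k) = j}. orbit g k = U} = card U" by simp
  qed
  finally show ?thesis .
qed

text \<open>
  A colouring is fixed by \<open>g\<close> exactly if it is constant on the cycles of \<open>g\<close>. Once the other colours
  have the right multiplicities, so has the colour \<open>0\<close>, as the total is \<open>m\<close>.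
\<close>

lemma colouring_character_cycles:
  assumes g: "g permutes {1..m}" and l: "0 < l" and \<alpha>: "(\<Sum>j<l. \<alpha> j) = int m"
    and nonneg: "\<And>j. j \<in> {1..<l} \<Longrightarrow> 0 \<le> \<alpha> j"
  shows "colouring_character m l \<alpha> g
    = of_nat (card (cycle_colourings (orbit g ` {1..m}) card l (\<lambda>j. nat (\<alpha> j))))"
proof -
  let ?C = "orbit g ` {1..m}"
  let ?X = "cycle_colourings ?C card l (\<lambda>j. nat (\<alpha> j))"
  let ?Y = "{f \<in> colourings {1..m} {..<l} \<alpha>. \<forall>k\<in>{1..m}. f (g k) = f k}"
  define \<Phi> where "\<Phi> F = restrict (\<lambda>k. F (orbit g k)) {1..m}" for F :: "nat set \<Rightarrow> nat"
  have gk: "g k \<in> {1..m}" "orbit g (g k) = orbit g k" if "k \<in> {1..m}" for k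
    using permutes_in_interval[OF g that] orbit_permutes(3)[OF g orbit.base] by auto
  have fibre: "{k\<in>{1..m}. \<Phi> F k = j} = {k\<in>{1..m}. F (orbit g k) = j}" for F j
    by (auto simp: \<Phi>_def)
  have in_iff: "\<Phi> F \<in> ?Y \<longleftrightarrow> F \<in> ?X" if F: "F \<in> ?C \<rightarrow>\<^sub>E {..<l}" for F
  proof -
    have ext: "\<Phi> F \<in> {1..m} \<rightarrow>\<^sub>E {..<l}" using F by (auto simp: \<Phi>_def)
    have fixed: "\<forall>k\<in>{1..m}. \<Phi> F (g k) = \<Phi> F k" using gk by (simp add: \<Phi>_def)
    let ?n = "\<lambda>j. card {k\<in>{1..m}. F (orbit g k) = j}"
    have total: "(\<Sum>j<l. int (?n j)) = int m"
    proof -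
      have "card {1..m} = (\<Sum>j<l. card {k\<in>{1..m}. F (orbit g k) = j})"
        using F by (intro card_eq_sum_fibres) auto
      moreover have "card {1..m} = m" by simp
      ultimately show ?thesis unfolding of_nat_sum[symmetric] by argo
    qed
    have split: "(\<Sum>j<l. h j) = h 0 + (\<Sum>j\<in>{1..<l}. h j)" for h :: "nat \<Rightarrow> int"
      using l by (simp add: lessThan_atLeast0 sum.atLeast_Suc_lessThan One_nat_def)
    have "(\<forall>j\<in>{..<l}. int (?n j) = \<alpha> j) \<longleftrightarrow> (\<forall>j\<in>{1..<l}. int (?n j) = \<alpha> j)"
    proof
      assume *: "\<forall>j\<in>{1..<l}. int (?n j) = \<alpha> j"
      then have "(\<Sum>j\<in>{1..<l}. int (?n j)) = (\<Sum>j\<in>{1..<l}. \<alpha> j)" by (intro sum.cong) auto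
      then have "int (?n 0) = \<alpha> 0" using total \<alpha> split[of \<alpha>] split[of "\<lambda>j. int (?n j)"] by simp
      then show "\<forall>j\<in>{..<l}. int (?n j) = \<alpha> j"
        using * by (metis atLeastLessThan_iff lessThan_iff less_one linorder_not_less)
    qed auto
    also have "\<dots> \<longleftrightarrow> (\<forall>j\<in>{1..<l}. ?n j = nat (\<alpha> j))"
    proof (rule ball_cong[OF refl])
      fix j assume "j \<in> {1..<l}"
      then have "0 \<le> \<alpha> j" by (rule nonneg)
      then show "int (?n j) = \<alpha> j \<longleftrightarrow> ?n j = nat (\<alpha> j)" by arith
    qed
    finally show ?thesis
      using ext fixed F unfolding colourings_def cycle_colourings_def mem_Collect_eq fibre
        card_orbit_colours[OF g, symmetric] by blast
  qed
  have "bij_betw \<Phi> ?X ?Y"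
    unfolding bij_betw_def
  proof (intro conjI inj_onI equalityI subsetI)
    fix F F' assume FF: "F \<in> ?X" "F' \<in> ?X" "\<Phi> F = \<Phi> F'"
    have "F (orbit g k) = F' (orbit g k)" if "k \<in> {1..m}" for k
      using fun_cong[OF FF(3), of k] that by (simp add: \<Phi>_def)
    then show "F = F'"
      using FF(1,2) by (intro extensionalityI[of _ ?C]) (auto simp: cycle_colourings_def PiE_def)
  next
    fix f assume "f \<in> \<Phi> ` ?X"
    then obtain F where F: "F \<in> ?X" "f = \<Phi> F" by blast
    then have "F \<in> ?C \<rightarrow>\<^sub>E {..<l}" by (simp add: cycle_colourings_def)
    then show "f \<in> ?Y" using in_iff F by blast
  next
    fix f assume f: "f \<in> ?Y"
    then have f_PiE: "f \<in> {1..m} \<rightarrow>\<^sub>E {..<l}" and f_fixed: "\<forall>k\<in>{1..m}. f (g k) = f k"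
      by (simp_all add: colourings_def)
    define F where "F = restrict (\<lambda>U. f (SOME k. k \<in> U)) ?C"
    have F_orbit: "F (orbit g k) = f k" if k: "k \<in> {1..m}" for k
    proof -
      have "(SOME k'. k' \<in> orbit g k) \<in> orbit g k"
        using orbit_permutes(1)[OF g] by (rule someI)
      then show ?thesis using constant_on_orbit[OF g f_fixed k] k by (simp add: F_def)
    qed
    have "\<Phi> F = f"
      using f_PiE F_orbit by (intro extensionalityI[of _ "{1..m}"]) (auto simp: \<Phi>_def PiE_def)
    moreover have "F \<in> ?C \<rightarrow>\<^sub>E {..<l}"
    proof (rule PiE_I)
      fix U assume "U \<in> ?C"
      then obtain k where "k \<in> {1..m}" "U = orbit g k" by blast
      then show "F U \<in> {..<l}" using F_orbit[of k] PiE_mem[OF f_PiE] by simp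
    qed (simp add: F_def)
    ultimately show "f \<in> \<Phi> ` ?X" using in_iff[of F] f by force
  qed
  from bij_betw_same_card[OF this] show ?thesis by (simp add: colouring_character_def)
qed

lemma cycle_counts_eq: "cycle_counts m g = length_counts (orbit g ` {1..m}) card"
  by (simp add: cycle_counts_def length_counts_def cycle_count_def fun_eq_iff Suc_eq_plus1)

text \<open>
  The polynomial depends on the multiplicities of the nonzero colours only, not on \<open>m\<close>.
\<close>

theorem colouring_character_polynomial:
  assumes l: "0 < l" and k: "(\<Sum>j\<in>{1..<l}. \<beta> j) \<le> int k"
  shows "\<exists>P. weight_le k P \<and> (\<forall>m g \<alpha>. g permutes {1..m} \<longrightarrow> (\<forall>j\<in>{1..<l}. \<alpha> j = \<beta> j) \<longrightarrow>
    (\<Sum>j<l. \<alpha> j) = int m \<longrightarrow> colouring_character m l \<alpha> g = rho m P g)"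
proof (cases "\<forall>j\<in>{1..<l}. 0 \<le> \<beta> j")
  case True
  obtain Q where Q: "poly_fun (\<Sum>j\<in>{1..<l}. nat (\<beta> j)) Q"
    and Q_eq: "\<And>(C :: nat set set) w. finite C \<Longrightarrow> \<forall>c\<in>C. 0 < w c \<Longrightarrow>
      of_nat (card (cycle_colourings C w l (\<lambda>j. nat (\<beta> j)))) = Q (length_counts C w)"
    using cycle_colourings_polynomial[OF l, of "\<lambda>j. nat (\<beta> j)"] by metis
  have "int (\<Sum>j\<in>{1..<l}. nat (\<beta> j)) = (\<Sum>j\<in>{1..<l}. \<beta> j)" using True by simp
  then have "(\<Sum>j\<in>{1..<l}. nat (\<beta> j)) \<le> k" using k by linarith
  from poly_fun_mono[OF Q this] obtain P where P: "weight_le k P" "\<And>x. Q x = poly_value P x"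
    unfolding poly_fun_def by blast
  have "colouring_character m l \<alpha> g = rho m P g"
    if g: "g permutes {1..m}" and \<alpha>: "\<forall>j\<in>{1..<l}. \<alpha> j = \<beta> j" and m: "(\<Sum>j<l. \<alpha> j) = int m" for m g \<alpha>
  proof -
    have "0 < card U" if "U \<in> orbit g ` {1..m}" for U
      using that orbit_permutes(1,2)[OF g] by (auto simp: card_gt_0_iff dest: finite_subset[OF _ finite_atLeastAtMost])
    then have "Q (length_counts (orbit g ` {1..m}) card)
        = of_nat (card (cycle_colourings (orbit g ` {1..m}) card l (\<lambda>j. nat (\<beta> j))))"
      by (intro Q_eq[symmetric]) auto
    also have "cycle_colourings (orbit g ` {1..m}) card l (\<lambda>j. nat (\<beta> j))
        = cycle_colourings (orbit g ` {1..m}) card l (\<lambda>j. nat (\<alpha> j))"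
      using \<alpha> by (simp add: cycle_colourings_def)
    also have "of_nat (card \<dots>) = colouring_character m l \<alpha> g"
      using \<alpha> True by (intro colouring_character_cycles[symmetric] g l m) simp
    finally show ?thesis by (simp add: rho_eq_poly_value cycle_counts_eq P(2))
  qed
  with P(1) show ?thesis by blast
next
  case False
  then obtain j where j: "j \<in> {1..<l}" "\<beta> j < 0" by (auto simp: not_le)
  have "colouring_character m l \<alpha> g = rho m 0 g" if \<alpha>: "\<forall>j\<in>{1..<l}. \<alpha> j = \<beta> j" for m g \<alpha>
  proof -
    have "f \<notin> colourings {1..m} {..<l} \<alpha>" for f
    proof
      assume "f \<in> colourings {1..m} {..<l} \<alpha>"
      then have "int (card {k\<in>{1..m}. f k = j}) = \<alpha> j" using j by (simp add: colourings_def)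
      then show False using j \<alpha> by simp
    qed
    then have "colourings {1..m} {..<l} \<alpha> = {}" by blast
    then show ?thesis by (simp add: colouring_character_def rho_eq_poly_value poly_value_0)
  qed
  then show ?thesis using weight_le_0 by blast
qed

section \<open>Polynomial characters of padded Specht modules\<close>

lemma padded_eq:
  assumes l: "is_partition l" and m: "sum_list l + first_part l \<le> m"
  shows "padded l m = (if m = 0 then [] else (m - sum_list l) # l)" and "m = 0 \<Longrightarrow> l = []"
    and "is_partition (padded l m)" and "sum_list (padded l m) = m" and "tl (padded l m) = l"
proof -
  have filter_l: "filter (\<lambda>k. 0 < k) l = l"
    using l by (auto simp: is_partition_def filter_id_conv intro: gr0I)
  have pos: "0 < first_part l" if "l \<noteq> []"
    using that l by (auto simp: is_partition_def first_part_def neq_Nil_conv)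
  show nil: "m = 0 \<Longrightarrow> l = []" using m pos by auto
  have "m \<noteq> 0 \<Longrightarrow> sum_list l < m" using m pos by (cases "l = []") auto
  then show eq: "padded l m = (if m = 0 then [] else (m - sum_list l) # l)"
    using nil by (auto simp: padded_def filter_l)
  have "k \<le> m - sum_list l" if "k \<in> set l" for k
  proof -
    have "k \<le> first_part l"
      using l that by (cases l) (auto simp: is_partition_def first_part_def)
    then show ?thesis using m by simp
  qed
  then show "is_partition (padded l m)"
    using l m \<open>m \<noteq> 0 \<Longrightarrow> sum_list l < m\<close> unfolding eq by (auto simp: is_partition_def)
  show "sum_list (padded l m) = m" using m unfolding eq by auto
  show "tl (padded l m) = l" using nil unfolding eq by auto
qed

lemma permutes_sum_tail:
  assumes "\<pi> permutes {..<Suc n}"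
  shows "(\<Sum>j\<in>{1..<Suc n}. int (\<pi> j) - int j) = - int (\<pi> 0)"
proof -
  have "(\<Sum>j<Suc n. int (\<pi> j)) = (\<Sum>j<Suc n. int j)"
    using sum.permute[OF assms, of int] by (simp only: comp_def)
  then have "(\<Sum>j<Suc n. int (\<pi> j) - int j) = 0"
    by (simp only: sum_subtractf diff_self)
  moreover have "(\<Sum>j<Suc n. h j) = h 0 + (\<Sum>j\<in>{1..<Suc n}. h j)" for h :: "nat \<Rightarrow> int"
    by (simp only: lessThan_atLeast0 sum.atLeast_Suc_lessThan[OF zero_less_Suc] One_nat_def)
  ultimately have "int (\<pi> 0) - int 0 + (\<Sum>j\<in>{1..<Suc n}. int (\<pi> j) - int j) = 0"
    by (simp only:)
  then show ?thesis by linarith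
qed

text \<open>
  In the determinant for \<open>\<lambda>[m]\<close> the multiplicities of the colours \<open>1, \<dots>, \<ell>\<close> do not involve \<open>m\<close>, and their
  sum is \<open>|\<lambda>| - \<pi> 0\<close>. The bound on \<open>m\<close> is the one that makes
  \<open>\<lambda>[m]\<close> a partition.
\<close>

theorem specht_character_polynomial:
  assumes l: "is_partition l"
  shows "\<exists>P. weight_le (sum_list l) P \<and> (\<forall>m g. sum_list l + first_part l \<le> m \<longrightarrow> g permutes {1..m} \<longrightarrow>
    rep_character (specht (padded l m)) g = rho m P g)"
proof -
  let ?n = "length l"
  let ?\<Pi> = "{\<pi>. \<pi> permutes {..<Suc ?n}}"
  define \<beta> where "\<beta> \<pi> j = int (l ! (j - 1)) + int (\<pi> j) - int j" for \<pi> :: "nat \<Rightarrow> nat" and j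
  have sum_l: "(\<Sum>j\<in>{1..<Suc ?n}. int (l ! (j - 1))) = int (sum_list l)"
    by (simp only: One_nat_def sum.shift_bounds_Suc_ivl)
       (simp add: sum_list_sum_nth One_nat_def)
  have sum_\<beta>: "(\<Sum>j\<in>{1..<Suc ?n}. \<beta> \<pi> j) = int (sum_list l) - int (\<pi> 0)" if "\<pi> permutes {..<Suc ?n}" for \<pi>
  proof -
    have "(\<Sum>j\<in>{1..<Suc ?n}. \<beta> \<pi> j)
        = (\<Sum>j\<in>{1..<Suc ?n}. int (l ! (j - 1))) + (\<Sum>j\<in>{1..<Suc ?n}. int (\<pi> j) - int j)"
      unfolding \<beta>_def by (simp only: sum.distrib[symmetric] add_diff_eq)
    then show ?thesis unfolding sum_l permutes_sum_tail[OF that] by simp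
  qed
  have "\<forall>\<pi>. \<exists>P. \<pi> permutes {..<Suc ?n} \<longrightarrow> weight_le (sum_list l) P \<and>
      (\<forall>m g \<alpha>. g permutes {1..m} \<longrightarrow> (\<forall>j\<in>{1..<Suc ?n}. \<alpha> j = \<beta> \<pi> j) \<longrightarrow>
        (\<Sum>j<Suc ?n. \<alpha> j) = int m \<longrightarrow> colouring_character m (Suc ?n) \<alpha> g = rho m P g)"
  proof
    fix \<pi>
    show "\<exists>P. \<pi> permutes {..<Suc ?n} \<longrightarrow> weight_le (sum_list l) P \<and>
      (\<forall>m g \<alpha>. g permutes {1..m} \<longrightarrow> (\<forall>j\<in>{1..<Suc ?n}. \<alpha> j = \<beta> \<pi> j) \<longrightarrow>
        (\<Sum>j<Suc ?n. \<alpha> j) = int m \<longrightarrow> colouring_character m (Suc ?n) \<alpha> g = rho m P g)"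
    proof (cases "\<pi> permutes {..<Suc ?n}")
      case True
      then have "(\<Sum>j\<in>{1..<Suc ?n}. \<beta> \<pi> j) \<le> int (sum_list l)" using sum_\<beta> by simp
      from colouring_character_polynomial[OF zero_less_Suc this] show ?thesis by blast
    qed blast
  qed
  then obtain P where P: "\<And>\<pi>. \<pi> permutes {..<Suc ?n} \<Longrightarrow> weight_le (sum_list l) (P \<pi>)"
    and P_eq: "\<And>\<pi> m g \<alpha>. \<pi> permutes {..<Suc ?n} \<Longrightarrow> g permutes {1..m} \<Longrightarrow>
      \<forall>j\<in>{1..<Suc ?n}. \<alpha> j = \<beta> \<pi> j \<Longrightarrow> (\<Sum>j<Suc ?n. \<alpha> j) = int m \<Longrightarrow>
      colouring_character m (Suc ?n) \<alpha> g = rho m (P \<pi>) g" by metis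
  define Q where "Q = (\<Sum>\<pi>\<in>?\<Pi>. poly_scale (of_int (sign \<pi>)) (P \<pi>))"
  have "weight_le (sum_list l) Q"
    unfolding Q_def using P by (intro weight_le_sum weight_le_scale) auto
  moreover have "rep_character (specht (padded l m)) g = rho m Q g"
    if m: "sum_list l + first_part l \<le> m" and g: "g permutes {1..m}" for m g
  proof -
    note pad = padded_eq[OF l m]
    interpret tableau_shape "padded l m" by unfold_locales (rule pad(3))
    have len: "length (padded l m) \<le> Suc ?n" using pad(1) by simp
    have part: "part (padded l m) j = l ! (j - 1)" if j: "j \<in> {1..<Suc ?n}" for j
    proof -
      obtain i where "j = Suc i" "i < ?n" using j by (cases j) auto
      then show ?thesis using pad(1,2) by (auto simp: part_def)
    qed
    have "rep_character (specht (padded l m)) g = jacobi_trudi m (Suc ?n) (part (padded l m)) g"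
      using specht_character_jacobi_trudi[OF len] g unfolding pad(4) by blast
    also have "\<dots> = (\<Sum>\<pi>\<in>?\<Pi>. of_int (sign \<pi>) * rho m (P \<pi>) g)"
      unfolding jacobi_trudi_def
    proof (rule sum.cong[OF refl])
      fix \<pi> assume "\<pi> \<in> ?\<Pi>"
      then have \<pi>: "\<pi> permutes {..<Suc ?n}" by simp
      have "(\<Sum>j<Suc ?n. int (part (padded l m) j) + int (\<pi> j) - int j) = int m"
        unfolding sum_permuted_shape[OF \<pi>] sum_part[OF len] pad(4) ..
      moreover have "\<forall>j\<in>{1..<Suc ?n}. int (part (padded l m) j) + int (\<pi> j) - int j = \<beta> \<pi> j"
        by (simp add: part \<beta>_def)
      ultimately have "colouring_character m (Suc ?n) (\<lambda>j. int (part (padded l m) j) + int (\<pi> j) - int j) g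
          = rho m (P \<pi>) g"
        by (intro P_eq[OF \<pi> g])
      then show "of_int (sign \<pi>) * colouring_character m (Suc ?n) (\<lambda>j. int (part (padded l m) j) + int (\<pi> j) - int j) g
          = of_int (sign \<pi>) * rho m (P \<pi>) g" by simp
    qed
    also have "\<dots> = rho m Q g"
      by (simp add: Q_def rho_eq_poly_value poly_value_sum poly_value_scale)
    finally show ?thesis .
  qed
  ultimately show ?thesis by blast
qed

section \<open>The character polynomials span\<close>

definition char_poly :: "nat list \<Rightarrow> cycle_poly" where
  "char_poly l = (SOME P. weight_le (sum_list l) P \<and> (\<forall>m g. sum_list l + first_part l \<le> m \<longrightarrow>
    g permutes {1..m} \<longrightarrow> rep_character (specht (padded l m)) g = rho m P g))"

lemma
  assumes "is_partition l"
  shows char_poly_weight: "weight_le (sum_list l) (char_poly l)"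
    and char_poly_character: "sum_list l + first_part l \<le> m \<Longrightarrow> g permutes {1..m} \<Longrightarrow>
      rep_character (specht (padded l m)) g = rho m (char_poly l) g"
  using someI_ex[OF specht_character_polynomial[OF assms]] unfolding char_poly_def by blast+

definition partitions_upto :: "nat \<Rightarrow> nat list set" where
  "partitions_upto d = {l. is_partition l \<and> sum_list l \<le> d}"

lemma finite_partitions_upto: "finite (partitions_upto d)"
proof (rule finite_subset)
  show "partitions_upto d \<subseteq> {l. set l \<subseteq> {..d} \<and> length l \<le> d}"
  proof
    fix l assume "l \<in> partitions_upto d"
    then have l: "0 \<notin> set l" "sum_list l \<le> d" by (auto simp: partitions_upto_def is_partition_def)
    have "length l \<le> sum_list l" using l(1) by (induction l) auto
    moreover have "k \<le> d" if "k \<in> set l" for k using member_le_sum_list[OF that] l(2) by simp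
    ultimately show "l \<in> {l. set l \<subseteq> {..d} \<and> length l \<le> d}" using l(2) by auto
  qed
  show "finite {l. set l \<subseteq> {..d} \<and> length l \<le> d}" by (rule finite_lists_length_le) simp
qed

lemma first_part_le_sum_list: "first_part l \<le> sum_list l"
  by (cases l) (auto simp: first_part_def)

lemma finite_stable_partitions: "finite (stable_partitions N)"
  by (rule finite_subset[OF _ finite_partitions_upto[of N]])
     (auto simp: stable_partitions_def partitions_upto_def)

lemma stable_partitions_simple:
  assumes "l \<in> stable_partitions m"
  shows "absolutely_simple m (specht (padded l m))"
proof -
  have l: "is_partition l" "sum_list l + first_part l \<le> m" using assms by (auto simp: stable_partitions_def)
  interpret tableau_shape "padded l m" by unfold_locales (rule padded_eq(3)[OF l])
  show ?thesis using specht_absolutely_simple by (simp add: padded_eq(4)[OF l])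
qed

lemma stable_partitions_orthogonal:
  assumes "l \<in> stable_partitions m" "l' \<in> stable_partitions m" "l \<noteq> l'"
  shows "char_inner m (rep_character (specht (padded l m))) (rep_character (specht (padded l' m))) = 0"
proof -
  have l: "is_partition l" "sum_list l + first_part l \<le> m"
    and l': "is_partition l'" "sum_list l' + first_part l' \<le> m"
    using assms by (auto simp: stable_partitions_def)
  have "padded l m \<noteq> padded l' m" using padded_eq(5)[OF l] padded_eq(5)[OF l'] assms(3) by metis
  then show ?thesis by (intro specht_orthogonal padded_eq(3,4) l l')
qed

text \<open>
  Monomials of weight \<open>d\<close> correspond to partitions of \<open>d\<close>: the exponent at index \<open>i\<close> becomes the
  multiplicity of the part \<open>i + 1\<close>. An injection from monomials to partitions suffices for
  comparing dimensions.
\<close>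

primrec partition_of :: "monomial \<Rightarrow> nat \<Rightarrow> nat list" where
  "partition_of a 0 = []"
| "partition_of a (Suc d) = replicate (lookup a d) (Suc d) @ partition_of a d"

lemma set_partition_of: "set (partition_of a d) \<subseteq> {1..d}"
  by (induction d) (auto simp: atLeastAtMost_iff set_replicate_conv_if)

lemma is_partition_partition_of: "is_partition (partition_of a d)"
proof -
  have "sorted_wrt (\<ge>) (partition_of a d)"
  proof (induction d)
    case (Suc d)
    have "sorted_wrt (\<ge>) (replicate n k)" for n k :: nat by (induction n) auto
    then show ?case using Suc set_partition_of[of a d]
      by (auto simp: sorted_wrt_append set_replicate_conv_if atLeastAtMost_iff subset_iff split: if_splits)
  qed simp
  then show ?thesis using set_partition_of[of a d] by (auto simp: is_partition_def atLeastAtMost_iff)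
qed

lemma sum_list_partition_of: "sum_list (partition_of a d) = (\<Sum>i<d. (i + 1) * lookup a i)"
  by (induction d) (simp_all add: sum_list_replicate algebra_simps)

lemma count_partition_of:
  "count (mset (partition_of a d)) (Suc i) = (if i < d then lookup a i else 0)"
  by (induction d) (auto simp: less_Suc_eq)

lemma keys_weight_le:
  assumes "weight a \<le> d"
  shows "keys a \<subseteq> {..<d}"
proof
  fix i assume i: "i \<in> keys a"
  then have "1 \<le> lookup a i" by (simp add: in_keys_iff Suc_le_eq)
  then have "i + 1 \<le> (i + 1) * lookup a i" by simp
  also have "\<dots> \<le> weight a" unfolding weight_def using i by (intro member_le_sum) auto
  finally show "i \<in> {..<d}" using assms by simp
qed

lemma card_monomials_le:
  "finite {a. weight a \<le> d} \<and> card {a. weight a \<le> d} \<le> card (partitions_upto d)"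
proof -
  let ?p = "\<lambda>a. partition_of a d"
  have inj: "inj_on ?p {a. weight a \<le> d}"
  proof (rule inj_onI)
    fix a b assume a: "a \<in> {a. weight a \<le> d}" and b: "b \<in> {a. weight a \<le> d}" and eq: "?p a = ?p b"
    show "a = b"
    proof (rule poly_mapping_eqI)
      fix i
      show "lookup a i = lookup b i"
      proof (cases "i < d")
        case True
        then show ?thesis using count_partition_of[of a d i] count_partition_of[of b d i] eq by simp
      next
        case False
        then have "i \<notin> keys a" "i \<notin> keys b"
          using keys_weight_le[of a d] keys_weight_le[of b d] a b by auto
        then show ?thesis by (simp add: in_keys_iff)
      qed
    qed
  qed
  have sub: "?p ` {a. weight a \<le> d} \<subseteq> partitions_upto d"
  proof (rule image_subsetI)
    fix a assume a: "a \<in> {a. weight a \<le> d}"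
    then have "weight a = sum_list (?p a)"
      using weight_superset[OF finite_lessThan keys_weight_le] by (simp add: sum_list_partition_of)
    then show "?p a \<in> partitions_upto d"
      using a is_partition_partition_of by (simp add: partitions_upto_def)
  qed
  show ?thesis
    using inj_on_finite[OF inj sub finite_partitions_upto] card_inj_on_le[OF inj sub finite_partitions_upto] by blast
qed

lemma rho_lincomb:
  "rho m (\<Sum>l\<in>L. poly_scale (c l) (P l)) g = (\<Sum>l\<in>L. c l * rho m (P l) g)"
  by (simp add: rho_eq_poly_value poly_value_sum poly_value_scale)

text \<open>
  For \<open>m \<ge> 2 d\<close> all the partitions \<open>\<lambda>[m]\<close> with \<open>|\<lambda>| \<le> d\<close> exist, as \<open>\<lambda>\<^sub>1 \<le> |\<lambda>|\<close>, and the
  polynomials take the values of orthonormal characters.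
\<close>

lemma char_poly_coefficients_vanish:
  assumes m: "2 * d \<le> m"
    and zero: "\<And>g. g permutes {1..m} \<Longrightarrow> rho m (\<Sum>l\<in>partitions_upto d. poly_scale (c l) (char_poly l)) g = 0"
    and k: "k \<in> partitions_upto d"
  shows "c k = 0"
proof -
  let ?L = "partitions_upto d"
  let ?\<chi> = "\<lambda>l. rep_character (specht (padded l m))"
  have stable: "l \<in> stable_partitions m" if "l \<in> ?L" for l
    using that first_part_le_sum_list[of l] m by (auto simp: partitions_upto_def stable_partitions_def)
  have "(\<Sum>l\<in>?L. c l * ?\<chi> l g) = 0" if g: "g permutes {1..m}" for g
  proof -
    have "(\<Sum>l\<in>?L. c l * ?\<chi> l g) = (\<Sum>l\<in>?L. c l * rho m (char_poly l) g)"
      using stable by (intro sum.cong) (auto simp: stable_partitions_def char_poly_character g)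
    then show ?thesis using zero[OF g] by (simp add: rho_lincomb)
  qed
  then have "char_inner m (?\<chi> k) (\<lambda>g. \<Sum>l\<in>?L. c l * ?\<chi> l g) = 0"
    by (simp add: char_inner_def)
  then have "(\<Sum>l\<in>?L. c l * char_inner m (?\<chi> k) (?\<chi> l)) = 0"
    by (simp only: char_inner_lincomb)
  moreover have "(\<Sum>l\<in>?L. c l * char_inner m (?\<chi> k) (?\<chi> l)) = (\<Sum>l\<in>?L. if l = k then c k else 0)"
    using stable_partitions_orthogonal[OF stable[OF k] stable]
      absolutely_simple_norm[OF stable_partitions_simple[OF stable[OF k]]]
    by (intro sum.cong refl) auto
  ultimately show ?thesis using k finite_partitions_upto by simp
qed

text \<open>
  Independent vectors, at least as many as a spanning set has, span as well.
\<close>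

theorem char_poly_spans:
  assumes P: "weight_le d P"
  shows "\<exists>c. P = (\<Sum>l\<in>partitions_upto d. poly_scale (c l) (char_poly l))"
proof -
  let ?L = "partitions_upto d"
  define B where "B = (\<lambda>a. single a (1::rat)) ` {a. weight a \<le> d}"
  have in_span: "Q \<in> cycle_polys.span B" if Q: "weight_le d Q" for Q
  proof -
    have "Q = (\<Sum>a\<in>keys Q. poly_scale (lookup Q a) (single a 1))"
    proof (rule poly_mapping_eqI)
      fix b
      have "lookup (\<Sum>a\<in>keys Q. poly_scale (lookup Q a) (single a 1)) b
          = (\<Sum>a\<in>keys Q. if a = b then lookup Q a else 0)"
        unfolding lookup_sum by (intro sum.cong) (auto simp: lookup_poly_scale lookup_single when_def)
      then show "lookup Q b
          = lookup (\<Sum>a\<in>keys Q. poly_scale (lookup Q a) (single a 1)) b"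
        by (simp add: in_keys_iff)
    qed
    also have "\<dots> \<in> cycle_polys.span B"
      using Q unfolding B_def weight_le_def
      by (intro cycle_polys.span_sum cycle_polys.span_scale cycle_polys.span_base) blast
    finally show ?thesis .
  qed
  have indep: "c k = 0" if "(\<Sum>l\<in>?L. poly_scale (c l) (char_poly l)) = 0" "k \<in> ?L" for c k
    using char_poly_coefficients_vanish[OF order_refl _ that(2), of c] that(1)
    by (simp add: rho_eq_poly_value poly_value_0)
  have inj: "inj_on char_poly ?L"
  proof (rule inj_onI, rule ccontr)
    fix k l assume kl: "k \<in> ?L" "l \<in> ?L" "char_poly k = char_poly l" "k \<noteq> l"
    let ?c = "\<lambda>j. if j = k then 1 else if j = l then - 1 else (0::rat)"
    have "(\<Sum>j\<in>?L. poly_scale (?c j) (char_poly j)) = (\<Sum>j\<in>{k, l}. poly_scale (?c j) (char_poly j))"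
      using kl finite_partitions_upto by (intro sum.mono_neutral_right) auto
    also have "\<dots> = 0" using kl(3,4) by simp
    finally show False using indep[of ?c k] kl(1) by simp
  qed
  have "cycle_polys.independent (char_poly ` ?L)"
  proof
    assume "cycle_polys.dependent (char_poly ` ?L)"
    then obtain u where u: "\<exists>v\<in>char_poly ` ?L. u v \<noteq> 0" "(\<Sum>v\<in>char_poly ` ?L. poly_scale (u v) v) = 0"
      using cycle_polys.dependent_finite[OF finite_imageI[OF finite_partitions_upto]] by blast
    then have "(\<Sum>l\<in>?L. poly_scale (u (char_poly l)) (char_poly l)) = 0"
      by (simp add: sum.reindex[OF inj])
    then show False using indep[of "\<lambda>l. u (char_poly l)"] u(1) by blast
  qed
  note indep_image = this
  have fin_B: "finite B" using card_monomials_le[of d] by (simp add: B_def)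
  have "char_poly ` ?L \<subseteq> cycle_polys.span B"
  proof (rule image_subsetI)
    fix l assume "l \<in> ?L"
    then have "weight_le d (char_poly l)"
      using char_poly_weight[of l] unfolding partitions_upto_def weight_le_def by fastforce
    then show "char_poly l \<in> cycle_polys.span B" by (rule in_span)
  qed
  note image_span = this
  have card_B: "card B \<le> card (char_poly ` ?L)"
  proof -
    have "card B \<le> card {a. weight a \<le> d}"
      unfolding B_def using card_monomials_le by (intro card_image_le) blast
    also have "\<dots> \<le> card (char_poly ` ?L)" using card_monomials_le[of d] by (simp add: card_image[OF inj])
    finally show ?thesis .
  qed
  \<comment> \<open>a monomial outside of the span would give too large an independent set\<close>
  have "b \<in> cycle_polys.span (char_poly ` ?L)" if b: "b \<in> B" for b
  proof (rule ccontr)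
    assume out: "b \<notin> cycle_polys.span (char_poly ` ?L)"
    then have "b \<notin> char_poly ` ?L" using cycle_polys.span_base by blast
    then have "card B < card (insert b (char_poly ` ?L))"
      using card_B finite_partitions_upto by (simp add: card_insert_if)
    moreover have "card (insert b (char_poly ` ?L)) \<le> card B"
    proof -
      have "insert b (char_poly ` ?L) \<subseteq> cycle_polys.span B"
        using b image_span cycle_polys.span_base by blast
      from cycle_polys.independent_span_bound[OF fin_B cycle_polys.independent_insertI[OF out indep_image] this]
      show ?thesis by blast
    qed
    ultimately show False by simp
  qed
  then have "cycle_polys.span B \<subseteq> cycle_polys.span (char_poly ` ?L)"
    by (intro cycle_polys.span_minimal cycle_polys.subspace_span) blast
  then have "P \<in> cycle_polys.span (char_poly ` ?L)" using in_span[OF P] by blast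
  then obtain u where "P = (\<Sum>v\<in>char_poly ` ?L. poly_scale (u v) v)"
    using cycle_polys.span_finite[OF finite_imageI[OF finite_partitions_upto]] by blast
  then show ?thesis by (auto simp: sum.reindex[OF inj])
qed

lemma ex_weight_le: "\<exists>d. weight_le d P"
  unfolding weight_le_def by (metis finite_keys finite_imageI Max_ge imageI)

text \<open>
  Uniqueness of the polynomial character: the difference is a combination of the character polynomials,
  and its coefficients vanish as soon as its values do for one large \<open>m\<close>.
\<close>

lemma rho_eq_imp_eq:
  assumes "\<And>m g. N \<le> m \<Longrightarrow> g permutes {1..m} \<Longrightarrow> rho m P g = rho m Q g"
  shows "P = Q"
proof -
  obtain d where "weight_le d (P - Q)" using ex_weight_le by blast
  then obtain c where c: "P - Q = (\<Sum>l\<in>partitions_upto d. poly_scale (c l) (char_poly l))"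
    using char_poly_spans by blast
  define m where "m = max N (2 * d)"
  have "rho m (P - Q) g = 0" if "g permutes {1..m}" for g
    using assms[of m g] that by (simp add: m_def rho_eq_poly_value poly_value_diff)
  then have "c l = 0" if "l \<in> partitions_upto d" for l
    using char_poly_coefficients_vanish[of d m c l] that unfolding c by (simp add: m_def)
  then have "P - Q = 0" unfolding c by (intro sum.neutral) simp
  then show ?thesis by simp
qed

lemma polynomial_character_eq:
  assumes "polynomial_from N W P"
  shows "polynomial_character W = P"
  unfolding polynomial_character_def
proof (rule the_equality)
  show "\<exists>N. polynomial_from N W P" using assms by blast
  fix Q assume "\<exists>N. polynomial_from N W Q"
  then obtain N' where Q: "polynomial_from N' W Q" by blast
  show "Q = P"
  proof (rule rho_eq_imp_eq)
    fix m g assume "max N N' \<le> m" "g permutes {1..m}"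
    then show "rho m Q g = rho m P g" using assms Q unfolding polynomial_from_def by (metis max.bounded_iff)
  qed
qed

section \<open>Representation stability and character polynomiality\<close>

lemma specht_scale_0: "scale (specht \<nu>) c 0 = 0"
  by (simp add: specht_def fun_eq_iff)

lemma stable_partitions_mono: "N \<le> m \<Longrightarrow> stable_partitions N \<subseteq> stable_partitions m"
  by (auto simp: stable_partitions_def)

lemma RS_from_imp_PC_from:
  assumes W: "FB_module W" and RS: "RS_from N W"
  shows "PC_from N W"
proof -
  obtain n where n: "\<And>m. N \<le> m \<Longrightarrow> rep_iso m (W m)
      (direct_sum {(l, j). l \<in> stable_partitions N \<and> j < n l} (\<lambda>(l, j :: nat). specht (padded l m)))"
    using RS unfolding RS_from_def by blast
  let ?L = "stable_partitions N"
  define P where "P = (\<Sum>l\<in>?L. poly_scale (of_nat (n l)) (char_poly l))"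
  have "rep_character (W m) g = rho m P g" if m: "N \<le> m" and g: "g permutes {1..m}" for m g
  proof -
    let ?I = "{(l, j). l \<in> ?L \<and> j < n l}"
    have I: "?I = (SIGMA l:?L. {..<n l})" by auto
    have "rep_character (W m) g = (\<Sum>i\<in>?I. rep_character ((\<lambda>(l, j). specht (padded l m)) i) g)"
    proof (rule rep_character_direct_sum[OF _ _ _ _ n[OF m] g])
      show "sym_module m (W m)" using W unfolding FB_module_def by blast
      show "finite ?I" unfolding I by (intro finite_SigmaI finite_stable_partitions) auto
      show "sym_module m ((\<lambda>(l, j :: nat). specht (padded l m)) i)" if "i \<in> ?I" for i
        using that stable_partitions_mono[OF m] stable_partitions_simple[of _ m]
        by (auto simp: absolutely_simple_def)
      show "scale ((\<lambda>(l, j :: nat). specht (padded l m)) i) c 0 = 0" for i c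
        by (simp add: specht_scale_0 split: prod.split)
    qed
    also have "\<dots> = (\<Sum>l\<in>?L. \<Sum>j<n l. rep_character (specht (padded l m)) g)"
      unfolding I by (subst sum.Sigma) (auto simp: finite_stable_partitions case_prod_unfold)
    also have "\<dots> = (\<Sum>l\<in>?L. of_nat (n l) * rho m (char_poly l) g)"
      using m g by (intro sum.cong) (auto simp: char_poly_character stable_partitions_def)
    finally show ?thesis by (simp add: P_def rho_lincomb)
  qed
  then show ?thesis unfolding PC_from_def polynomial_from_def by blast
qed

text \<open>
  In the basis of the character polynomials only those with \<open>|\<lambda>| \<le> d\<close> occur in \<open>P\<close>, and their range
  of validity \<open>m \<ge> |\<lambda>| + \<lambda>\<^sub>1\<close> contains \<open>m \<ge> 2 d\<close>. The multiplicities are the coefficients of \<open>P\<close>,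
  which settles their independence of \<open>m\<close>. The zero
  polynomial has degree \<open>-\<infinity>\<close>, hence the case distinction in the bound.
\<close>

lemma PC_imp_RS_from:
  assumes W: "FB_module W" and P: "polynomial_from N W P" and d: "weight_le d P" "P \<noteq> 0 \<longrightarrow> 2 * d \<le> N"
  shows "RS_from N W"
proof -
  let ?L = "stable_partitions N"
  have "\<exists>c. P = (\<Sum>l\<in>?L. poly_scale (c l) (char_poly l))"
  proof (cases "P = 0")
    case True
    then show ?thesis by (intro exI[of _ "\<lambda>_. 0"]) simp
  next
    case False
    obtain c where c: "P = (\<Sum>l\<in>partitions_upto d. poly_scale (c l) (char_poly l))"
      using char_poly_spans[OF d(1)] by blast
    have sub: "partitions_upto d \<subseteq> ?L"
    proof
      fix l assume "l \<in> partitions_upto d"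
      then show "l \<in> ?L"
        using d(2) False first_part_le_sum_list[of l] by (auto simp: partitions_upto_def stable_partitions_def)
    qed
    have "P = (\<Sum>l\<in>?L. poly_scale (if l \<in> partitions_upto d then c l else 0) (char_poly l))"
      unfolding c by (rule sum.mono_neutral_cong_left[OF finite_stable_partitions sub]) auto
    then show ?thesis by (rule exI[of _ "\<lambda>l. if l \<in> partitions_upto d then c l else 0"])
  qed
  then obtain c where c: "P = (\<Sum>l\<in>?L. poly_scale (c l) (char_poly l))" by blast
  have decompose: "\<exists>n. (\<forall>l\<in>?L. c l = of_nat (n l)) \<and>
      rep_iso m (W m) (direct_sum {(l, j). l \<in> ?L \<and> j < n l} (\<lambda>(l, j :: nat). specht (padded l m)))"
    if m: "N \<le> m" for m
  proof (rule decomposition_from_character[where S = "\<lambda>l. specht (padded l m)"])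
    show "finite ?L" by (rule finite_stable_partitions)
    show "sym_module m (W m)" using W unfolding FB_module_def by blast
    show "absolutely_simple m (specht (padded l m))" if "l \<in> ?L" for l
      using that stable_partitions_mono[OF m] by (intro stable_partitions_simple) blast
    show "char_inner m (rep_character (specht (padded l m))) (rep_character (specht (padded l' m))) = 0"
      if "l \<in> ?L" "l' \<in> ?L" "l \<noteq> l'" for l l'
      using that stable_partitions_mono[OF m] by (intro stable_partitions_orthogonal) auto
    show "scale (specht (padded l m)) k 0 = 0" for l k by (rule specht_scale_0)
    show "rep_character (W m) g = (\<Sum>l\<in>?L. c l * rep_character (specht (padded l m)) g)"
      if g: "g permutes {1..m}" for g
    proof -
      have "rep_character (W m) g = rho m P g" using P m g unfolding polynomial_from_def by blast
      also have "\<dots> = (\<Sum>l\<in>?L. c l * rho m (char_poly l) g)" unfolding c by (rule rho_lincomb)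
      also have "\<dots> = (\<Sum>l\<in>?L. c l * rep_character (specht (padded l m)) g)"
        using m g by (intro sum.cong) (auto simp: char_poly_character stable_partitions_def)
      finally show ?thesis .
    qed
  qed
  obtain n where n: "\<And>l. l \<in> ?L \<Longrightarrow> c l = of_nat (n l)"
    using decompose[OF order_refl] by blast
  have "rep_iso m (W m) (direct_sum {(l, j). l \<in> ?L \<and> j < n l} (\<lambda>(l, j :: nat). specht (padded l m)))"
    if m: "N \<le> m" for m
  proof -
    obtain n' where n': "\<forall>l\<in>?L. c l = of_nat (n' l)"
      and iso: "rep_iso m (W m) (direct_sum {(l, j). l \<in> ?L \<and> j < n' l} (\<lambda>(l, j :: nat). specht (padded l m)))"
      using decompose[OF m] by blast
    have "n' l = n l" if "l \<in> ?L" for l using n[OF that] bspec[OF n' that] by simp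
    then have "{(l, j). l \<in> ?L \<and> j < n' l} = {(l, j). l \<in> ?L \<and> j < n l}" by auto
    with iso show ?thesis by simp
  qed
  then show ?thesis unfolding RS_from_def by blast
qed

theorem theorem4p1p1:
  fixes W :: "nat \<Rightarrow> 'v::ab_group_add sym_rep"
  assumes "FB_module W"
  shows "(RS W \<longrightarrow> PC W \<and> rank_PC W \<le> rank_RS W) \<and>
    (PC W \<longrightarrow> RS W \<and>
      ereal (real (rank_RS W))
        \<le> max (ereal (real (rank_PC W))) (2 * deg_w (polynomial_character W)))"
proof (intro conjI impI)
  assume "RS W"
  then have "RS_from (rank_RS W) W" unfolding RS_def rank_RS_def by (rule LeastI_ex)
  then have PC: "PC_from (rank_RS W) W" by (rule RS_from_imp_PC_from[OF assms])
  then show "PC W" unfolding PC_def by blast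
  from PC show "rank_PC W \<le> rank_RS W" unfolding rank_PC_def by (rule Least_le)
next
  assume "PC W"
  then have "PC_from (rank_PC W) W" unfolding PC_def rank_PC_def by (rule LeastI_ex)
  then obtain P where P: "polynomial_from (rank_PC W) W P" unfolding PC_from_def by blast
  have char: "polynomial_character W = P" by (rule polynomial_character_eq[OF P])
  define d where "d = (if P = 0 then 0 else Max (weight ` keys P))"
  define N where "N = max (rank_PC W) (2 * d)"
  have "weight_le d P" unfolding weight_le_def d_def by auto
  moreover have "polynomial_from N W P" using P unfolding polynomial_from_def N_def by simp
  ultimately have RS: "RS_from N W" by (intro PC_imp_RS_from[OF assms]) (auto simp: N_def)
  then show "RS W" unfolding RS_def by blast
  from RS have "rank_RS W \<le> N" unfolding rank_RS_def by (rule Least_le)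
  then have "ereal (real (rank_RS W)) \<le> ereal (real N)" by simp
  also have "\<dots> \<le> max (ereal (real (rank_PC W))) (2 * deg_w (polynomial_character W))"
    unfolding char N_def deg_w_def d_def by (auto simp: max_def)
  finally show "ereal (real (rank_RS W)) \<le> max (ereal (real (rank_PC W))) (2 * deg_w (polynomial_character W))" .
qed

end
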